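(* Let $E$ be a finite-dimensional $k$-vector space with linear coordinates $x_1,\dots,x_n,y_1,\dots,y_n$ (a basis of $E^*$), let $A=T(E^* )$ be the tensor algebra, and let $\omega=\sum_i dx_i\otimes dy_i\in\mathrm{DR}^2(A)$, a noncommutative symplectic structure on $A$. There is a natural Lie algebra central extension $$0\to k\to A/[A,A]\to\mathrm{Der}_\omega(A)\to0.$$
   Context: $k$ is an algebraically closed field of characteristic zero. $\Omega^1_{nc}(A)=\ker(A\otimes A\xrightarrow{\text{mult}}A)$, $\Omega^\bullet_{nc}(A)=T_A\Omega^1_{nc}(A)$ with differential $d(a_0\,da_1\cdots da_m)=da_0\,da_1\cdots da_m$; $\mathrm{DR}^\bullet(A)$ is its quotient by the span of super-commutators, with the induced differential; $\mathrm{DR}^0(A)=A/[A,A]$. The element $dx_i\otimes dy_i$ is the class of the form $dx_i\,dy_i$. For $\theta\in\mathrm{Der}(A)$, $i_\theta$ is the degree $-1$ super-derivation with $i_\theta(a)=0$, $i_\theta(da)=\theta(a)$, and $L_\theta=di_\theta+i_\theta d$; both descend to $\mathrm{DR}^\bullet(A)$. The form $\omega$ is closed and nondegenerate, i.e. $\mathrm{Der}(A)\to\mathrm{DR}^1(A)$, $\theta\mapsto i_\theta\omega$, is bijective. $\mathrm{Der}_\omega(A)=\{\theta\in\mathrm{Der}(A):L_\theta\omega=0\}$ with the commutator bracket. For $f\in A/[A,A]$, $\theta_f$ is the unique derivation with $i_{\theta_f}\omega=df$. The Lie bracket on $A/[A,A]$ is $\{f,g\}=i_{\theta_f}(dg)$.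 The map $A/[A,A]\to\mathrm{Der}_\omega(A)$ is $f\mapsto\theta_f$, and $k\to A/[A,A]$ is the inclusion of constants. *)

theory Defs
  imports
    "HOL-Algebra.Algebra"
    "HOL-Algebra.Algebraic_Closure_Type"
    "HOL-Library.Poly_Mapping"
    "HOL-Library.Function_Algebras"
begin

text \<open>
  Conventions. Scalars live in a field type. An associative \<open>k\<close>-algebra is a record of type
  \<open>('k, 'a) module\<close>, i.e. a ring together with a scalar multiplication by all of the type \<open>'k\<close>.
  Quotients are sets of cosets, as in HOL-Algebra.
\<close>

text \<open>The map that a function constant on cosets induces on the set of cosets.\<close>

definition induced :: "('a \<Rightarrow> 'b) \<Rightarrow> 'a set \<Rightarrow> 'b"
  where "induced f Y = the_elem (f ` Y)"


section \<open>The tensor algebra of a bimodule\<close>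

text \<open>Left action \<open>r \<odot> m\<close>; only the additive part of the underlying ring record is used.\<close>

record ('r, 'm) bimodule = "('r, 'm) module" +
  rsmult :: "'m \<Rightarrow> 'r \<Rightarrow> 'm"

text \<open>Words form the free monoid, so \<open>'x list \<Rightarrow>\<^sub>0 int\<close> with its convolution product is the
  free (noncommutative) ring on \<open>'x\<close>.\<close>

instantiation list :: (type) monoid_add
begin
definition zero_list_def: "(0 :: 'a list) = []"
definition plus_list_def: "(xs :: 'a list) + ys = xs @ ys"
instance by standard (simp_all add: zero_list_def plus_list_def)
end

definition free_ring :: "'x set \<Rightarrow> ('x list \<Rightarrow>\<^sub>0 int) ring"
  where "free_ring Y =
    \<lparr>carrier = {p. Poly_Mapping.keys p \<subseteq> lists Y},
     monoid.mult = (*), one = 1, ring.zero = 0, add = (+)\<rparr>"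

type_synonym ('r, 'm) ten = "(('r + 'm) list \<Rightarrow>\<^sub>0 int) set"

text \<open>
  \<open>T\<^sub>R(M)\<close> is the ring generated by \<open>R\<close> and \<open>M\<close>, subject to the relations of the ring \<open>R\<close> and of
  the \<open>R\<close>-bimodule \<open>M\<close>. The relations are homogeneous in the number of letters from \<open>M\<close>, and
  the component of degree \<open>q\<close> is the \<open>q\<close>-fold tensor power of \<open>M\<close> over \<open>R\<close>
  (\<open>R\<close> itself for \<open>q = 0\<close>).
\<close>

definition ten_rels ::
    "('r, 'z) ring_scheme \<Rightarrow> ('r, 'm) bimodule \<Rightarrow> (('r + 'm) list \<Rightarrow>\<^sub>0 int) set"
  where "ten_rels R M =
      {frag_of [Inl (a \<oplus>\<^bsub>R\<^esub> b)] - frag_of [Inl a] - frag_of [Inl b]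
        | a b. a \<in> carrier R \<and> b \<in> carrier R}
    \<union> {frag_of [Inl (a \<otimes>\<^bsub>R\<^esub> b)] - frag_of [Inl a, Inl b]
        | a b. a \<in> carrier R \<and> b \<in> carrier R}
    \<union> {frag_of [Inl \<one>\<^bsub>R\<^esub>] - frag_of []}
    \<union> {frag_of [Inr (m \<oplus>\<^bsub>M\<^esub> m')] - frag_of [Inr m] - frag_of [Inr m']
        | m m'. m \<in> carrier M \<and> m' \<in> carrier M}
    \<union> {frag_of [Inr (a \<odot>\<^bsub>M\<^esub> m)] - frag_of [Inl a, Inr m]
        | a m. a \<in> carrier R \<and> m \<in> carrier M}
    \<union> {frag_of [Inr (rsmult M m a)] - frag_of [Inr m, Inl a]
        | a m. a \<in> carrier R \<and> m \<in> carrier M}"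

definition ten_free :: "('r, 'z) ring_scheme \<Rightarrow> ('r, 'm) bimodule \<Rightarrow> (('r + 'm) list \<Rightarrow>\<^sub>0 int) ring"
  where "ten_free R M = free_ring (carrier R <+> carrier M)"

definition ten_ideal :: "('r, 'z) ring_scheme \<Rightarrow> ('r, 'm) bimodule \<Rightarrow> (('r + 'm) list \<Rightarrow>\<^sub>0 int) set"
  where "ten_ideal R M = Idl\<^bsub>ten_free R M\<^esub> (ten_rels R M)"

definition ten_class ::
    "('r, 'z) ring_scheme \<Rightarrow> ('r, 'm) bimodule \<Rightarrow> (('r + 'm) list \<Rightarrow>\<^sub>0 int) \<Rightarrow> ('r, 'm) ten"
  where "ten_class R M p = ten_ideal R M +>\<^bsub>ten_free R M\<^esub> p"

definition ten_base :: "('r, 'z) ring_scheme \<Rightarrow> ('r, 'm) bimodule \<Rightarrow> 'r \<Rightarrow> ('r, 'm) ten"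
  where "ten_base R M r = ten_class R M (frag_of [Inl r])"

definition ten_gen :: "('r, 'z) ring_scheme \<Rightarrow> ('r, 'm) bimodule \<Rightarrow> 'm \<Rightarrow> ('r, 'm) ten"
  where "ten_gen R M m = ten_class R M (frag_of [Inr m])"

definition tensor_algebra ::
    "('r, 'z) ring_scheme \<Rightarrow> ('r, 'm) bimodule \<Rightarrow> ('r, ('r, 'm) ten) module"
  where "tensor_algebra R M =
    (let Q = ten_free R M Quot ten_ideal R M in
     \<lparr>carrier = carrier Q, monoid.mult = monoid.mult Q, one = \<one>\<^bsub>Q\<^esub>,
      ring.zero = \<zero>\<^bsub>Q\<^esub>, add = add Q,
      module.smult = (\<lambda>r Y. ten_base R M r \<otimes>\<^bsub>Q\<^esub> Y)\<rparr>)"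

definition ten_degree :: "('r, 'z) ring_scheme \<Rightarrow> ('r, 'm) bimodule \<Rightarrow> nat \<Rightarrow> ('r, 'm) ten set"
  where "ten_degree R M q = ten_class R M `
    {p \<in> carrier (ten_free R M). \<forall>w \<in> Poly_Mapping.keys p. length (filter (\<lambda>l. \<not> isl l) w) = q}"


section \<open>Noncommutative differential forms\<close>

text \<open>\<open>A \<otimes>\<^sub>k A\<close> as the free abelian group on \<open>A \<times> A\<close> modulo biadditivity and \<open>k\<close>-balancedness,
  with the outer \<open>A\<close>-bimodule structure.\<close>

type_synonym 'a tsq = "('a \<times> 'a \<Rightarrow>\<^sub>0 int) set"

definition tsq_rels :: "('k, 'a) module \<Rightarrow> ('a \<times> 'a \<Rightarrow>\<^sub>0 int) set"
  where "tsq_rels A =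
      {frag_of (a \<oplus>\<^bsub>A\<^esub> a', b) - frag_of (a, b) - frag_of (a', b)
        | a a' b. a \<in> carrier A \<and> a' \<in> carrier A \<and> b \<in> carrier A}
    \<union> {frag_of (a, b \<oplus>\<^bsub>A\<^esub> b') - frag_of (a, b) - frag_of (a, b')
        | a b b'. a \<in> carrier A \<and> b \<in> carrier A \<and> b' \<in> carrier A}
    \<union> {frag_of (c \<odot>\<^bsub>A\<^esub> a, b) - frag_of (a, c \<odot>\<^bsub>A\<^esub> b)
        | c a b. a \<in> carrier A \<and> b \<in> carrier A}"

definition tsq_free :: "('k, 'a) module \<Rightarrow> ('a \<times> 'a \<Rightarrow>\<^sub>0 int) monoid"
  where "tsq_free A = free_Abelian_group (carrier A \<times> carrier A)"

definition tsq_class :: "('k, 'a) module \<Rightarrow> ('a \<times> 'a \<Rightarrow>\<^sub>0 int) \<Rightarrow> 'a tsq"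
  where "tsq_class A p = generate (tsq_free A) (tsq_rels A) #>\<^bsub>tsq_free A\<^esub> p"

definition tensor_square :: "('k, 'a) module \<Rightarrow> ('a, 'a tsq) bimodule"
  where "tensor_square A =
    (let Q = tsq_free A Mod generate (tsq_free A) (tsq_rels A) in
     \<lparr>carrier = carrier Q, monoid.mult = undefined, one = undefined,
      ring.zero = \<one>\<^bsub>Q\<^esub>, add = monoid.mult Q,
      module.smult = (\<lambda>a. induced (\<lambda>p. tsq_class A
                 (frag_extend (\<lambda>(b, c). frag_of (a \<otimes>\<^bsub>A\<^esub> b, c)) p))),
      rsmult = (\<lambda>Y a. induced (\<lambda>p. tsq_class A
                 (frag_extend (\<lambda>(b, c). frag_of (b, c \<otimes>\<^bsub>A\<^esub> a)) p)) Y)\<rparr>)"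

definition tsq_mult :: "('k, 'a) module \<Rightarrow> 'a tsq \<Rightarrow> 'a"
  where "tsq_mult A = induced (\<lambda>p. \<Oplus>\<^bsub>A\<^esub>bc \<in> Poly_Mapping.keys p.
           add_pow A (Poly_Mapping.lookup p bc) (fst bc \<otimes>\<^bsub>A\<^esub> snd bc))"

definition Omega1 :: "('k, 'a) module \<Rightarrow> ('a, 'a tsq) bimodule"
  where "Omega1 A =
    (tensor_square A)\<lparr>carrier := {Y \<in> carrier (tensor_square A). tsq_mult A Y = \<zero>\<^bsub>A\<^esub>}\<rparr>"

definition univ_der :: "('k, 'a) module \<Rightarrow> 'a \<Rightarrow> 'a tsq"
  where "univ_der A a = tsq_class A (frag_of (\<one>\<^bsub>A\<^esub>, a) - frag_of (a, \<one>\<^bsub>A\<^esub>))"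

type_synonym 'a ncform = "('a, 'a tsq) ten"

definition Omega :: "('k, 'a) module \<Rightarrow> ('a, 'a ncform) module"
  where "Omega A = tensor_algebra A (Omega1 A)"

definition Omega_degree :: "('k, 'a) module \<Rightarrow> nat \<Rightarrow> 'a ncform set"
  where "Omega_degree A q = ten_degree A (Omega1 A) q"

definition form0 :: "('k, 'a) module \<Rightarrow> 'a \<Rightarrow> 'a ncform"
  where "form0 A a = ten_base A (Omega1 A) a"

definition dform :: "('k, 'a) module \<Rightarrow> 'a \<Rightarrow> 'a ncform"
  where "dform A a = ten_gen A (Omega1 A) (univ_der A a)"

text \<open>\<open>std_form A a\<^sub>0 [a\<^sub>1, \<dots>, a\<^sub>m]\<close> is \<open>a\<^sub>0 da\<^sub>1 \<cdots> da\<^sub>m\<close>.\<close>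

definition std_form :: "('k, 'a) module \<Rightarrow> 'a \<Rightarrow> 'a list \<Rightarrow> 'a ncform"
  where "std_form A a as = foldl (\<lambda>\<alpha> b. \<alpha> \<otimes>\<^bsub>Omega A\<^esub> dform A b) (form0 A a) as"

text \<open>The forms \<open>a\<^sub>0 da\<^sub>1 \<cdots> da\<^sub>m\<close> generate \<open>\<Omega>\<close> additively, so additivity and the defining
  formula determine the differential.\<close>

definition Omega_d :: "('k, 'a) module \<Rightarrow> 'a ncform \<Rightarrow> 'a ncform"
  where "Omega_d A = (THE D.
     D \<in> extensional (carrier (Omega A)) \<and>
     D \<in> hom (add_monoid (Omega A)) (add_monoid (Omega A)) \<and>
     (\<forall>a \<in> carrier A. \<forall>as \<in> lists (carrier A).
        D (std_form A a as) = std_form A \<one>\<^bsub>A\<^esub> (a # as)))"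

definition Der :: "('k, 'a) module \<Rightarrow> ('a \<Rightarrow> 'a) set"
  where "Der A = {\<theta> \<in> carrier A \<rightarrow>\<^sub>E carrier A.
     (\<forall>a \<in> carrier A. \<forall>b \<in> carrier A. \<theta> (a \<oplus>\<^bsub>A\<^esub> b) = \<theta> a \<oplus>\<^bsub>A\<^esub> \<theta> b) \<and>
     (\<forall>c. \<forall>a \<in> carrier A. \<theta> (c \<odot>\<^bsub>A\<^esub> a) = c \<odot>\<^bsub>A\<^esub> \<theta> a) \<and>
     (\<forall>a \<in> carrier A. \<forall>b \<in> carrier A.
        \<theta> (a \<otimes>\<^bsub>A\<^esub> b) = \<theta> a \<otimes>\<^bsub>A\<^esub> b \<oplus>\<^bsub>A\<^esub> a \<otimes>\<^bsub>A\<^esub> \<theta> b)}"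

text \<open>\<open>k\<close>-linearity of the contraction follows from additivity, the Leibniz rule and its vanishing
  on \<open>A\<close>.\<close>

definition Omega_contr :: "('k, 'a) module \<Rightarrow> ('a \<Rightarrow> 'a) \<Rightarrow> 'a ncform \<Rightarrow> 'a ncform"
  where "Omega_contr A \<theta> = (THE D.
     D \<in> extensional (carrier (Omega A)) \<and>
     D \<in> hom (add_monoid (Omega A)) (add_monoid (Omega A)) \<and>
     (\<forall>q. D ` Omega_degree A (Suc q) \<subseteq> Omega_degree A q) \<and>
     (\<forall>q. \<forall>\<alpha> \<in> Omega_degree A q. \<forall>\<beta> \<in> carrier (Omega A).
        D (\<alpha> \<otimes>\<^bsub>Omega A\<^esub> \<beta>) = D \<alpha> \<otimes>\<^bsub>Omega A\<^esub> \<beta>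
          \<oplus>\<^bsub>Omega A\<^esub> add_pow (Omega A) ((-1 :: int) ^ q) (\<alpha> \<otimes>\<^bsub>Omega A\<^esub> D \<beta>)) \<and>
     (\<forall>a \<in> carrier A. D (form0 A a) = \<zero>\<^bsub>Omega A\<^esub>) \<and>
     (\<forall>a \<in> carrier A. D (dform A a) = form0 A (\<theta> a)))"

definition Omega_Lie :: "('k, 'a) module \<Rightarrow> ('a \<Rightarrow> 'a) \<Rightarrow> 'a ncform \<Rightarrow> 'a ncform"
  where "Omega_Lie A \<theta> \<alpha> =
    Omega_d A (Omega_contr A \<theta> \<alpha>) \<oplus>\<^bsub>Omega A\<^esub> Omega_contr A \<theta> (Omega_d A \<alpha>)"


section \<open>The noncommutative de Rham complex\<close>

text \<open>The set of super-commutators of homogeneous forms is closed under scalars, so the additive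
  subgroup it generates is its \<open>k\<close>-span.\<close>

type_synonym 'a dr = "'a ncform set"

definition super_commutators :: "('k, 'a) module \<Rightarrow> 'a ncform set"
  where "super_commutators A =
    {\<alpha> \<otimes>\<^bsub>Omega A\<^esub> \<beta> \<ominus>\<^bsub>Omega A\<^esub> add_pow (Omega A) ((-1 :: int) ^ (p * q)) (\<beta> \<otimes>\<^bsub>Omega A\<^esub> \<alpha>)
      | \<alpha> \<beta> p q. \<alpha> \<in> Omega_degree A p \<and> \<beta> \<in> Omega_degree A q}"

definition DR_class :: "('k, 'a) module \<Rightarrow> 'a ncform \<Rightarrow> 'a dr"
  where "DR_class A \<alpha> =
    generate (add_monoid (Omega A)) (super_commutators A) +>\<^bsub>Omega A\<^esub> \<alpha>"

definition DR :: "('k, 'a) module \<Rightarrow> nat \<Rightarrow> 'a dr set"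
  where "DR A q = DR_class A ` Omega_degree A q"

definition DR_zero :: "('k, 'a) module \<Rightarrow> 'a dr"
  where "DR_zero A = DR_class A \<zero>\<^bsub>Omega A\<^esub>"

definition DR_d :: "('k, 'a) module \<Rightarrow> 'a dr \<Rightarrow> 'a dr"
  where "DR_d A = induced (\<lambda>\<alpha>. DR_class A (Omega_d A \<alpha>))"

definition DR_contr :: "('k, 'a) module \<Rightarrow> ('a \<Rightarrow> 'a) \<Rightarrow> 'a dr \<Rightarrow> 'a dr"
  where "DR_contr A \<theta> = induced (\<lambda>\<alpha>. DR_class A (Omega_contr A \<theta> \<alpha>))"

definition DR_Lie :: "('k, 'a) module \<Rightarrow> ('a \<Rightarrow> 'a) \<Rightarrow> 'a dr \<Rightarrow> 'a dr"
  where "DR_Lie A \<theta> = induced (\<lambda>\<alpha>. DR_class A (Omega_Lie A \<theta> \<alpha>))"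

definition nc_symplectic :: "('k, 'a) module \<Rightarrow> 'a dr \<Rightarrow> bool"
  where "nc_symplectic A \<omega> \<longleftrightarrow>
     \<omega> \<in> DR A 2 \<and> DR_d A \<omega> = DR_zero A \<and>
     bij_betw (\<lambda>\<theta>. DR_contr A \<theta> \<omega>) (Der A) (DR A 1)"


section \<open>Lie algebras and central extensions\<close>

text \<open>Only the additive group, the scalar multiplication and the bracket are used.\<close>

record ('k, 'l) lie_alg = "('k, 'l) module" +
  lie_bracket :: "'l \<Rightarrow> 'l \<Rightarrow> 'l"

definition lie_algebra :: "('k :: field, 'l) lie_alg \<Rightarrow> bool"
  where "lie_algebra L \<longleftrightarrow>
     Module.module (ring_of_type_algebra :: 'k ring) L \<and>
     (\<forall>u \<in> carrier L. \<forall>v \<in> carrier L. lie_bracket L u v \<in> carrier L) \<and>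
     (\<forall>u \<in> carrier L. \<forall>v \<in> carrier L. \<forall>w \<in> carrier L.
        lie_bracket L (u \<oplus>\<^bsub>L\<^esub> v) w = lie_bracket L u w \<oplus>\<^bsub>L\<^esub> lie_bracket L v w \<and>
        lie_bracket L w (u \<oplus>\<^bsub>L\<^esub> v) = lie_bracket L w u \<oplus>\<^bsub>L\<^esub> lie_bracket L w v) \<and>
     (\<forall>c. \<forall>u \<in> carrier L. \<forall>v \<in> carrier L.
        lie_bracket L (c \<odot>\<^bsub>L\<^esub> u) v = c \<odot>\<^bsub>L\<^esub> lie_bracket L u v \<and>
        lie_bracket L u (c \<odot>\<^bsub>L\<^esub> v) = c \<odot>\<^bsub>L\<^esub> lie_bracket L u v) \<and>
     (\<forall>u \<in> carrier L. lie_bracket L u u = \<zero>\<^bsub>L\<^esub>) \<and>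
     (\<forall>u \<in> carrier L. \<forall>v \<in> carrier L. \<forall>w \<in> carrier L.
        lie_bracket L u (lie_bracket L v w) \<oplus>\<^bsub>L\<^esub> lie_bracket L v (lie_bracket L w u)
          \<oplus>\<^bsub>L\<^esub> lie_bracket L w (lie_bracket L u v) = \<zero>\<^bsub>L\<^esub>)"

definition lie_hom :: "('k, 'l) lie_alg \<Rightarrow> ('k, 'm) lie_alg \<Rightarrow> ('l \<Rightarrow> 'm) set"
  where "lie_hom L M = {f \<in> carrier L \<rightarrow> carrier M.
     (\<forall>u \<in> carrier L. \<forall>v \<in> carrier L. f (u \<oplus>\<^bsub>L\<^esub> v) = f u \<oplus>\<^bsub>M\<^esub> f v) \<and>
     (\<forall>c. \<forall>u \<in> carrier L. f (c \<odot>\<^bsub>L\<^esub> u) = c \<odot>\<^bsub>M\<^esub> f u) \<and>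
     (\<forall>u \<in> carrier L. \<forall>v \<in> carrier L. f (lie_bracket L u v) = lie_bracket M (f u) (f v))}"

definition lie_central_extension ::
    "('k :: field, 'c) lie_alg \<Rightarrow> ('c \<Rightarrow> 'g) \<Rightarrow> ('k, 'g) lie_alg \<Rightarrow> ('g \<Rightarrow> 'h) \<Rightarrow> ('k, 'h) lie_alg \<Rightarrow> bool"
  where "lie_central_extension C i G p H \<longleftrightarrow>
     lie_algebra C \<and> lie_algebra G \<and> lie_algebra H \<and>
     i \<in> lie_hom C G \<and> p \<in> lie_hom G H \<and>
     inj_on i (carrier C) \<and>
     i ` carrier C = {g \<in> carrier G. p g = \<zero>\<^bsub>H\<^esub>} \<and>
     p ` carrier G = carrier H \<and>
     (\<forall>c \<in> carrier C. \<forall>g \<in> carrier G. lie_bracket G (i c) g = \<zero>\<^bsub>G\<^esub>)"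

definition ground_lie :: "('k :: field, 'k) lie_alg"
  where "ground_lie = \<lparr>carrier = UNIV, monoid.mult = undefined, one = undefined,
     ring.zero = 0, add = (+), module.smult = (*), lie_bracket = (\<lambda>_ _. 0)\<rparr>"


section \<open>Hamiltonian derivations and the bracket on \<open>A/[A,A]\<close>\<close>

definition Der_omega :: "('k, 'a) module \<Rightarrow> 'a dr \<Rightarrow> ('k, 'a \<Rightarrow> 'a) lie_alg"
  where "Der_omega A \<omega> = \<lparr>
     carrier = {\<theta> \<in> Der A. DR_Lie A \<theta> \<omega> = DR_zero A},
     monoid.mult = undefined, one = undefined,
     ring.zero = (\<lambda>a \<in> carrier A. \<zero>\<^bsub>A\<^esub>),
     add = (\<lambda>\<theta> \<eta>. \<lambda>a \<in> carrier A. \<theta> a \<oplus>\<^bsub>A\<^esub> \<eta> a),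
     module.smult = (\<lambda>c \<theta>. \<lambda>a \<in> carrier A. c \<odot>\<^bsub>A\<^esub> \<theta> a),
     lie_bracket = (\<lambda>\<theta> \<eta>. \<lambda>a \<in> carrier A. \<theta> (\<eta> a) \<ominus>\<^bsub>A\<^esub> \<eta> (\<theta> a))\<rparr>"

definition cyc_class :: "('k, 'a) module \<Rightarrow> 'a \<Rightarrow> 'a set"
  where "cyc_class A a = generate (add_monoid A)
     {b \<otimes>\<^bsub>A\<^esub> c \<ominus>\<^bsub>A\<^esub> c \<otimes>\<^bsub>A\<^esub> b | b c. b \<in> carrier A \<and> c \<in> carrier A} +>\<^bsub>A\<^esub> a"

definition cyc_space :: "('k, 'a) module \<Rightarrow> 'a set set"
  where "cyc_space A = cyc_class A ` carrier A"

text \<open>The canonical map \<open>A/[A,A] \<rightarrow> DR(A)\<close>; it is injective with image \<open>DR\<^sup>0(A)\<close>, which is how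
  \<open>cyc_bracket\<close> turns the element \<open>i\<^bsub>\<theta>\<^esub>(dg)\<close> of \<open>DR\<^sup>0(A)\<close> into one of \<open>A/[A,A]\<close>.\<close>

definition cyc_to_DR :: "('k, 'a) module \<Rightarrow> 'a set \<Rightarrow> 'a dr"
  where "cyc_to_DR A = induced (\<lambda>a. DR_class A (form0 A a))"

definition ham :: "('k, 'a) module \<Rightarrow> 'a dr \<Rightarrow> 'a set \<Rightarrow> ('a \<Rightarrow> 'a)"
  where "ham A \<omega> f =
    (THE \<theta>. \<theta> \<in> Der A \<and> DR_contr A \<theta> \<omega> = DR_d A (cyc_to_DR A f))"

definition cyc_bracket :: "('k, 'a) module \<Rightarrow> 'a dr \<Rightarrow> 'a set \<Rightarrow> 'a set \<Rightarrow> 'a set"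
  where "cyc_bracket A \<omega> f g = inv_into (cyc_space A) (cyc_to_DR A)
     (DR_contr A (ham A \<omega> f) (DR_d A (cyc_to_DR A g)))"

definition cyc_lie :: "('k, 'a) module \<Rightarrow> 'a dr \<Rightarrow> ('k, 'a set) lie_alg"
  where "cyc_lie A \<omega> = \<lparr>
     carrier = cyc_space A, monoid.mult = undefined, one = undefined,
     ring.zero = cyc_class A \<zero>\<^bsub>A\<^esub>, add = set_add A,
     module.smult = (\<lambda>c. induced (\<lambda>a. cyc_class A (c \<odot>\<^bsub>A\<^esub> a))),
     lie_bracket = cyc_bracket A \<omega>\<rparr>"

definition const_class :: "('k, 'a) module \<Rightarrow> 'k \<Rightarrow> 'a set"
  where "const_class A c = cyc_class A (c \<odot>\<^bsub>A\<^esub> \<one>\<^bsub>A\<^esub>)"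


section \<open>The tensor algebra of the dual of a vector space\<close>

definition dual_space :: "('k :: field \<Rightarrow> 'e :: ab_group_add \<Rightarrow> 'e) \<Rightarrow> ('e \<Rightarrow> 'k) set"
  where "dual_space s = {\<phi>. Vector_Spaces.linear s (*) \<phi>}"

definition dual_bimodule :: "('k :: field \<Rightarrow> 'e :: ab_group_add \<Rightarrow> 'e) \<Rightarrow> ('k, 'e \<Rightarrow> 'k) bimodule"
  where "dual_bimodule s = \<lparr>carrier = dual_space s, monoid.mult = undefined, one = undefined,
     ring.zero = 0, add = (+), module.smult = (\<lambda>c \<phi> v. c * \<phi> v), rsmult = (\<lambda>\<phi> c v. \<phi> v * c)\<rparr>"

definition linear_coordinates ::
    "('k :: field \<Rightarrow> 'e :: ab_group_add \<Rightarrow> 'e) \<Rightarrow> nat \<Rightarrow> (nat \<Rightarrow> 'e \<Rightarrow> 'k) \<Rightarrow> (nat \<Rightarrow> 'e \<Rightarrow> 'k) \<Rightarrow> bool"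
  where "linear_coordinates s n x y \<longleftrightarrow>
     (let B = x ` {1..n} \<union> y ` {1..n}; sc = (\<lambda>c (\<phi> :: 'e \<Rightarrow> 'k) v. c * \<phi> v) in
      inj_on x {1..n} \<and> inj_on y {1..n} \<and> x ` {1..n} \<inter> y ` {1..n} = {} \<and>
      \<not> Modules.module.dependent sc B \<and> Modules.module.span sc B = dual_space s)"

definition tensor_algebra_dual ::
    "('k :: field \<Rightarrow> 'e :: ab_group_add \<Rightarrow> 'e) \<Rightarrow> ('k, ('k, 'e \<Rightarrow> 'k) ten) module"
  where "tensor_algebra_dual s = tensor_algebra (ring_of_type_algebra :: 'k ring) (dual_bimodule s)"

definition coord :: "('k :: field \<Rightarrow> 'e :: ab_group_add \<Rightarrow> 'e) \<Rightarrow> ('e \<Rightarrow> 'k) \<Rightarrow> ('k, 'e \<Rightarrow> 'k) ten"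
  where "coord s \<phi> = ten_gen (ring_of_type_algebra :: 'k ring) (dual_bimodule s) \<phi>"

definition canonical_form ::
    "('k :: field \<Rightarrow> 'e :: ab_group_add \<Rightarrow> 'e) \<Rightarrow> nat \<Rightarrow> (nat \<Rightarrow> 'e \<Rightarrow> 'k) \<Rightarrow> (nat \<Rightarrow> 'e \<Rightarrow> 'k)
      \<Rightarrow> ('k, 'e \<Rightarrow> 'k) ten dr"
  where "canonical_form s n x y =
    (let A = tensor_algebra_dual s in
     DR_class A (\<Oplus>\<^bsub>Omega A\<^esub>i \<in> {1..n}.
       dform A (coord s (x i)) \<otimes>\<^bsub>Omega A\<^esub> dform A (coord s (y i))))"

end

theory Submission
  imports Defs
begin

text \<open>
  \<^bold>\<open>Why the statement holds.\<close> Choosing linear coordinates identifies \<open>A = T(E\<^sup>*)\<close> with the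
  free algebra on letters \<open>z\<^sub>i\<close>, and \<open>\<Omega>\<^sup>\<bullet>\<close> with the free algebra on letters \<open>z\<^sub>i\<close> and \<open>dz\<^sub>i\<close>. In this
  model \<open>d\<close>, the contractions \<open>i\<^sub>\<theta>\<close> and the Lie derivatives are (super-)derivations that are
  determined by their values on letters, so each Cartan identity is checked on letters
  (\<open>twisted_derivation_eqI\<close>), and all of them preserve the span of super-commutators
  (\<open>scom_sder\<close>).

  Nondegeneracy: modulo super-commutators every one-form is uniquely \<open>\<Sum>\<^sub>i a\<^sub>i dz\<^sub>i\<close>; the coefficients
  are read off by rotating the word around its unique \<open>d\<close>-letter (\<open>cycpart_scom\<close>). As
  \<open>i\<^sub>\<theta> \<omega>\<close> is \<open>\<Sum> \<theta>(x\<^sub>i) dy\<^sub>i - \<theta>(y\<^sub>i) dx\<^sub>i\<close> modulo these, and a derivation of a free algebra is an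
  arbitrary choice of values on letters, \<open>\<theta> \<mapsto> i\<^sub>\<theta> \<omega>\<close> is bijective (\<open>one_form_eq_ii_omega0\<close>, \<open>cycpart_ii_omega0\<close>).

  Exactness: the Euler field \<open>eu\<close> satisfies \<open>d i\<^sub>e\<^sub>u + i\<^sub>e\<^sub>u d = \<close> word length. In characteristic zero one
  may divide by the length on nonempty words, so every form that is closed modulo
  super-commutators is exact modulo super-commutators and constants (\<open>poincare_homotopy\<close>,
  \<open>dd_scom_exact\<close>). In degree one this says that \<open>f \<mapsto> \<theta>\<^sub>f\<close> maps onto
  \<open>Der\<^sub>\<omega>(A)\<close>, since \<open>L\<^sub>\<theta> \<omega> = d i\<^sub>\<theta> \<omega>\<close>; in degree zero it says that the kernel consists of the constants.

  Lie structure: \<open>{f, g}\<close> is the class of \<open>\<theta>\<^sub>f(g)\<close>. It is alternating because \<open>i\<^sub>\<theta> i\<^sub>\<theta> = 0\<close>, and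
  \<open>i\<^bsub>[\<theta>,\<eta>]\<^esub> = L\<^sub>\<theta> i\<^sub>\<eta> - i\<^sub>\<eta> L\<^sub>\<theta>\<close> gives \<open>\<theta>\<^bsub>{f,g}\<^esub> = [\<theta>\<^sub>f, \<theta>\<^sub>g]\<close> (\<open>ham_field_necklace\<close>), from which the Jacobi
  identity follows. The Lie algebra axioms for \<open>Der\<^sub>\<omega>(A)\<close> are inherited along the surjection
  \<open>f \<mapsto> \<theta>\<^sub>f\<close>.

  The remaining work is the passage between the presentations by generators and relations and
  the free model: the universal property of the tensor algebra yields homomorphisms into the
  model, and these are bijective because the letters generate (locale \<open>free_pres\<close>).
\<close>

section \<open>Additive maps on finitely supported functions\<close>

text \<open>The additive extension of a family \<open>f w\<close> of maps on coefficients. Coefficients may sit in a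
  monoid other than the target, so no scalar action on the target is needed.\<close>

definition lin_ext :: "('x \<Rightarrow> 'c::zero \<Rightarrow> 'b) \<Rightarrow> ('x \<Rightarrow>\<^sub>0 'c) \<Rightarrow> 'b::comm_monoid_add"
  where "lin_ext f p = (\<Sum>w\<in>Poly_Mapping.keys p. f w (Poly_Mapping.lookup p w))"

lemma lin_ext_superset:
  assumes "\<And>w. f w 0 = 0" "finite S" "Poly_Mapping.keys p \<subseteq> S"
  shows "lin_ext f p = (\<Sum>w\<in>S. f w (Poly_Mapping.lookup p w))"
  unfolding lin_ext_def using assms by (intro sum.mono_neutral_left) (auto simp: in_keys_iff)

lemma lin_ext_single: "f w 0 = 0 \<Longrightarrow> lin_ext f (Poly_Mapping.single w c) = f w c"
  by (cases "c = 0") (auto simp: lin_ext_def)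

lemma lin_ext_additive:
  fixes f :: "'x \<Rightarrow> 'c::ab_group_add \<Rightarrow> 'b::ab_group_add"
  assumes "\<And>w. additive (f w)"
  shows "additive (lin_ext f)"
proof
  fix p q :: "'x \<Rightarrow>\<^sub>0 'c"
  define S where "S = Poly_Mapping.keys p \<union> Poly_Mapping.keys q"
  have z: "f w 0 = 0" for w using additive.zero[OF assms] .
  have "lin_ext f r = (\<Sum>w\<in>S. f w (Poly_Mapping.lookup r w))" if "Poly_Mapping.keys r \<subseteq> S" for r
    using that by (intro lin_ext_superset z) (auto simp: S_def)
  then show "lin_ext f (p + q) = lin_ext f p + lin_ext f q"
    using keys_add[of p q]
    by (simp add: S_def lookup_add additive.add[OF assms] sum.distrib)
qed

lemma lin_ext_additive_single:
  fixes f :: "'x \<Rightarrow> 'c::ab_group_add \<Rightarrow> 'b::ab_group_add"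
  assumes "\<And>w. additive (f w)"
  shows "lin_ext f (Poly_Mapping.single w c) = f w c"
  by (rule lin_ext_single) (rule additive.zero[OF assms])

lemma poly_mapping_sum_single:
  fixes p :: "'x \<Rightarrow>\<^sub>0 'c::comm_monoid_add"
  shows "p = (\<Sum>w\<in>Poly_Mapping.keys p. Poly_Mapping.single w (Poly_Mapping.lookup p w))"
  by (rule poly_mapping_eqI) (auto simp: lookup_sum lookup_single when_def in_keys_iff)

lemma additive_eqI:
  fixes P Q :: "('x \<Rightarrow>\<^sub>0 'c::ab_group_add) \<Rightarrow> 'b::ab_group_add"
  assumes "additive P" "additive Q" "\<And>w c. P (Poly_Mapping.single w c) = Q (Poly_Mapping.single w c)"
  shows "P p = Q p"
  by (subst (1 2) poly_mapping_sum_single) (simp add: additive.sum[OF assms(1)] additive.sum[OF assms(2)] assms(3))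

lemma biadditive_eqI:
  fixes P Q :: "('x \<Rightarrow>\<^sub>0 'c::ab_group_add) \<Rightarrow> ('y \<Rightarrow>\<^sub>0 'd::ab_group_add) \<Rightarrow> 'b::ab_group_add"
  assumes "\<And>q. additive (\<lambda>p. P p q)" "\<And>q. additive (\<lambda>p. Q p q)"
    and "\<And>p. additive (P p)" "\<And>p. additive (Q p)"
    and "\<And>u a v b. P (Poly_Mapping.single u a) (Poly_Mapping.single v b) = Q (Poly_Mapping.single u a) (Poly_Mapping.single v b)"
  shows "P p q = Q p q"
proof -
  have "P (Poly_Mapping.single u a) q = Q (Poly_Mapping.single u a) q" for u a
    by (rule additive_eqI[OF assms(3) assms(4) assms(5)])
  then show ?thesis by (rule additive_eqI[OF assms(1) assms(2)])
qed

lemma additive_id: "additive (\<lambda>x. x)" by standard auto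
lemma additive_const0: "additive (\<lambda>x. 0)" by standard auto
lemma additive_plus: "additive f \<Longrightarrow> additive g \<Longrightarrow> additive (\<lambda>x. f x + g x)"
  by (auto simp: additive_def algebra_simps)
lemma additive_diff: "additive f \<Longrightarrow> additive g \<Longrightarrow> additive (\<lambda>x. f x - g x)"
  by (auto simp: additive_def algebra_simps)
lemma additive_uminus: "additive f \<Longrightarrow> additive (\<lambda>x. - f x)"
  by (auto simp: additive_def algebra_simps)
lemma additive_mult_l: "additive f \<Longrightarrow> additive (\<lambda>x. (a :: _ :: ring) * f x)"
  by (auto simp: additive_def algebra_simps)
lemma additive_mult_r: "additive f \<Longrightarrow> additive (\<lambda>x. f x * (a :: _ :: ring))"
  by (auto simp: additive_def algebra_simps)
lemma additive_comp: "additive g \<Longrightarrow> additive f \<Longrightarrow> additive (\<lambda>x. g (f x))"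
  by (auto simp: additive_def)
lemma additive_single: "additive (Poly_Mapping.single w :: _ \<Rightarrow> _ \<Rightarrow>\<^sub>0 'c :: ab_group_add)"
  by standard (simp add: single_add)

lemma lookup_additive: "additive (\<lambda>p. Poly_Mapping.lookup p w :: 'c :: ab_group_add)"
  by standard (simp add: lookup_add)

lemmas additive_intros = additive_id additive_const0 additive_plus additive_diff additive_uminus
  additive_mult_l additive_mult_r additive_single

section \<open>Free algebras and super-derivations\<close>

text \<open>The monomial \<open>c w\<close> in the free algebra on \<open>'x\<close>, realised as finitely supported functions on
  words with the convolution product.\<close>

abbreviation mon :: "'x list \<Rightarrow> 'k \<Rightarrow> 'x list \<Rightarrow>\<^sub>0 'k::zero"
  where "mon \<equiv> Poly_Mapping.single"

lemma mon_mult: "mon u a * mon v b = mon (u @ v) (a * b :: _ :: semiring_0)"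
  by (simp add: mult_single plus_list_def)

lemma one_mon: "1 = mon [] 1"
  by (simp flip: zero_list_def)

lemma scalar_central: "mon [] (c :: _ :: comm_ring_1) * p = p * mon [] c"
  by (rule additive_eqI[of "\<lambda>p. _ * p" "\<lambda>p. p * _"])
     (auto intro!: additive_intros simp: mon_mult mult.commute)

text \<open>The model of noncommutative forms on a free algebra: \<open>Inl i\<close> is the letter \<open>z\<^sub>i\<close> and \<open>Inr i\<close> is
  the letter \<open>dz\<^sub>i\<close>. The algebra itself is the part without letters \<open>Inr\<close>.\<close>

type_synonym ('i, 'k) forms = "('i + 'i) list \<Rightarrow>\<^sub>0 'k"

text \<open>The degree of a word as a differential form.\<close>

definition fdeg :: "('i + 'j) list \<Rightarrow> nat"
  where "fdeg w = length (filter (\<lambda>l. \<not> isl l) w)"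

lemma fdeg_simps [simp]: "fdeg [] = 0" "fdeg (Inl i # w) = fdeg w" "fdeg (Inr j # w) = Suc (fdeg w)"
  "fdeg (u @ v) = fdeg u + fdeg v"
  by (simp_all add: fdeg_def)

text \<open>The parity automorphism. It carries the signs of the super Leibniz rule, so that the rule can be
  stated for inhomogeneous forms.\<close>

definition eps :: "('i, 'k::comm_ring_1) forms \<Rightarrow> ('i, 'k) forms"
  where "eps = lin_ext (\<lambda>w c. mon w ((-1) ^ fdeg w * c))"

lemma eps_additive: "additive eps"
  unfolding eps_def by (intro lin_ext_additive) (auto intro!: additive_comp[OF additive_single] additive_intros)

lemma eps_mon [simp]: "eps (mon w c) = mon w ((-1) ^ fdeg w * c)"
  unfolding eps_def by (intro lin_ext_additive_single) (auto intro!: additive_comp[OF additive_single] additive_intros)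

lemma additive_eps: "additive f \<Longrightarrow> additive (\<lambda>x. eps (f x))"
  by (rule additive_comp[OF eps_additive])

lemma eps_1 [simp]: "eps 1 = 1"
  by (simp add: one_mon del: single_one)

lemma eps_mult: "eps (p * q) = eps p * eps q"
  by (rule biadditive_eqI[of "\<lambda>p q. eps (p * q)" "\<lambda>p q. eps p * eps q"])
     (auto intro!: additive_intros additive_eps simp: mon_mult power_add mult_ac)

lemma eps_eps [simp]: "eps (eps p) = p"
  by (rule additive_eqI[of "\<lambda>p. eps (eps p)"])
     (auto intro!: additive_intros additive_eps simp flip: mult.assoc power_add)

lemma lookup_eps: "Poly_Mapping.lookup (eps p) w = (-1) ^ fdeg w * Poly_Mapping.lookup p w"
  by (rule additive_eqI[of "\<lambda>p. Poly_Mapping.lookup (eps p) w" "\<lambda>p. (-1) ^ fdeg w * Poly_Mapping.lookup p w"])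
     (auto intro: additive_comp[OF lookup_additive eps_additive] additive_mult_l lookup_additive simp: lookup_single when_def)

text \<open>The super-derivation of odd parity with prescribed values \<open>\<delta>\<close> on letters, on words and then on
  all forms.\<close>

fun sder_word :: "('i + 'i \<Rightarrow> ('i, 'k::comm_ring_1) forms) \<Rightarrow> ('i + 'i) list \<Rightarrow> ('i, 'k) forms" where
  "sder_word \<delta> [] = 0"
| "sder_word \<delta> (l # w) = \<delta> l * mon w 1 + eps (mon [l] 1) * sder_word \<delta> w"

definition sder :: "('i + 'i \<Rightarrow> ('i, 'k::comm_ring_1) forms) \<Rightarrow> ('i, 'k) forms \<Rightarrow> ('i, 'k) forms"
  where "sder \<delta> = lin_ext (\<lambda>w c. mon [] c * sder_word \<delta> w)"

lemma sder_additive: "additive (sder \<delta>)"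
  unfolding sder_def by (intro lin_ext_additive additive_intros)

lemma additive_sder: "additive f \<Longrightarrow> additive (\<lambda>x. sder \<delta> (f x))"
  by (rule additive_comp[OF sder_additive])

lemmas additive_intros' = additive_intros additive_sder additive_eps

lemma sder_mon: "sder \<delta> (mon w c) = mon [] c * sder_word \<delta> w"
  unfolding sder_def by (intro lin_ext_additive_single additive_intros)

lemma sder_word_append: "sder_word \<delta> (u @ v) = sder_word \<delta> u * mon v 1 + eps (mon u 1) * sder_word \<delta> v"
proof (induction u)
  case (Cons l u)
  have "eps (mon (l # u) 1) = eps (mon [l] 1) * eps (mon u (1::'b))"
    unfolding eps_mult[symmetric] mon_mult by simp
  then show ?case using Cons by (simp add: algebra_simps mon_mult del: eps_mon)
qed (simp flip: one_mon)

lemma sder_mult: "sder \<delta> (p * q) = sder \<delta> p * q + eps p * sder \<delta> q"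
proof (rule biadditive_eqI[of "\<lambda>p q. sder \<delta> (p * q)" "\<lambda>p q. sder \<delta> p * q + eps p * sder \<delta> q"])
  fix u v :: "('a + 'a) list" and a b :: 'b
  have comm: "A * B * (U * V + E * W) = A * U * (B * V) + A * E * (B * W)"
    if "B * U = U * B" "B * E = E * B" for A B U V E W :: "('a, 'b) forms"
  proof -
    have "B * (U * V) = U * (B * V)" "B * (E * W) = E * (B * W)"
      by (simp_all only: mult.assoc[symmetric] that)
    then show ?thesis by (simp only: distrib_left mult.assoc)
  qed
  have v: "mon v b = mon [] b * mon v 1" by (simp add: mon_mult)
  have u: "eps (mon u a) = mon [] a * eps (mon u 1)" by (simp add: mon_mult mult.commute)
  have "sder \<delta> (mon u a * mon v b) = mon [] a * mon [] b * (sder_word \<delta> u * mon v 1 + eps (mon u 1) * sder_word \<delta> v)"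
    by (simp add: mon_mult sder_mon sder_word_append del: eps_mon)
  also have "\<dots> = mon [] a * sder_word \<delta> u * (mon [] b * mon v 1) + mon [] a * eps (mon u 1) * (mon [] b * sder_word \<delta> v)"
    by (rule comm; rule scalar_central)
  also have "\<dots> = sder \<delta> (mon u a) * mon v b + eps (mon u a) * sder \<delta> (mon v b)"
    by (simp only: u sder_mon v[symmetric])
  finally show "sder \<delta> (mon u a * mon v b) = sder \<delta> (mon u a) * mon v b + eps (mon u a) * sder \<delta> (mon v b)" .
qed (auto intro!: additive_intros')

lemma sder_letter [simp]: "sder \<delta> (mon [l] c) = mon [] c * \<delta> l"
  by (simp add: sder_mon one_mon[symmetric])

lemma sder_scalar [simp]: "sder \<delta> (mon [] c) = 0" by (simp add: sder_mon)

lemma sder_scale: "sder \<delta> (mon [] c * p) = mon [] c * sder \<delta> p"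
  by (simp add: sder_mult)

text \<open>Derivations twisted by a map \<open>\<tau>\<close> are determined by their values on scalars and letters. Taking
  \<open>\<tau> = eps\<close> covers odd super-derivations, and \<open>\<tau> = id\<close> ordinary derivations.\<close>

lemma twisted_derivation_eqI:
  fixes P Q \<tau> :: "('x list \<Rightarrow>\<^sub>0 'k::comm_ring_1) \<Rightarrow> ('x list \<Rightarrow>\<^sub>0 'k)"
  assumes "additive P" "additive Q"
    and "\<And>p q. P (p * q) = P p * q + \<tau> p * P q" "\<And>p q. Q (p * q) = Q p * q + \<tau> p * Q q"
    and "\<And>c. P (mon [] c) = Q (mon [] c)" "\<And>l. P (mon [l] 1) = Q (mon [l] 1)"
  shows "P p = Q p"
proof (rule additive_eqI[OF assms(1,2)])
  fix w and c :: 'k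
  have "P (mon w 1) = Q (mon w 1)"
  proof (induction w)
    case (Cons l w)
    have "mon (l # w) 1 = mon [l] 1 * mon w (1::'k)" by (simp add: mon_mult)
    then show ?case using Cons by (simp add: assms)
  qed (simp add: assms)
  moreover have "mon w c = mon [] c * mon w 1" by (simp add: mon_mult)
  ultimately show "P (mon w c) = Q (mon w c)" by (simp add: assms)
qed

text \<open>The values on letters have the parity that makes the super-derivation reverse parity.\<close>

definition odd_der :: "('i + 'i \<Rightarrow> ('i, 'k::comm_ring_1) forms) \<Rightarrow> bool"
  where "odd_der \<delta> \<longleftrightarrow> (\<forall>i. eps (\<delta> (Inl i)) = - \<delta> (Inl i)) \<and> (\<forall>i. eps (\<delta> (Inr i)) = \<delta> (Inr i))"

lemma eps_0 [simp]: "eps 0 = 0" by (rule additive.zero[OF eps_additive])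

lemma sder_0 [simp]: "sder \<delta> 0 = 0" by (rule additive.zero[OF sder_additive])

text \<open>Conjugating by \<open>eps\<close> turns an odd super-derivation into a super-derivation, which is compared with
  \<open>- sder \<delta>\<close> on letters.\<close>

lemma eps_sder:
  assumes "odd_der \<delta>"
  shows "eps (sder \<delta> p) = - sder \<delta> (eps p)"
proof -
  have "eps (sder \<delta> (eps p)) = - sder \<delta> p" for p
  proof (rule twisted_derivation_eqI[of "\<lambda>p. eps (sder \<delta> (eps p))" "\<lambda>p. - sder \<delta> p" eps p])
    show "eps (sder \<delta> (eps (mon [l] 1))) = - sder \<delta> (mon [l] 1)" for l
      using assms by (cases l) (simp_all add: odd_der_def one_mon[symmetric] single_uminus eps_mult additive.minus[OF sder_additive] additive.minus[OF eps_additive])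
  qed (auto intro!: additive_intros' simp: sder_mult eps_mult algebra_simps additive.add[OF eps_additive])
  from this[of "eps p"] show ?thesis by simp
qed

section \<open>The de Rham differential and contractions\<close>

text \<open>The de Rham differential.\<close>

definition dd :: "('i, 'k::comm_ring_1) forms \<Rightarrow> ('i, 'k) forms"
  where "dd = sder (case_sum (\<lambda>i. mon [Inr i] 1) (\<lambda>_. 0))"

text \<open>Contraction with the derivation \<open>z\<^sub>i \<mapsto> v i\<close>. A derivation of a free algebra is recorded by its
  values \<open>v\<close> on the letters.\<close>

definition ii :: "('i \<Rightarrow> ('i, 'k::comm_ring_1) forms) \<Rightarrow> ('i, 'k) forms \<Rightarrow> ('i, 'k) forms"
  where "ii v = sder (case_sum (\<lambda>_. 0) v)"

text \<open>Derivations in question take values of even parity; for values in the algebra this is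
  automatic.\<close>

definition even_field :: "('i \<Rightarrow> ('i, 'k::comm_ring_1) forms) \<Rightarrow> bool"
  where "even_field v \<longleftrightarrow> (\<forall>i. eps (v i) = v i)"


lemma odd_dd: "odd_der (case_sum (\<lambda>i. mon [Inr i] 1) (\<lambda>_. 0))"
  by (simp add: odd_der_def single_uminus)

lemma odd_ii: "even_field v \<Longrightarrow> odd_der (case_sum (\<lambda>_. 0) v)"
  by (simp add: odd_der_def even_field_def)

lemma dd_letter [simp]: "dd (mon [Inl i] c) = mon [Inr i] c" "dd (mon [Inr i] c) = 0" "dd (mon [] c) = 0" "dd 0 = 0" "dd 1 = 0"
  by (simp_all add: dd_def one_mon mon_mult del: single_one)

lemma ii_letter [simp]: "ii v (mon [Inl i] c) = 0" "ii v (mon [Inr i] c) = mon [] c * v i" "ii v (mon [] c) = 0" "ii v 0 = 0" "ii v 1 = 0"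
  by (simp_all add: ii_def one_mon del: single_one)

lemma dd_additive: "additive dd" and ii_additive: "additive (ii v)"
  by (auto simp: dd_def ii_def intro: sder_additive)

lemmas dd_add = additive.add[OF dd_additive] and dd_diff = additive.diff[OF dd_additive]
  and dd_minus = additive.minus[OF dd_additive]
  and ii_add = additive.add[OF ii_additive] and ii_diff = additive.diff[OF ii_additive]
  and ii_minus = additive.minus[OF ii_additive]
  and eps_add = additive.add[OF eps_additive]

lemma dd_mult: "dd (p * q) = dd p * q + eps p * dd q"
  and ii_mult: "ii v (p * q) = ii v p * q + eps p * ii v q"
  by (simp_all add: dd_def ii_def sder_mult)

lemma eps_dd: "eps (dd p) = - dd (eps p)"
  by (simp add: dd_def eps_sder odd_dd)

lemma eps_ii: "even_field v \<Longrightarrow> eps (ii v p) = - ii v (eps p)"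
  by (simp add: ii_def eps_sder odd_ii)

lemmas additive_intros_forms = additive_intros' additive_comp[OF dd_additive] additive_comp[OF ii_additive] dd_additive ii_additive

lemma dd_dd:
  fixes p :: "('i, 'k::{comm_ring_1, ring_char_0, ring_no_zero_divisors}) forms"
  shows "dd (dd p) = 0"
proof -
  have "dd (dd p) = (\<lambda>p. 0) p"
  proof (rule twisted_derivation_eqI[of "\<lambda>p. dd (dd p)" "\<lambda>p. 0" "\<lambda>p. p"])
    show "dd (dd (mon [l] 1)) = 0" for l by (cases l) auto
  qed (auto intro!: additive_intros_forms simp: dd_mult dd_add eps_dd)
  then show ?thesis .
qed

text \<open>The Lie derivative, defined by Cartan's formula.\<close>

definition ll :: "('i \<Rightarrow> ('i, 'k::comm_ring_1) forms) \<Rightarrow> ('i, 'k) forms \<Rightarrow> ('i, 'k) forms"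
  where "ll v p = dd (ii v p) + ii v (dd p)"

lemma ll_additive: "additive (ll v)"
  unfolding ll_def by (intro additive_intros_forms)

lemma ll_scalar [simp]: "ll v (mon [] c) = 0" "ll v 0 = 0"
  by (simp_all add: ll_def)

lemma ll_mult: "even_field v \<Longrightarrow> ll v (p * q) = ll v p * q + p * ll v q"
  by (simp add: ll_def dd_mult dd_add ii_mult ii_add eps_dd eps_ii algebra_simps)

lemma ll_dd:
  fixes p :: "('i, 'k::{comm_ring_1, ring_char_0, ring_no_zero_divisors}) forms"
  shows "ll v (dd p) = dd (ll v p)"
  by (simp add: ll_def dd_dd dd_add)

text \<open>Cartan's formula for \<open>i\<^bsub>[v,w]\<^esub>\<close>. For values in the algebra, which contractions annihilate,
  \<open>ii v (dd (w i))\<close> is the derivation \<open>v\<close> applied to \<open>w i\<close>.\<close>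

lemma ll_ii:
  fixes v w :: "'i \<Rightarrow> ('i, 'k::comm_ring_1) forms"
  assumes "even_field v" "even_field w" "\<And>i. ii v (w i) = 0" "\<And>i. ii w (v i) = 0"
  shows "ll v (ii w p) - ii w (ll v p) = ii (\<lambda>i. ii v (dd (w i)) - ii w (dd (v i))) p"
proof -
  have e: "eps (ll v p) = ll v (eps p)" for p
    using assms(1) by (simp add: ll_def eps_add eps_dd eps_ii dd_minus ii_minus)
  show ?thesis
  proof (rule twisted_derivation_eqI[of "\<lambda>p. ll v (ii w p) - ii w (ll v p)" "ii (\<lambda>i. ii v (dd (w i)) - ii w (dd (v i)))" eps])
    show "ll v (ii w (mon [l] 1)) - ii w (ll v (mon [l] 1)) = ii (\<lambda>i. ii v (dd (w i)) - ii w (dd (v i))) (mon [l] 1)" for l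
      using assms(3,4) by (cases l) (auto simp: ll_def one_mon[symmetric])
  qed (auto intro!: additive_intros_forms additive_comp[OF ll_additive] ll_additive
       simp: ll_mult ii_mult assms e additive.add[OF ll_additive] ii_add algebra_simps)
qed

section \<open>The Euler field\<close>

text \<open>Scaling of each word by a function of its length.\<close>

definition wscale :: "(nat \<Rightarrow> 'k) \<Rightarrow> ('x list \<Rightarrow>\<^sub>0 'k) \<Rightarrow> ('x list \<Rightarrow>\<^sub>0 'k::comm_ring_1)"
  where "wscale h = lin_ext (\<lambda>w c. mon w (h (length w) * c))"

lemma wscale_additive: "additive (wscale h)"
  unfolding wscale_def by (intro lin_ext_additive) (auto intro!: additive_comp[OF additive_single] additive_intros)

lemma wscale_mon [simp]: "wscale h (mon w c) = mon w (h (length w) * c)"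
  unfolding wscale_def by (intro lin_ext_additive_single) (auto intro!: additive_comp[OF additive_single] additive_intros)

lemma lookup_wscale: "Poly_Mapping.lookup (wscale h p) w = h (length w) * Poly_Mapping.lookup p w"
  by (rule additive_eqI[of "\<lambda>p. Poly_Mapping.lookup (wscale h p) w" "\<lambda>p. h (length w) * Poly_Mapping.lookup p w"])
     (auto intro: additive_comp[OF lookup_additive wscale_additive] additive_mult_l lookup_additive simp: lookup_single when_def)

text \<open>The Euler field \<open>z\<^sub>i \<mapsto> z\<^sub>i\<close>; its Lie derivative multiplies a word by its length.\<close>

definition euler :: "'i \<Rightarrow> ('i, 'k::comm_ring_1) forms"
  where "euler i = mon [Inl i] 1"

lemma even_euler: "even_field euler" by (simp add: even_field_def euler_def)

lemma ll_euler: "ll euler p = wscale of_nat p"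
proof (rule twisted_derivation_eqI[of "ll euler" "wscale of_nat" "\<lambda>p. p"])
  show "wscale of_nat (p * q) = wscale of_nat p * q + p * wscale of_nat q" for p q :: "('a, 'b) forms"
    by (rule biadditive_eqI[of "\<lambda>p q. wscale of_nat (p * q)" "\<lambda>p q. wscale of_nat p * q + p * wscale of_nat q"])
       (auto intro!: additive_intros additive_comp[OF wscale_additive] wscale_additive simp: mon_mult algebra_simps simp flip: single_add)
  show "ll euler (mon [l] 1) = wscale of_nat (mon [l] 1)" for l :: "'a + 'a"
    by (cases l) (auto simp: ll_def euler_def mon_mult)
qed (auto intro: ll_additive wscale_additive simp: ll_mult even_euler)

text \<open>Division by the word length. The empty word is sent to \<open>0\<close>, by the convention \<open>1 / 0 = 0\<close>.\<close>

definition unscale :: "('x list \<Rightarrow>\<^sub>0 'k) \<Rightarrow> ('x list \<Rightarrow>\<^sub>0 'k::field)"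
  where "unscale = wscale (\<lambda>n. 1 / of_nat n)"

lemma unscale_scale:
  fixes p :: "'x list \<Rightarrow>\<^sub>0 'k::field_char_0"
  shows "unscale (wscale of_nat p) = p - mon [] (Poly_Mapping.lookup p [])"
    "wscale of_nat (unscale p) = p - mon [] (Poly_Mapping.lookup p [])"
  by (auto intro!: poly_mapping_eqI simp: unscale_def lookup_wscale lookup_minus lookup_single when_def)

lemma lookup_dd_Nil:
  fixes p :: "('a, 'b::comm_ring_1) forms"
  shows "Poly_Mapping.lookup (dd p) [] = 0"
proof -
  let ?\<delta> = "case_sum (\<lambda>i. mon [Inr i] 1) (\<lambda>_. 0) :: 'a + 'a \<Rightarrow> ('a, 'b) forms"
  have *: "Poly_Mapping.lookup (mon [m] c * p) [] = 0" for m c and p :: "('a, 'b) forms"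
    by (rule additive_eqI[OF additive_comp[OF lookup_additive additive_mult_l[OF additive_id]] additive_const0])
      (simp add: mon_mult lookup_single)
  have **: "Poly_Mapping.lookup (mon [] c * q) [] = c * Poly_Mapping.lookup q []" for c and q :: "('a, 'b) forms"
    by (rule additive_eqI[OF additive_comp[OF lookup_additive additive_mult_l[OF additive_id]]
            additive_mult_l[OF lookup_additive]])
      (simp add: mon_mult lookup_single when_def)
  have "Poly_Mapping.lookup (sder_word ?\<delta> w) [] = 0" for w
  proof (induction w)
    case (Cons l w)
    show ?case by (cases l) (simp_all add: lookup_add *)
  qed simp
  then have "Poly_Mapping.lookup (dd (mon w c)) [] = 0" for w :: "('a + 'a) list" and c :: 'b
    by (simp add: dd_def sder_mon **)
  then show ?thesis
    by (rule additive_eqI[OF additive_comp[OF lookup_additive dd_additive] additive_const0])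
qed

text \<open>Since the length operator is \<open>d i + i d\<close>, it commutes with \<open>d\<close>, and so does its partial inverse.\<close>

lemma unscale_dd:
  fixes p :: "('i, 'k::field_char_0) forms"
  shows "unscale (dd p) = dd (unscale p)"
proof -
  \<comment> \<open>Only the constant term is lost in \<open>wscale of_nat (unscale p)\<close>, and \<open>d\<close> kills it.\<close>
  have "dd p = dd (wscale of_nat (unscale p))" by (simp add: unscale_scale dd_diff)
  also have "\<dots> = wscale of_nat (dd (unscale p))" by (simp flip: ll_euler add: ll_dd)
  finally show ?thesis by (simp add: unscale_scale lookup_dd_Nil)
qed

text \<open>The homotopy formula behind the Poincare lemma.\<close>

lemma poincare_homotopy:
  fixes p :: "('i, 'k::field_char_0) forms"
  shows "p - mon [] (Poly_Mapping.lookup p []) = dd (unscale (ii euler p)) + unscale (ii euler (dd p))"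
  unfolding unscale_scale(1)[symmetric] ll_euler[symmetric]
  by (simp add: ll_def additive.add[OF wscale_additive] unscale_def unscale_dd[unfolded unscale_def])

section \<open>The span of super-commutators\<close>

text \<open>The span of the super-commutators of words over \<open>J\<close>. The coefficient \<open>c\<close> is arbitrary, so the
  additive span is closed under scalars.\<close>

inductive_set scom :: "('i + 'i) set \<Rightarrow> ('i, 'k::comm_ring_1) forms set" for J where
  scom_0: "0 \<in> scom J"
| scom_step: "p \<in> scom J \<Longrightarrow> u \<in> lists J \<Longrightarrow> v \<in> lists J \<Longrightarrow>
    p + (mon (u @ v) c - mon (v @ u) ((-1) ^ (fdeg u * fdeg v) * c)) \<in> scom J"

lemma scom_gen: "u \<in> lists J \<Longrightarrow> v \<in> lists J \<Longrightarrow>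
    mon (u @ v) c - mon (v @ u) ((-1) ^ (fdeg u * fdeg v) * c) \<in> scom J"
  using scom_step[OF scom_0] by fastforce

lemma scom_add: "q \<in> scom J \<Longrightarrow> p \<in> scom J \<Longrightarrow> p + q \<in> scom J"
  by (induction rule: scom.induct) (auto simp flip: add.assoc intro: scom.intros)

lemma scom_induct_additive:
  assumes "p \<in> scom J" "additive F" "0 \<in> S" "\<And>x y. x \<in> S \<Longrightarrow> y \<in> S \<Longrightarrow> x + y \<in> S"
    and "\<And>u v c. u \<in> lists J \<Longrightarrow> v \<in> lists J \<Longrightarrow>
      F (mon (u @ v) c) - F (mon (v @ u) ((-1) ^ (fdeg u * fdeg v) * c)) \<in> S"
  shows "F p \<in> S"
  using assms(1)
  by (induction rule: scom.induct)
     (auto simp: additive.zero[OF assms(2)] additive.add[OF assms(2)] additive.diff[OF assms(2)] assms(3-))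

lemma scom_scale: "p \<in> scom J \<Longrightarrow> mon [] c * p \<in> scom J"
  by (erule scom_induct_additive)
     (auto intro!: additive_intros scom_add scom_0 simp: mon_mult mult.left_commute[of c] scom_gen)

lemma scom_minus: "p \<in> scom J \<Longrightarrow> - p \<in> scom J"
  using scom_scale[of p J "-1"] by (simp add: single_uminus flip: one_mon)

lemma scom_diff: "p \<in> scom J \<Longrightarrow> q \<in> scom J \<Longrightarrow> p - q \<in> scom J"
  using scom_add[of "-q" J p] scom_minus[of q J] by simp

lemma scom_wscale: "p \<in> scom J \<Longrightarrow> wscale h p \<in> scom J"
  by (erule scom_induct_additive)
     (auto intro!: wscale_additive scom_add scom_0 scom_gen simp: mult.left_commute[of "h _"] add.commute)

lemma scom_lookup_Nil:
  assumes "p \<in> scom J" shows "Poly_Mapping.lookup p [] = 0"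
  using scom_induct_additive[OF assms lookup_additive, of "{0}"] by (auto simp: lookup_single when_def)

lemma additive_closed:
  fixes F :: "('x \<Rightarrow>\<^sub>0 'c::ab_group_add) \<Rightarrow> 'b::ab_group_add"
  assumes "additive F" "0 \<in> S" "\<And>x y. x \<in> S \<Longrightarrow> y \<in> S \<Longrightarrow> x + y \<in> S"
    and "\<And>w c. w \<in> Poly_Mapping.keys p \<Longrightarrow> F (Poly_Mapping.single w c) \<in> S"
  shows "F p \<in> S"
proof -
  have "(\<Sum>w\<in>K. F (Poly_Mapping.single w (Poly_Mapping.lookup p w))) \<in> S" if "K \<subseteq> Poly_Mapping.keys p" for K
    using finite_subset[OF that finite_keys] that by (induction K rule: finite_induct) (auto simp: assms)
  then show ?thesis by (subst poly_mapping_sum_single) (simp add: additive.sum[OF assms(1)])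
qed

text \<open>Dropping the words that are not over \<open>J\<close> maps super-commutators to super-commutators over
  \<open>J\<close>, because \<open>u @ v\<close> and \<open>v @ u\<close> have the same letters. Hence a form over \<open>J\<close> in the span of all
  super-commutators is in the span of those over \<open>J\<close>; this allows one to ignore the alphabet.\<close>

lemma scom_restrict:
  assumes "p \<in> scom UNIV" "Poly_Mapping.keys p \<subseteq> lists J"
  shows "p \<in> scom J"
proof -
  define r where "r = lin_ext (\<lambda>w c. if w \<in> lists J then mon w c else (0 :: ('a, 'b) forms))"
  have ad: "additive (\<lambda>c. if w \<in> lists J then mon w c else (0 :: ('a, 'b) forms))" for w
    by (cases "w \<in> lists J") (simp_all add: additive_single additive_const0)
  have r: "additive r" "r (mon w c) = (if w \<in> lists J then mon w c else 0)" for w c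
    unfolding r_def by (rule lin_ext_additive ad lin_ext_additive_single)+
  have "r p - p \<in> {0}"
    by (rule additive_closed[of "\<lambda>p. r p - p"]) (use assms(2) in \<open>auto intro!: additive_diff r additive_id simp: r(2)\<close>)
  moreover have "r p \<in> scom J"
    by (rule scom_induct_additive[OF assms(1) r(1)]) (auto intro: scom_0 scom_add scom_gen simp: r(2))
  ultimately show ?thesis by simp
qed

lemma lookup_scale: "Poly_Mapping.lookup (mon [] c * q) w = (c :: _ :: comm_ring_1) * Poly_Mapping.lookup q w"
  by (rule additive_eqI[OF additive_comp[OF lookup_additive additive_mult_l[OF additive_id]]
            additive_mult_l[OF lookup_additive]])
      (simp add: mon_mult lookup_single when_def)

lemma scom_commutator:
  assumes "\<And>w. w \<in> Poly_Mapping.keys p \<Longrightarrow> w \<in> lists J \<and> even (fdeg w) = even a"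
    and "\<And>w. w \<in> Poly_Mapping.keys q \<Longrightarrow> w \<in> lists J \<and> even (fdeg w) = even b"
  shows "p * q - mon [] ((-1) ^ (a * b)) * (q * p) \<in> scom J"
proof (rule additive_closed[of "\<lambda>p. p * q - mon [] ((-1) ^ (a * b)) * (q * p)"])
  fix u c assume u: "u \<in> Poly_Mapping.keys p"
  show "mon u c * q - mon [] ((-1) ^ (a * b)) * (q * mon u c) \<in> scom J"
  proof (rule additive_closed[of "\<lambda>q. mon u c * q - mon [] ((-1) ^ (a * b)) * (q * mon u c)"])
    fix v d assume v: "v \<in> Poly_Mapping.keys q"
    have "((-1) ^ (a * b) :: 'b) = (-1) ^ (fdeg u * fdeg v)"
      using assms(1)[OF u] assms(2)[OF v] by (auto simp: uminus_power_if)
    then show "mon u c * mon v d - mon [] ((-1) ^ (a * b)) * (mon v d * mon u c) \<in> scom J"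
      using scom_gen[of u J v "c * d"] assms(1)[OF u] assms(2)[OF v] by (simp add: mon_mult mult.commute)
  qed (auto intro!: additive_intros scom_0 scom_add)
qed (auto intro!: additive_intros scom_0 scom_add)

text \<open>An eigenvector of \<open>eps\<close> only involves words of one parity, since \<open>1 \<noteq> -1\<close>.\<close>

lemma eps_parity:
  fixes p :: "('i, 'k::{comm_ring_1, ring_char_0, ring_no_zero_divisors}) forms"
  assumes "eps p = mon [] ((-1) ^ a) * p" "w \<in> Poly_Mapping.keys p"
  shows "even (fdeg w) = even a"
proof -
  have "(-1) ^ fdeg w * Poly_Mapping.lookup p w = (-1) ^ a * Poly_Mapping.lookup p w"
    using arg_cong[OF assms(1), of "\<lambda>p. Poly_Mapping.lookup p w"] by (simp add: lookup_eps lookup_scale)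
  then have "(-1) ^ fdeg w = ((-1) ^ a :: 'k)" using assms(2) by (simp add: in_keys_iff)
  then show ?thesis by (auto simp: uminus_power_if split: if_splits)
qed

text \<open>By the Leibniz rule the image of \<open>[u, v]\<close> is \<open>[\<delta>u, v] \<plusminus> [u, \<delta>v]\<close>.\<close>

lemma scom_sder:
  fixes p :: "('i, 'k::{comm_ring_1, ring_char_0, ring_no_zero_divisors}) forms"
  assumes p: "p \<in> scom UNIV" and odd: "odd_der \<delta>"
  shows "sder \<delta> p \<in> scom UNIV"
proof (rule scom_induct_additive[OF p sder_additive])
  fix u v :: "('i + 'i) list" and c :: 'k
  define U V :: "('i, 'k) forms" where "U = mon u 1" and "V = mon v 1"
  define a b where "a = fdeg u" and "b = fdeg v"
  let ?s = "\<lambda>n. mon [] ((-1) ^ n) :: ('i, 'k) forms"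
  have eU: "eps U = ?s a * U" and eV: "eps V = ?s b * V" by (simp_all add: U_def V_def a_def b_def mon_mult)
  have s: "?s n * (?s m * x) = ?s (n + m) * x" for n m x by (simp add: mon_mult power_add flip: mult.assoc)
  have sS: "?s (Suc n) = - ?s n" for n by (simp add: single_uminus)
  have ed: "eps (sder \<delta> Z) = ?s (Suc n) * sder \<delta> Z" if "eps Z = ?s n * Z" for Z n
    using that by (simp add: eps_sder[OF odd] sder_scale single_uminus)
  have comm: "Z * Y - ?s (n * m) * (Y * Z) \<in> scom UNIV" if "eps Z = ?s n * Z" "eps Y = ?s m * Y" for Z Y n m
    using eps_parity[OF that(1)] eps_parity[OF that(2)] by (intro scom_commutator) auto
  have 1: "sder \<delta> U * V - ?s (Suc a * b) * (V * sder \<delta> U) \<in> scom UNIV"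
    by (intro comm ed eU eV)
  have 2: "?s a * (U * sder \<delta> V - ?s (a * Suc b) * (sder \<delta> V * U)) \<in> scom UNIV"
    by (intro scom_scale comm ed eU eV)
  have e: "?s (a + a * Suc b) = ?s (a * b)" "?s (a * b + b) = ?s (Suc a * b)"
    by (simp_all add: algebra_simps) (simp add: power_add flip: power_mult_distrib mult.assoc)
  have "sder \<delta> (U * V) - ?s (a * b) * sder \<delta> (V * U) =
    (sder \<delta> U * V - ?s (Suc a * b) * (V * sder \<delta> U)) + ?s a * (U * sder \<delta> V - ?s (a * Suc b) * (sder \<delta> V * U))"
    by (simp add: sder_mult eU eV right_diff_distrib distrib_left s e mult.assoc del: power_Suc mult_Suc mult_Suc_right)
  then have "sder \<delta> (U * V) - ?s (a * b) * sder \<delta> (V * U) \<in> scom UNIV"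
    using scom_add[OF 2 1] by simp
  then have "mon [] c * (sder \<delta> (U * V) - ?s (a * b) * sder \<delta> (V * U)) \<in> scom UNIV" by (rule scom_scale)
  moreover have "mon (u @ v) c = mon [] c * (U * V)" "mon (v @ u) ((-1) ^ (a * b) * c) = mon [] c * (?s (a * b) * (V * U))"
    by (simp_all add: U_def V_def mon_mult mult.commute)
  ultimately show "sder \<delta> (mon (u @ v) c) - sder \<delta> (mon (v @ u) ((-1) ^ (fdeg u * fdeg v) * c)) \<in> scom UNIV"
    by (simp add: sder_scale right_diff_distrib flip: a_def b_def)
qed (auto intro: scom_0 scom_add)

lemma scom_dd: "p \<in> scom UNIV \<Longrightarrow> dd p \<in> scom UNIV"
  and scom_ii: "p \<in> scom UNIV \<Longrightarrow> even_field v \<Longrightarrow> ii v p \<in> scom UNIV"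
  for p :: "('i, 'k::{comm_ring_1, ring_char_0, ring_no_zero_divisors}) forms"
  by (simp_all add: dd_def ii_def scom_sder odd_dd odd_ii)


section \<open>Homogeneous forms\<close>

text \<open>Homogeneous forms of degree \<open>q\<close> in the letters indexed by \<open>I\<close>.\<close>

definition hforms :: "'i set \<Rightarrow> nat \<Rightarrow> ('i, 'k::zero) forms set"
  where "hforms I q = {p. \<forall>w\<in>Poly_Mapping.keys p. w \<in> lists (I <+> I) \<and> fdeg w = q}"

lemma hforms_0 [simp]: "0 \<in> hforms I q" by (simp add: hforms_def)

lemma hforms_add: "p \<in> hforms I q \<Longrightarrow> p' \<in> hforms I q \<Longrightarrow> p + p' \<in> hforms I q"
  using keys_add[of p p'] by (auto simp: hforms_def)

lemma hforms_minus: "p \<in> hforms I q \<Longrightarrow> - p \<in> hforms I q" for p :: "('i, 'k::ab_group_add) forms"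
  by (auto simp: hforms_def in_keys_iff)

lemma hforms_diff: "p \<in> hforms I q \<Longrightarrow> p' \<in> hforms I q \<Longrightarrow> p - p' \<in> hforms I q" for p :: "('i, 'k::ab_group_add) forms"
  using hforms_add[of p I q "-p'"] hforms_minus[of p' I q] by simp

lemma hforms_mult: "p \<in> hforms I a \<Longrightarrow> q \<in> hforms I b \<Longrightarrow> p * q \<in> hforms I (a + b)"
  for p q :: "('i, 'k::comm_ring_1) forms"
  using keys_mult[of p q] by (fastforce simp: hforms_def plus_list_def)

lemma hforms_mon: "w \<in> lists (I <+> I) \<Longrightarrow> fdeg w = q \<Longrightarrow> mon w c \<in> hforms I q"
  by (auto simp: hforms_def)

lemma hforms_scale: "p \<in> hforms I q \<Longrightarrow> mon [] c * p \<in> hforms I q" for p :: "('i, 'k::comm_ring_1) forms"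
  using hforms_mult[OF hforms_mon[of "[]" I 0 c], of p q] by simp

lemma hforms_sum: "(\<And>x. x \<in> S \<Longrightarrow> f x \<in> hforms I q) \<Longrightarrow> sum f S \<in> hforms I q"
  by (induction S rule: infinite_finite_induct) (auto intro: hforms_add)

lemma hforms_eps: "p \<in> hforms I q \<Longrightarrow> eps p = mon [] ((-1) ^ q) * p" for p :: "('i, 'k::comm_ring_1) forms"
  by (rule poly_mapping_eqI) (auto simp: lookup_eps lookup_scale hforms_def in_keys_iff)

lemma hforms_wscale: "p \<in> hforms I q \<Longrightarrow> wscale h p \<in> hforms I q" for p :: "('i, 'k::comm_ring_1) forms"
  by (auto simp: hforms_def in_keys_iff lookup_wscale)

lemma hforms_keys: "p \<in> hforms I q \<Longrightarrow> w \<in> Poly_Mapping.keys p \<Longrightarrow> w \<in> lists (I <+> I)"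
  "p \<in> hforms I q \<Longrightarrow> w \<in> Poly_Mapping.keys p \<Longrightarrow> fdeg w = q"
  by (auto simp: hforms_def)

lemma hforms_dd: "p \<in> hforms I q \<Longrightarrow> dd p \<in> hforms I (Suc q)" for p :: "('i, 'k::comm_ring_1) forms"
proof (rule additive_closed[OF dd_additive])
  fix w and c :: 'k assume p: "p \<in> hforms I q" and w: "w \<in> Poly_Mapping.keys p"
  have "sder_word (case_sum (\<lambda>i. mon [Inr i] 1) (\<lambda>_. 0)) w \<in> (hforms I (Suc (fdeg w)) :: ('i, 'k) forms set)" if "w \<in> lists (I <+> I)" for w
    using that
  proof (induction w)
    case (Cons l w)
    then obtain i where i: "i \<in> I" "l = Inl i \<or> l = Inr i" by auto
    show ?case using i(2)
    proof
      assume "l = Inl i" then show ?thesis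
        using Cons i hforms_mult[OF hforms_mon[of "[l]" I 0 1] Cons.IH]
        by (auto simp: mon_mult intro!: hforms_add hforms_mon)
    next
      assume "l = Inr i" then show ?thesis
        using Cons i hforms_mult[OF hforms_mon[of "[l]" I 1 "-1"] Cons.IH] by auto
    qed
  qed simp
  then show "dd (mon w c) \<in> hforms I (Suc q)"
    using hforms_keys[OF p w] by (auto simp: dd_def sder_mon intro!: hforms_scale)
qed (auto intro: hforms_add)

lemma hforms_sder_word_ii:
  fixes v :: "'i \<Rightarrow> ('i, 'k::comm_ring_1) forms"
  assumes v: "\<And>i. i \<in> I \<Longrightarrow> v i \<in> hforms I 0"
  shows "w \<in> lists (I <+> I) \<Longrightarrow> sder_word (case_sum (\<lambda>_. 0) v) w \<in> hforms I (fdeg w - 1) \<and>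
    (fdeg w = 0 \<longrightarrow> sder_word (case_sum (\<lambda>_. 0) v) w = 0)"
proof (induction w)
  case (Cons l w)
  then obtain i where i: "i \<in> I" "l = Inl i \<or> l = Inr i" and w: "w \<in> lists (I <+> I)" by auto
  have L: "[l] \<in> lists (I <+> I)" using Cons.prems by simp
  let ?s = "sder_word (case_sum (\<lambda>_. 0) v) w"
  have IH: "?s \<in> hforms I (fdeg w - 1)" "fdeg w = 0 \<Longrightarrow> ?s = 0"
    using Cons.IH[OF w] by auto
  from i(2) show ?case
  proof
    assume "l = Inl i" then show ?thesis
      using i(1) hforms_mult[OF hforms_mon[OF L, of 0 1] IH(1)] IH(2) by simp
  next
    assume l: "l = Inr i"
    have "mon [l] (-1) * ?s \<in> hforms I (fdeg w)"
    proof (cases "fdeg w")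
      case (Suc n)
      then show ?thesis using hforms_mult[OF hforms_mon[OF L, of 1 "-1"] IH(1)] l by simp
    qed (simp add: IH)
    moreover have "v i * mon w 1 \<in> hforms I (fdeg w)"
      using hforms_mult[OF v[OF i(1)] hforms_mon[OF w refl]] by simp
    ultimately show ?thesis using l by (simp add: hforms_add)
  qed
qed simp

lemma hforms_ii:
  fixes p :: "('i, 'k::comm_ring_1) forms"
  assumes v: "\<And>i. i \<in> I \<Longrightarrow> v i \<in> hforms I 0" and p: "p \<in> hforms I q"
  shows "ii v p \<in> hforms I (q - 1)" "q = 0 \<Longrightarrow> ii v p = 0"
proof -
  have *: "sder_word (case_sum (\<lambda>_. 0) v) w \<in> hforms I (q - 1) \<and> (q = 0 \<longrightarrow> sder_word (case_sum (\<lambda>_. 0) v) w = 0)"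
    if "w \<in> Poly_Mapping.keys p" for w
    using hforms_sder_word_ii[OF v hforms_keys(1)[OF p that]] hforms_keys(2)[OF p that] by simp
  show "ii v p \<in> hforms I (q - 1)"
  proof (rule additive_closed[OF ii_additive])
    fix w and c :: 'k assume w: "w \<in> Poly_Mapping.keys p"
    from *[OF w] show "ii v (mon w c) \<in> hforms I (q - 1)" by (simp add: ii_def sder_mon hforms_scale)
  qed (auto intro: hforms_add)
  assume q: "q = 0"
  have "ii v p \<in> {0}"
  proof (rule additive_closed[OF ii_additive])
    fix w and c :: 'k assume w: "w \<in> Poly_Mapping.keys p"
    from *[OF w] q show "ii v (mon w c) \<in> {0}" by (simp add: ii_def sder_mon)
  qed auto
  then show "ii v p = 0" by simp
qed

section \<open>Cyclic coordinates of one-forms\<close>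

text \<open>For a word \<open>p dz q\<close> with no further \<open>d\<close>-letter, the rotated word \<open>q p\<close>; undefined for every
  other word.\<close>

definition cyc_word :: "'i \<Rightarrow> ('i + 'i) list \<Rightarrow> ('i + 'i) list option"
  where "cyc_word z w = (case dropWhile isl w of [] \<Rightarrow> None
     | l # q \<Rightarrow> if l = Inr z \<and> list_all isl q then Some (q @ takeWhile isl w) else None)"

text \<open>The coefficient \<open>a\<^sub>z\<close> in the normal form \<open>\<Sum>\<^sub>z a\<^sub>z dz\<close> of a one-form modulo super-commutators.\<close>

definition cycpart :: "'i \<Rightarrow> ('i, 'k::comm_ring_1) forms \<Rightarrow> ('i, 'k) forms"
  where "cycpart z = lin_ext (\<lambda>w c. case cyc_word z w of None \<Rightarrow> 0 | Some w' \<Rightarrow> mon w' c)"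

lemma cycpart_additive: "additive (cycpart z)"
  and cycpart_mon: "cycpart z (mon w c) = (case cyc_word z w of None \<Rightarrow> 0 | Some w' \<Rightarrow> mon w' c)"
proof -
  have a: "additive (\<lambda>c. case cyc_word z w of None \<Rightarrow> 0 | Some w' \<Rightarrow> mon w' c)" for w
    by (cases "cyc_word z w") (auto intro: additive_intros)
  show "additive (cycpart z)" unfolding cycpart_def by (rule lin_ext_additive a)+
  show "cycpart z (mon w c) = (case cyc_word z w of None \<Rightarrow> 0 | Some w' \<Rightarrow> mon w' c)"
    unfolding cycpart_def by (rule lin_ext_additive_single a)+
qed

lemma cyc_word_split:
  assumes "fdeg a = 0" "fdeg b = 0"
  shows "cyc_word z (a @ Inr j # b) = (if j = z then Some (b @ a) else None)"
proof -
  have "\<forall>l\<in>set a. isl l" "\<forall>l\<in>set b. isl l" using assms by (auto simp: fdeg_def filter_empty_conv)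
  then have "takeWhile isl (a @ Inr j # b) = a" "dropWhile isl (a @ Inr j # b) = Inr j # b" "list_all isl b"
    by (auto simp: list_all_iff)
  then show ?thesis unfolding cyc_word_def by (simp only: list.case sum.inject simp_thms)
qed

lemma cyc_word_None: "fdeg w \<noteq> 1 \<Longrightarrow> cyc_word z w = None"
proof -
  have w: "fdeg w = fdeg (takeWhile isl w) + fdeg (dropWhile isl w)"
    by (subst takeWhile_dropWhile_id[of isl w, symmetric]) (simp only: fdeg_simps)
  have "fdeg (takeWhile isl w) = 0" by (auto simp: fdeg_def filter_empty_conv dest: set_takeWhileD)
  moreover have "fdeg q = 0" if "list_all isl q" for q :: "('a + 'a) list"
    using that by (auto simp: fdeg_def filter_empty_conv list_all_iff)
  ultimately show "fdeg w \<noteq> 1 \<Longrightarrow> cyc_word z w = None"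
    using w by (auto simp: cyc_word_def split: list.splits)
qed

lemma fdeg_1_split:
  assumes "fdeg w = 1"
  obtains a j b where "w = a @ Inr j # b" "fdeg a = 0" "fdeg b = 0"
  using assms
proof (induction w arbitrary: thesis)
  case (Cons l w)
  show ?case
  proof (cases l)
    case (Inl i)
    then show ?thesis using Cons.IH Cons.prems by (metis append_Cons fdeg_simps(2))
  next
    case (Inr j)
    then show ?thesis using Cons.prems(1)[of "[]" j w] Cons.prems(2) by simp
  qed
qed simp

text \<open>The coefficients are well defined modulo super-commutators: a commutator with exactly one
  \<open>d\<close>-letter rotates the word, and rotation does not change the word read off cyclically from
  behind that letter.\<close>

lemma cycpart_scom:
  fixes p :: "('i, 'k::comm_ring_1) forms"
  assumes "p \<in> scom UNIV"
  shows "cycpart z p = 0"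
proof -
  have *: "cycpart z (mon (u @ v) c) = cycpart z (mon (v @ u) c)" if d: "fdeg u = 1" "fdeg v = 0" for u v :: "('i + 'i) list" and c :: 'k
  proof -
    obtain a j b where u: "u = a @ Inr j # b" "fdeg a = 0" "fdeg b = 0" using fdeg_1_split[OF d(1)] .
    show ?thesis
      using cyc_word_split[of a "b @ v" z j] cyc_word_split[of "v @ a" b z j] d(2) u(2,3)
      unfolding u(1) by (simp add: cycpart_mon)
  qed
  have "cycpart z (mon (u @ v) c) = cycpart z (mon (v @ u) ((-1) ^ (fdeg u * fdeg v) * c))" for u v :: "('i + 'i) list" and c :: 'k
  proof (cases "fdeg u + fdeg v = 1")
    case True
    then consider "fdeg u = 1" "fdeg v = 0" | "fdeg v = 1" "fdeg u = 0" by linarith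
    then show ?thesis
    proof cases
      case 1 show ?thesis using *[OF 1, of c] 1 by simp
    next
      case 2 show ?thesis using *[OF 2, of c] 2 by simp
    qed
  next
    case False
    then show ?thesis using cyc_word_None[of "u @ v" z] cyc_word_None[of "v @ u" z] by (simp add: cycpart_mon add.commute)
  qed
  then show ?thesis
    using scom_induct_additive[OF assms cycpart_additive, of "{0}" z] by simp
qed

lemma hforms_cycpart:
  fixes p :: "('i, 'k::comm_ring_1) forms"
  assumes "p \<in> hforms I 1"
  shows "cycpart z p \<in> hforms I 0"
proof (rule additive_closed[OF cycpart_additive])
  fix w and c :: 'k assume "w \<in> Poly_Mapping.keys p"
  then have w: "w \<in> lists (I <+> I)" "fdeg w = 1" using assms by (auto simp: hforms_def)
  from fdeg_1_split[OF w(2)] obtain a j b where "w = a @ Inr j # b" "fdeg a = 0" "fdeg b = 0" .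
  then show "cycpart z (mon w c) \<in> hforms I 0"
    using w by (auto simp: cycpart_mon cyc_word_split intro!: hforms_mon)
qed (auto intro: hforms_add)

section \<open>The canonical two-form\<close>

text \<open>The form \<open>\<Sum> dx\<^sub>m dy\<^sub>m\<close>, with \<open>(m, False)\<close> the index of \<open>x\<^sub>m\<close> and \<open>(m, True)\<close> that of \<open>y\<^sub>m\<close>.\<close>

definition omega0 :: "'m set \<Rightarrow> ('m \<times> bool, 'k::comm_ring_1) forms"
  where "omega0 M = (\<Sum>m\<in>M. mon [Inr (m, False), Inr (m, True)] 1)"

lemma omega0_hforms: "omega0 M \<in> hforms (M \<times> UNIV) 2"
  unfolding omega0_def by (intro hforms_sum hforms_mon) auto

lemma dd_omega0: "dd (omega0 M :: ('a \<times> bool, 'b::comm_ring_1) forms) = 0"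
proof -
  have "mon [l, l'] 1 = mon [l] 1 * mon [l'] (1::'b)" for l l' :: "'a \<times> bool + 'a \<times> bool"
    by (simp add: mon_mult)
  then show ?thesis by (simp add: omega0_def additive.sum[OF dd_additive] dd_mult)
qed

lemma ii_omega0:
  fixes v :: "'a \<times> bool \<Rightarrow> ('a \<times> bool, 'b::comm_ring_1) forms"
  shows "ii v (omega0 M) = (\<Sum>m\<in>M. v (m, False) * mon [Inr (m, True)] 1 - mon [Inr (m, False)] 1 * v (m, True))"
proof -
  have "mon [l, l'] 1 = mon [l] 1 * mon [l'] (1::'b)" for l l' :: "'a \<times> bool + 'a \<times> bool"
    by (simp add: mon_mult)
  then show ?thesis
    by (auto simp: omega0_def additive.sum[OF ii_additive] ii_mult single_uminus simp flip: one_mon intro!: sum.cong)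
qed

lemma cycpart_letter:
  fixes p :: "('i, 'k::comm_ring_1) forms"
  assumes "p \<in> hforms I 0"
  shows "cycpart z (p * mon [Inr j] 1) = (if j = z then p else 0)"
    "cycpart z (mon [Inr j] 1 * p) = (if j = z then p else 0)"
proof -
  have 0: "fdeg w = 0" if "w \<in> Poly_Mapping.keys p" for w
    using hforms_keys(2)[OF assms that] .
  have ad: "additive (\<lambda>p. cycpart z (p * mon [Inr j] 1) - (if j = z then p else 0) :: ('i, 'k) forms)"
    "additive (\<lambda>p. cycpart z (mon [Inr j] 1 * p) - (if j = z then p else 0) :: ('i, 'k) forms)"
    by (auto simp: additive_def algebra_simps additive.add[OF cycpart_additive])
  have "cycpart z (p * mon [Inr j] 1) - (if j = z then p else 0) \<in> {0}"
  proof (rule additive_closed[OF ad(1)])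
    fix w and c :: 'k assume "w \<in> Poly_Mapping.keys p"
    from 0[OF this] show "cycpart z (mon w c * mon [Inr j] 1) - (if j = z then mon w c else 0) \<in> {0}"
      using cyc_word_split[of w "[]" z j] by (simp add: mon_mult cycpart_mon)
  qed auto
  moreover have "cycpart z (mon [Inr j] 1 * p) - (if j = z then p else 0) \<in> {0}"
  proof (rule additive_closed[OF ad(2)])
    fix w and c :: 'k assume "w \<in> Poly_Mapping.keys p"
    from 0[OF this] show "cycpart z (mon [Inr j] 1 * mon w c) - (if j = z then mon w c else 0) \<in> {0}"
      using cyc_word_split[of "[]" w z j] by (simp add: mon_mult cycpart_mon)
  qed auto
  ultimately show "cycpart z (p * mon [Inr j] 1) = (if j = z then p else 0)"
    "cycpart z (mon [Inr j] 1 * p) = (if j = z then p else 0)" by simp_all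
qed

lemma cycpart_ii_omega0:
  fixes v :: "'m \<times> bool \<Rightarrow> ('m \<times> bool, 'k::comm_ring_1) forms"
  assumes "finite M" "m \<in> M" "\<And>i. i \<in> M \<times> UNIV \<Longrightarrow> v i \<in> hforms (M \<times> UNIV) 0"
  shows "cycpart (m, True) (ii v (omega0 M)) = v (m, False)"
    "cycpart (m, False) (ii v (omega0 M)) = - v (m, True)"
  using assms
  by (auto simp: ii_omega0 additive.sum[OF cycpart_additive] additive.diff[OF cycpart_additive]
      cycpart_letter[of _ "M \<times> UNIV"] sum_subtractf sum_negf if_distrib[of uminus] cong: if_cong)

text \<open>Every one-form equals \<open>\<Sum> a\<^sub>m dy\<^sub>m + dx\<^sub>m b\<^sub>m\<close> modulo super-commutators, with the cyclic coordinates
  as coefficients. The field that contracts \<open>\<omega>\<close> to this sum is read off.\<close>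

lemma one_form_eq_ii_omega0:
  fixes p :: "('m \<times> bool, 'k::comm_ring_1) forms"
  assumes M: "finite M" and p: "p \<in> hforms (M \<times> UNIV) 1"
    and v: "\<And>m. m \<in> M \<Longrightarrow> v (m, False) = cycpart (m, True) p" "\<And>m. m \<in> M \<Longrightarrow> v (m, True) = - cycpart (m, False) p"
  shows "p - ii v (omega0 M) \<in> scom UNIV"
proof -
  define F where "F p = p - (\<Sum>m\<in>M. cycpart (m, True) p * mon [Inr (m, True)] 1 + mon [Inr (m, False)] 1 * cycpart (m, False) p)"
    for p :: "('m \<times> bool, 'k) forms"
  have "additive F"
    unfolding F_def by standard (simp add: additive.add[OF cycpart_additive] distrib_left distrib_right sum.distrib algebra_simps)
  moreover have "F (mon w c) \<in> scom UNIV" if w: "w \<in> Poly_Mapping.keys p" for w c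
  proof -
    have "fdeg w = 1" using hforms_keys(2)[OF p w] .
    from fdeg_1_split[OF this] obtain a j b where ab: "w = a @ Inr j # b" "fdeg a = 0" "fdeg b = 0" .
    obtain m s where j: "j = (m, s)" by (cases j)
    have m: "m \<in> M" using hforms_keys(1)[OF p w] ab j by auto
    have "(\<Sum>m'\<in>M. cycpart (m', True) (mon w c) * mon [Inr (m', True)] 1 + mon [Inr (m', False)] 1 * cycpart (m', False) (mon w c))
      = (\<Sum>m'\<in>M. if m' = m then if s then mon (b @ a @ [Inr j]) c else mon (Inr j # b @ a) c else 0)"
      using ab j by (intro sum.cong) (auto simp: cycpart_mon cyc_word_split mon_mult)
    also have "\<dots> = (if s then mon (b @ a @ [Inr j]) c else mon (Inr j # b @ a) c)"
      using m M by simp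
    finally show ?thesis
      using scom_gen[of "a @ [Inr j]" UNIV b c] scom_gen[of a UNIV "Inr j # b" c] ab by (auto simp: F_def)
  qed
  ultimately have "F p \<in> scom UNIV"
    using additive_closed[of F "scom UNIV" p] scom_0 scom_add by blast
  also have "F p = p - ii v (omega0 M)"
    unfolding F_def ii_omega0 by (simp add: v)
  finally show ?thesis .
qed

section \<open>Tensor algebras by generators and relations\<close>

text \<open>Evaluation of an element of the free ring at a family of elements of a ring.\<close>

definition word_eval :: "('x \<Rightarrow> 'f::ring_1) \<Rightarrow> ('x list \<Rightarrow>\<^sub>0 int) \<Rightarrow> 'f"
  where "word_eval g = lin_ext (\<lambda>w c. of_int c * prod_list (map g w))"

lemma additive_of_int: "additive (\<lambda>c. of_int c * (a :: _ :: ring_1))"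
  by standard (simp add: distrib_right)

lemma word_eval_additive: "additive (word_eval g)"
  unfolding word_eval_def by (intro lin_ext_additive additive_of_int)

lemma word_eval_single: "word_eval g (Poly_Mapping.single w c) = of_int c * prod_list (map g w)"
  unfolding word_eval_def by (intro lin_ext_additive_single additive_of_int)

lemma word_eval_mult: "word_eval g (p * q) = word_eval g p * word_eval g q"
proof (rule biadditive_eqI[of "\<lambda>p q. word_eval g (p * q)" "\<lambda>p q. word_eval g p * word_eval g q"])
  fix u v a b
  show "word_eval g (mon u a * mon v b) = word_eval g (mon u a) * word_eval g (mon v b)"
    by (simp add: mon_mult word_eval_single) (metis mult.assoc mult_of_int_commute)
qed (simp_all add: additive_comp[OF word_eval_additive] additive_mult_l additive_mult_r additive_id word_eval_additive)

lemma Plus_simps [simp]: "Inl a \<in> A <+> B \<longleftrightarrow> a \<in> A" "Inr b \<in> A <+> B \<longleftrightarrow> b \<in> B"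
  by auto

lemma free_ring_simps [simp]:
  "carrier (free_ring Y) = {p. Poly_Mapping.keys p \<subseteq> lists Y}"
  "p \<otimes>\<^bsub>free_ring Y\<^esub> q = p * q" "\<one>\<^bsub>free_ring Y\<^esub> = 1" "\<zero>\<^bsub>free_ring Y\<^esub> = 0" "p \<oplus>\<^bsub>free_ring Y\<^esub> q = p + q"
  by (simp_all add: free_ring_def)

lemma free_ring_ring: "ring (free_ring Y)"
proof (rule ringI)
  show "abelian_group (free_ring Y)"
  proof (rule abelian_groupI)
    fix p assume "p \<in> carrier (free_ring Y)"
    then show "\<exists>q\<in>carrier (free_ring Y). q \<oplus>\<^bsub>free_ring Y\<^esub> p = \<zero>\<^bsub>free_ring Y\<^esub>"
      by (intro bexI[of _ "- p"]) auto
  qed (use keys_add in \<open>fastforce simp: algebra_simps\<close>)+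
  show "monoid (free_ring Y)"
  proof (rule monoidI)
    fix p q assume "p \<in> carrier (free_ring Y)" "q \<in> carrier (free_ring Y)"
    then show "p \<otimes>\<^bsub>free_ring Y\<^esub> q \<in> carrier (free_ring Y)"
      using keys_mult[of p q] by (fastforce simp: plus_list_def)
  qed (auto simp: mult.assoc zero_list_def)
qed (auto simp: algebra_simps)

lemma a_minus_eqI:
  assumes "abelian_group G" "a \<in> carrier G" "b \<in> carrier G" "c \<in> carrier G" "c \<oplus>\<^bsub>G\<^esub> b = a"
  shows "a \<ominus>\<^bsub>G\<^esub> b = c"
proof -
  interpret abelian_group G by fact
  show ?thesis using assms(2-) by (metis a_minus_def add.inv_closed add.m_assoc r_neg r_zero)
qed

lemma free_ring_minus:
  assumes "p \<in> carrier (free_ring Y)" "q \<in> carrier (free_ring Y)"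
  shows "p \<ominus>\<^bsub>free_ring Y\<^esub> q = p - q"
proof (rule a_minus_eqI)
  show "abelian_group (free_ring Y)" using free_ring_ring by (rule ring.is_abelian_group)
qed (use assms keys_diff[of p q] in auto)

text \<open>Only closure of the two carriers under the operations is needed for the relations to live
  in the free ring.\<close>

locale ten_data =
  fixes R :: "('r, 'z) ring_scheme" and M :: "('r, 'm) bimodule"
  assumes R_add: "a \<in> carrier R \<Longrightarrow> b \<in> carrier R \<Longrightarrow> a \<oplus>\<^bsub>R\<^esub> b \<in> carrier R"
    and R_mult: "a \<in> carrier R \<Longrightarrow> b \<in> carrier R \<Longrightarrow> a \<otimes>\<^bsub>R\<^esub> b \<in> carrier R"
    and R_one: "\<one>\<^bsub>R\<^esub> \<in> carrier R"
    and M_add: "m \<in> carrier M \<Longrightarrow> m' \<in> carrier M \<Longrightarrow> m \<oplus>\<^bsub>M\<^esub> m' \<in> carrier M"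
    and M_l: "a \<in> carrier R \<Longrightarrow> m \<in> carrier M \<Longrightarrow> a \<odot>\<^bsub>M\<^esub> m \<in> carrier M"
    and M_r: "a \<in> carrier R \<Longrightarrow> m \<in> carrier M \<Longrightarrow> rsmult M m a \<in> carrier M"
begin

abbreviation "F \<equiv> ten_free R M"
abbreviation "T \<equiv> tensor_algebra R M"
abbreviation "cls \<equiv> ten_class R M"

sublocale F: ring F unfolding ten_free_def by (rule free_ring_ring)

lemma carrier_F: "carrier F = {p. Poly_Mapping.keys p \<subseteq> lists (carrier R <+> carrier M)}"
  by (simp add: ten_free_def)

lemma F_simps [simp]:
  "p \<otimes>\<^bsub>F\<^esub> q = p * q" "\<one>\<^bsub>F\<^esub> = 1" "\<zero>\<^bsub>F\<^esub> = 0" "p \<oplus>\<^bsub>F\<^esub> q = p + q"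
  by (simp_all add: ten_free_def)

lemma F_minus: "p \<in> carrier F \<Longrightarrow> q \<in> carrier F \<Longrightarrow> p \<ominus>\<^bsub>F\<^esub> q = p - q"
  unfolding ten_free_def by (rule free_ring_minus)

lemma F_diff: "p \<in> carrier F \<Longrightarrow> q \<in> carrier F \<Longrightarrow> p - q \<in> carrier F"
  using keys_diff[of p q] by (auto simp: carrier_F)

lemma frag_F: "frag_of w \<in> carrier F \<longleftrightarrow> w \<in> lists (carrier R <+> carrier M)"
  by (simp add: carrier_F)

lemmas F_closed [simp] = F.a_closed[unfolded F_simps] F.m_closed[unfolded F_simps] F_diff
  F.zero_closed[unfolded F_simps] F.one_closed[unfolded F_simps] frag_F

lemma frag_Cons: "frag_of (l # w) = frag_of [l] * frag_of w"
  by (simp add: mon_mult)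

lemma rels_F: "ten_rels R M \<subseteq> carrier F"
  unfolding ten_rels_def by (auto simp: R_add R_mult R_one M_add M_l M_r)

sublocale I: ideal "ten_ideal R M" F
  unfolding ten_ideal_def by (rule F.genideal_ideal[OF rels_F])

lemma rels_ideal: "ten_rels R M \<subseteq> ten_ideal R M"
  unfolding ten_ideal_def by (rule F.genideal_self[OF rels_F])

lemma T_eq:
  "carrier T = carrier (F Quot ten_ideal R M)" "x \<otimes>\<^bsub>T\<^esub> y = x \<otimes>\<^bsub>F Quot ten_ideal R M\<^esub> y"
  "\<one>\<^bsub>T\<^esub> = \<one>\<^bsub>F Quot ten_ideal R M\<^esub>" "\<zero>\<^bsub>T\<^esub> = \<zero>\<^bsub>F Quot ten_ideal R M\<^esub>" "x \<oplus>\<^bsub>T\<^esub> y = x \<oplus>\<^bsub>F Quot ten_ideal R M\<^esub> y"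
  "r \<odot>\<^bsub>T\<^esub> x = ten_base R M r \<otimes>\<^bsub>F Quot ten_ideal R M\<^esub> x"
  by (simp_all add: tensor_algebra_def Let_def)

lemma T_smult: "r \<odot>\<^bsub>T\<^esub> x = ten_base R M r \<otimes>\<^bsub>T\<^esub> x"
  by (simp add: T_eq)

sublocale T: ring T
proof -
  interpret Q: ring "F Quot ten_ideal R M" by (rule I.quotient_is_ring)
  show "ring T"
  proof (rule ringI)
    show "abelian_group T"
      by (rule abelian_groupI) (auto simp: T_eq Q.a_ac intro: Q.add.l_inv_ex)
    show "monoid T"
      by (rule monoidI) (auto simp: T_eq Q.m_assoc)
  qed (auto simp: T_eq Q.l_distr Q.r_distr)
qed

lemma cls_closed [simp]: "p \<in> carrier F \<Longrightarrow> cls p \<in> carrier T"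
  using ring_hom_closed[OF I.rcos_ring_hom] by (simp add: ten_class_def T_eq)

lemma cls_hom:
  assumes "p \<in> carrier F" "q \<in> carrier F"
  shows "cls (p + q) = cls p \<oplus>\<^bsub>T\<^esub> cls q" "cls (p * q) = cls p \<otimes>\<^bsub>T\<^esub> cls q"
  using ring_hom_add[OF I.rcos_ring_hom assms]
    ring_hom_mult[OF I.rcos_ring_hom assms]
  by (simp_all add: ten_class_def T_eq)

lemma cls_0: "cls 0 = \<zero>\<^bsub>T\<^esub>" and cls_1: "cls 1 = \<one>\<^bsub>T\<^esub>"
proof -
  show "cls 1 = \<one>\<^bsub>T\<^esub>"
    using ring_hom_one[OF I.rcos_ring_hom] by (simp add: ten_class_def T_eq)
  have "cls 0 \<oplus>\<^bsub>T\<^esub> cls 0 = cls 0" using cls_hom(1)[of 0 0] by simp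
  then show "cls 0 = \<zero>\<^bsub>T\<^esub>" using cls_closed[of 0] by (simp add: T.add.r_cancel_one')
qed

lemma cls_diff: "p \<in> carrier F \<Longrightarrow> q \<in> carrier F \<Longrightarrow> cls (p - q) = cls p \<ominus>\<^bsub>T\<^esub> cls q"
  by (rule a_minus_eqI[OF T.is_abelian_group, symmetric])
     (auto simp: cls_hom(1)[symmetric])

lemma cls_eq_iff: "p \<in> carrier F \<Longrightarrow> q \<in> carrier F \<Longrightarrow> cls p = cls q \<longleftrightarrow> p - q \<in> ten_ideal R M"
  using F.quotient_eq_iff_same_a_r_cos[OF I.ideal_axioms, of p q] F_minus[of p q] by (simp add: ten_class_def)

lemma carrier_T: "carrier T = cls ` carrier F"
  by (auto simp: T_eq FactRing_def A_RCOSETS_def' ten_class_def)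

lemma cls_rel: "p \<in> carrier F \<Longrightarrow> q \<in> carrier F \<Longrightarrow> p - q \<in> ten_rels R M \<Longrightarrow> cls p = cls q"
  using cls_eq_iff rels_ideal by blast

lemma base_closed [simp]: "a \<in> carrier R \<Longrightarrow> ten_base R M a \<in> carrier T"
  and gen_closed [simp]: "m \<in> carrier M \<Longrightarrow> ten_gen R M m \<in> carrier T"
  by (auto simp: ten_base_def ten_gen_def )

lemma base_add:
  assumes "a \<in> carrier R" "b \<in> carrier R"
  shows "ten_base R M (a \<oplus>\<^bsub>R\<^esub> b) = ten_base R M a \<oplus>\<^bsub>T\<^esub> ten_base R M b"
proof -
  have "cls (frag_of [Inl (a \<oplus>\<^bsub>R\<^esub> b)]) = cls (frag_of [Inl a] + frag_of [Inl b])"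
  proof (rule cls_rel)
    show "frag_of [Inl (a \<oplus>\<^bsub>R\<^esub> b)] - (frag_of [Inl a] + frag_of [Inl b]) \<in> ten_rels R M"
      using assms unfolding ten_rels_def diff_diff_eq[symmetric] by blast
  qed (use assms in \<open>auto simp: R_add\<close>)
  then show ?thesis using assms by (simp add: ten_base_def cls_hom(1))
qed

lemma base_mult:
  assumes "a \<in> carrier R" "b \<in> carrier R"
  shows "ten_base R M (a \<otimes>\<^bsub>R\<^esub> b) = ten_base R M a \<otimes>\<^bsub>T\<^esub> ten_base R M b"
proof -
  have "cls (frag_of [Inl (a \<otimes>\<^bsub>R\<^esub> b)]) = cls (frag_of [Inl a, Inl b])"
    by (rule cls_rel) (use assms in \<open>auto simp: R_mult ten_rels_def\<close>)
  then show ?thesis using assms by (simp add: ten_base_def cls_hom(2) frag_Cons[of _ "[_]"])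
qed

lemma base_one: "ten_base R M \<one>\<^bsub>R\<^esub> = \<one>\<^bsub>T\<^esub>"
proof -
  have "cls (frag_of [Inl \<one>\<^bsub>R\<^esub>]) = cls (frag_of [])"
    by (rule cls_rel) (auto simp: R_one ten_rels_def)
  then show ?thesis by (simp add: ten_base_def cls_1[symmetric] one_mon del: single_one)
qed

lemma gen_add:
  assumes "m \<in> carrier M" "m' \<in> carrier M"
  shows "ten_gen R M (m \<oplus>\<^bsub>M\<^esub> m') = ten_gen R M m \<oplus>\<^bsub>T\<^esub> ten_gen R M m'"
proof -
  have "cls (frag_of [Inr (m \<oplus>\<^bsub>M\<^esub> m')]) = cls (frag_of [Inr m] + frag_of [Inr m'])"
  proof (rule cls_rel)
    show "frag_of [Inr (m \<oplus>\<^bsub>M\<^esub> m')] - (frag_of [Inr m] + frag_of [Inr m']) \<in> ten_rels R M"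
      using assms unfolding ten_rels_def diff_diff_eq[symmetric] by blast
  qed (use assms in \<open>auto simp: M_add\<close>)
  then show ?thesis using assms by (simp add: ten_gen_def cls_hom(1))
qed

lemma gen_l:
  assumes "a \<in> carrier R" "m \<in> carrier M"
  shows "ten_gen R M (a \<odot>\<^bsub>M\<^esub> m) = ten_base R M a \<otimes>\<^bsub>T\<^esub> ten_gen R M m"
proof -
  have "cls (frag_of [Inr (a \<odot>\<^bsub>M\<^esub> m)]) = cls (frag_of [Inl a, Inr m])"
  proof (rule cls_rel)
    show "frag_of [Inr (a \<odot>\<^bsub>M\<^esub> m)] - frag_of [Inl a, Inr m] \<in> ten_rels R M"
      using assms unfolding ten_rels_def by blast
  qed (use assms in \<open>auto simp: M_l\<close>)
  then show ?thesis using assms by (simp add: ten_base_def ten_gen_def cls_hom(2) frag_Cons[of _ "[_]"])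
qed

lemma gen_r:
  assumes "a \<in> carrier R" "m \<in> carrier M"
  shows "ten_gen R M (rsmult M m a) = ten_gen R M m \<otimes>\<^bsub>T\<^esub> ten_base R M a"
proof -
  have "cls (frag_of [Inr (rsmult M m a)]) = cls (frag_of [Inr m, Inl a])"
  proof (rule cls_rel)
    show "frag_of [Inr (rsmult M m a)] - frag_of [Inr m, Inl a] \<in> ten_rels R M"
      using assms unfolding ten_rels_def by blast
  qed (use assms in \<open>auto simp: M_r\<close>)
  then show ?thesis using assms by (simp add: ten_base_def ten_gen_def cls_hom(2) frag_Cons[of _ "[_]"])
qed

text \<open>The tensor algebra is generated as a ring by the images of \<open>R\<close> and \<open>M\<close>.\<close>

lemma ten_induct [consumes 1, case_names base gen diff mult]:
  assumes t: "t \<in> carrier T"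
    and base: "\<And>a. a \<in> carrier R \<Longrightarrow> P (ten_base R M a)"
    and gen: "\<And>m. m \<in> carrier M \<Longrightarrow> P (ten_gen R M m)"
    and diff: "\<And>s t. s \<in> carrier T \<Longrightarrow> t \<in> carrier T \<Longrightarrow> P s \<Longrightarrow> P t \<Longrightarrow> P (s \<ominus>\<^bsub>T\<^esub> t)"
    and mult: "\<And>s t. s \<in> carrier T \<Longrightarrow> t \<in> carrier T \<Longrightarrow> P s \<Longrightarrow> P t \<Longrightarrow> P (s \<otimes>\<^bsub>T\<^esub> t)"
  shows "P t"
proof -
  obtain p where p: "Poly_Mapping.keys p \<subseteq> lists (carrier R <+> carrier M)" "t = cls p"
    using t carrier_T by (auto simp: carrier_F)
  have one: "P (\<one>\<^bsub>T\<^esub>)" using base[OF R_one] by (simp add: base_one)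
  have word: "P (cls (frag_of w))" if "w \<in> lists (carrier R <+> carrier M)" for w
    using that
  proof (induction w)
    case (Cons l w)
    have "P (cls (frag_of [l]))"
    proof (cases l)
      case (Inl a)
      then show ?thesis using Cons.hyps base[of a] by (simp add: ten_base_def)
    next
      case (Inr m)
      then show ?thesis using Cons.hyps gen[of m] by (simp add: ten_gen_def)
    qed
    then show ?case using Cons mult[of "cls (frag_of [l])" "cls (frag_of w)"]
      by (auto simp: frag_Cons[of l w] cls_hom)
  qed (use one in \<open>simp add: cls_1[symmetric] one_mon del: single_one\<close>)
  have "P (cls p) \<and> p \<in> carrier F"
    using p(1)
  proof (induction p rule: frag_induction)
    case zero
    show ?case using diff[OF T.one_closed T.one_closed one one] by (simp add: cls_0 a_minus_def T.r_neg)
  next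
    case (one w)
    then show ?case using word[of w] by simp
  next
    case (diff a b)
    then show ?case using assms(4)[of "cls a" "cls b"] cls_diff[of a b] F_diff[of a b] by auto
  qed
  then show ?thesis using p(2) by simp
qed

lemma ten_degree_eq: "ten_degree R M q = cls ` {p \<in> carrier F. \<forall>w\<in>Poly_Mapping.keys p. fdeg w = q}"
  by (simp add: ten_degree_def fdeg_def)

lemma degree_closed: "t \<in> ten_degree R M q \<Longrightarrow> t \<in> carrier T"
  by (auto simp: ten_degree_eq)

lemma degree_0: "\<zero>\<^bsub>T\<^esub> \<in> ten_degree R M q"
  unfolding ten_degree_eq by (rule image_eqI[of _ _ 0]) (auto simp: cls_0)

lemma degree_add:
  assumes "s \<in> ten_degree R M q" "t \<in> ten_degree R M q"
  shows "s \<oplus>\<^bsub>T\<^esub> t \<in> ten_degree R M q"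
proof -
  obtain p p' where p: "p \<in> carrier F" "\<forall>w\<in>Poly_Mapping.keys p. fdeg w = q" "s = cls p"
    "p' \<in> carrier F" "\<forall>w\<in>Poly_Mapping.keys p'. fdeg w = q" "t = cls p'"
    using assms unfolding ten_degree_eq by blast
  show ?thesis unfolding ten_degree_eq
    by (rule image_eqI[of _ _ "p + p'"]) (use p keys_add[of p p'] in \<open>auto simp: cls_hom\<close>)
qed

lemma degree_mult:
  assumes "s \<in> ten_degree R M a" "t \<in> ten_degree R M b"
  shows "s \<otimes>\<^bsub>T\<^esub> t \<in> ten_degree R M (a + b)"
proof -
  obtain p p' where p: "p \<in> carrier F" "\<forall>w\<in>Poly_Mapping.keys p. fdeg w = a" "s = cls p"
    "p' \<in> carrier F" "\<forall>w\<in>Poly_Mapping.keys p'. fdeg w = b" "t = cls p'"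
    using assms unfolding ten_degree_eq by blast
  have "fdeg w = a + b" if "w \<in> Poly_Mapping.keys (p * p')" for w
    using that p keys_mult[of p p'] by (force simp: plus_list_def)
  then show ?thesis unfolding ten_degree_eq
    by (intro image_eqI[of _ _ "p * p'"]) (use p in \<open>auto simp: cls_hom\<close>)
qed

lemma degree_base: "a \<in> carrier R \<Longrightarrow> ten_base R M a \<in> ten_degree R M 0"
  and degree_gen: "m \<in> carrier M \<Longrightarrow> ten_gen R M m \<in> ten_degree R M 1"
  unfolding ten_degree_eq ten_base_def ten_gen_def by (auto intro!: imageI)

end

text \<open>The universal property of the tensor algebra, for maps into a ring given as a type.\<close>

locale ten_lift = ten_data R M for R :: "('r, 'z) ring_scheme" and M :: "('r, 'm) bimodule" +
  fixes f :: "'r \<Rightarrow> 'f::ring_1" and g :: "'m \<Rightarrow> 'f"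
  assumes f_add: "a \<in> carrier R \<Longrightarrow> b \<in> carrier R \<Longrightarrow> f (a \<oplus>\<^bsub>R\<^esub> b) = f a + f b"
    and f_mult: "a \<in> carrier R \<Longrightarrow> b \<in> carrier R \<Longrightarrow> f (a \<otimes>\<^bsub>R\<^esub> b) = f a * f b"
    and f_one: "f \<one>\<^bsub>R\<^esub> = 1"
    and g_add: "m \<in> carrier M \<Longrightarrow> m' \<in> carrier M \<Longrightarrow> g (m \<oplus>\<^bsub>M\<^esub> m') = g m + g m'"
    and g_l: "a \<in> carrier R \<Longrightarrow> m \<in> carrier M \<Longrightarrow> g (a \<odot>\<^bsub>M\<^esub> m) = f a * g m"
    and g_r: "a \<in> carrier R \<Longrightarrow> m \<in> carrier M \<Longrightarrow> g (rsmult M m a) = g m * f a"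
begin

abbreviation "e \<equiv> word_eval (case_sum f g)"

text \<open>The map induced on the quotient; by \<open>lift_hom_cls\<close> the choice of representative is irrelevant.\<close>

definition lift_hom :: "('r, 'm) ten \<Rightarrow> 'f"
  where "lift_hom t = e (SOME p. p \<in> carrier F \<and> t = cls p)"

lemmas e_add = additive.add[OF word_eval_additive] and e_diff = additive.diff[OF word_eval_additive]
  and e_minus = additive.minus[OF word_eval_additive] and e_0 = additive.zero[OF word_eval_additive]

text \<open>The kernel of the evaluation is an ideal containing the relations, hence contains the ideal they
  generate.\<close>

lemma ideal_kernel: "p \<in> ten_ideal R M \<Longrightarrow> e p = 0"
proof -
  let ?K = "{p \<in> carrier F. e p = 0}"
  have "ideal ?K F"
  proof (rule idealI)
    show "subgroup ?K (add_monoid F)"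
    proof (rule subgroup.intro)
      fix x y assume "x \<in> ?K" "y \<in> ?K"
      then show "x \<otimes>\<^bsub>add_monoid F\<^esub> y \<in> ?K"
        using F.a_closed[of x y] by (simp add: e_add)
    next
      fix x assume x: "x \<in> ?K"
      have "inv\<^bsub>add_monoid F\<^esub> x = - x"
        using F_minus[of 0 x] x by (simp add: a_minus_def a_inv_def)
      then show "inv\<^bsub>add_monoid F\<^esub> x \<in> ?K" using x F_diff[of 0 x] by (simp add: e_minus)
    qed (auto simp: e_0)
    fix a x assume "a \<in> ?K" "x \<in> carrier F"
    then show "x \<otimes>\<^bsub>F\<^esub> a \<in> ?K" "a \<otimes>\<^bsub>F\<^esub> x \<in> ?K"
      using F.m_closed[of x a] F.m_closed[of a x] by (simp_all add: word_eval_mult)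
  qed (rule F.ring_axioms)
  moreover have "ten_rels R M \<subseteq> ?K"
  proof -
    have "e p = 0" if "p \<in> ten_rels R M" for p
      using that unfolding ten_rels_def
      by (auto simp: e_diff word_eval_single f_add f_mult f_one g_add g_l g_r)
    then show ?thesis using rels_F by blast
  qed
  ultimately show "p \<in> ten_ideal R M \<Longrightarrow> e p = 0"
    unfolding ten_ideal_def using F.genideal_minimal by blast
qed

lemma lift_hom_cls: "p \<in> carrier F \<Longrightarrow> lift_hom (cls p) = e p"
proof -
  assume p: "p \<in> carrier F"
  let ?q = "SOME q. q \<in> carrier F \<and> cls p = cls q"
  have q: "?q \<in> carrier F \<and> cls p = cls ?q" by (rule someI[of _ p]) (use p in simp)
  then have "p - ?q \<in> ten_ideal R M" using cls_eq_iff[of p ?q] p by blast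
  from ideal_kernel[OF this] show ?thesis unfolding lift_hom_def by (simp add: e_diff)
qed

lemma lift_hom_base: "a \<in> carrier R \<Longrightarrow> lift_hom (ten_base R M a) = f a"
  and lift_hom_gen: "m \<in> carrier M \<Longrightarrow> lift_hom (ten_gen R M m) = g m"
  by (simp_all add: ten_base_def ten_gen_def lift_hom_cls word_eval_single)

lemma lift_hom_add: "s \<in> carrier T \<Longrightarrow> t \<in> carrier T \<Longrightarrow> lift_hom (s \<oplus>\<^bsub>T\<^esub> t) = lift_hom s + lift_hom t"
  and lift_hom_mult: "s \<in> carrier T \<Longrightarrow> t \<in> carrier T \<Longrightarrow> lift_hom (s \<otimes>\<^bsub>T\<^esub> t) = lift_hom s * lift_hom t"
proof -
  assume "s \<in> carrier T" "t \<in> carrier T"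
  then obtain p q where pq: "p \<in> carrier F" "q \<in> carrier F" "s = cls p" "t = cls q"
    unfolding carrier_T by blast
  then show "lift_hom (s \<oplus>\<^bsub>T\<^esub> t) = lift_hom s + lift_hom t" "lift_hom (s \<otimes>\<^bsub>T\<^esub> t) = lift_hom s * lift_hom t"
    using pq cls_hom[OF pq(1,2), symmetric]
    by (simp_all add: lift_hom_cls e_add word_eval_mult)
qed

lemma lift_hom_one: "lift_hom \<one>\<^bsub>T\<^esub> = 1"
  using lift_hom_base[OF R_one] by (simp add: base_one f_one)

text \<open>The induced map respects a multiplicative grading \<open>H\<close> of the target.\<close>

lemma lift_hom_degree:
  assumes H: "\<And>q. 0 \<in> H q" "\<And>q x y. x \<in> H q \<Longrightarrow> y \<in> H q \<Longrightarrow> x - y \<in> H q"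
    "\<And>a b x y. x \<in> H a \<Longrightarrow> y \<in> H b \<Longrightarrow> x * y \<in> H (a + b)" "1 \<in> H 0"
    and f: "\<And>a. a \<in> carrier R \<Longrightarrow> f a \<in> H 0" and g: "\<And>m. m \<in> carrier M \<Longrightarrow> g m \<in> H (Suc 0)"
    and t: "t \<in> ten_degree R M q"
  shows "lift_hom t \<in> H q"
proof -
  obtain p where p: "p \<in> carrier F" "\<forall>w\<in>Poly_Mapping.keys p. fdeg w = q" "t = cls p"
    using t unfolding ten_degree_eq by blast
  have word: "prod_list (map (case_sum f g) w) \<in> H (fdeg w)" if "w \<in> lists (carrier R <+> carrier M)" for w
    using that
  proof (induction w)
    case (Cons l w)
    then show ?case using H(3)[OF f, of _ "prod_list (map (case_sum f g) w)" "fdeg w"]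
        H(3)[OF g, of _ "prod_list (map (case_sum f g) w)" "fdeg w"]
      by (cases l) auto
  qed (simp add: H)
  have "Poly_Mapping.keys p \<subseteq> {w \<in> lists (carrier R <+> carrier M). fdeg w = q}"
    using p by (auto simp: carrier_F)
  then have "e p \<in> H q"
  proof (induction p rule: frag_induction)
    case (one w)
    then show ?case using word[of w] by (auto simp: word_eval_single)
  qed (auto simp: e_0 e_diff H)
  then show ?thesis using p by (simp add: lift_hom_cls)
qed

end

section \<open>Quotients by generated subgroups\<close>

text \<open>Cosets of a generated subgroup of a commutative group, in the notation shared by all the
  quotients below.\<close>

lemma coset_eq_iff:
  fixes G (structure)
  assumes "comm_group G" "S \<subseteq> carrier G" "x \<in> carrier G" "y \<in> carrier G"
  shows "generate G S #>\<^bsub>G\<^esub> x = generate G S #>\<^bsub>G\<^esub> y \<longleftrightarrow> x \<otimes>\<^bsub>G\<^esub> inv\<^bsub>G\<^esub> y \<in> generate G S"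
proof -
  interpret comm_group G by fact
  have N: "subgroup (generate G S) G" by (rule generate_is_subgroup[OF assms(2)])
  show ?thesis
  proof
    assume "generate G S #> x = generate G S #> y"
    then have "x \<in> generate G S #> y" using rcos_self[OF assms(3) N] by simp
    then obtain h where "h \<in> generate G S" "x = h \<otimes> y" by (auto simp: r_coset_def)
    then show "x \<otimes> inv y \<in> generate G S"
      using assms subgroup.mem_carrier[OF N] by (simp add: m_assoc)
  next
    assume "x \<otimes> inv y \<in> generate G S"
    moreover have "x = x \<otimes> inv y \<otimes> y" using assms by (simp add: m_assoc)
    ultimately have "x \<in> generate G S #> y" unfolding r_coset_def by blast
    then show "generate G S #> x = generate G S #> y" using repr_independence[OF _ assms(4) N] by simp
  qed
qed

lemma coset_mult:
  fixes G (structure)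
  assumes "comm_group G" "S \<subseteq> carrier G" "x \<in> carrier G" "y \<in> carrier G"
  shows "(generate G S #>\<^bsub>G\<^esub> x) <#>\<^bsub>G\<^esub> (generate G S #>\<^bsub>G\<^esub> y) = generate G S #>\<^bsub>G\<^esub> (x \<otimes>\<^bsub>G\<^esub> y)"
proof -
  interpret comm_group G by fact
  show ?thesis
    using normal.rcos_sum[OF subgroup_imp_normal[OF generate_is_subgroup[OF assms(2)]] assms(3,4)] .
qed

text \<open>Evaluation of \<open>induced\<close> on a coset on which the function is constant.\<close>

lemma induced_coset:
  fixes G (structure)
  assumes "comm_group G" "S \<subseteq> carrier G" "x \<in> carrier G"
    and "\<And>y. y \<in> carrier G \<Longrightarrow> y \<otimes>\<^bsub>G\<^esub> inv\<^bsub>G\<^esub> x \<in> generate G S \<Longrightarrow> f y = f x"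
  shows "induced f (generate G S #>\<^bsub>G\<^esub> x) = f x"
proof -
  interpret comm_group G by fact
  have N: "subgroup (generate G S) G" by (rule generate_is_subgroup[OF assms(2)])
  have "f y = f x" if y: "y \<in> generate G S #> x" for y
  proof (rule assms(4))
    obtain h where h: "h \<in> generate G S" "y = h \<otimes> x" using y by (auto simp: r_coset_def)
    show y: "y \<in> carrier G" using h subgroup.mem_carrier[OF N] assms(3) by simp
    show "y \<otimes> inv x \<in> generate G S" using h subgroup.mem_carrier[OF N] assms(3) by (simp add: m_assoc)
  qed
  moreover have "x \<in> generate G S #> x" by (rule rcos_self[OF assms(3) N])
  ultimately have "f ` (generate G S #> x) = {f x}" by blast
  then show ?thesis by (simp add: induced_def)
qed

section \<open>The tensor square of an algebra and its one-forms\<close>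

text \<open>An algebra embedded in a ring \<open>'f\<close>, together with a derivation \<open>D\<close> from the image into
  \<open>'f\<close>. Identities in the algebra can then be checked in \<open>'f\<close>.\<close>

locale emb_alg = ring A for A :: "('k, 'a) module" (structure) +
  fixes \<Phi> :: "'a \<Rightarrow> 'f::ring_1" and \<kappa> :: "'k \<Rightarrow> 'f" and D :: "'f \<Rightarrow> 'f"
  assumes \<Phi>_add: "a \<in> carrier A \<Longrightarrow> b \<in> carrier A \<Longrightarrow> \<Phi> (a \<oplus> b) = \<Phi> a + \<Phi> b"
    and \<Phi>_mult: "a \<in> carrier A \<Longrightarrow> b \<in> carrier A \<Longrightarrow> \<Phi> (a \<otimes> b) = \<Phi> a * \<Phi> b"
    and \<Phi>_one: "\<Phi> \<one> = 1"
    and \<Phi>_inj: "inj_on \<Phi> (carrier A)"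
    and smult_closed: "a \<in> carrier A \<Longrightarrow> c \<odot> a \<in> carrier A"
    and \<Phi>_smult: "a \<in> carrier A \<Longrightarrow> \<Phi> (c \<odot> a) = \<kappa> c * \<Phi> a"
    and \<kappa>_central: "\<kappa> c * z = z * \<kappa> c"
    and D_add: "D (z + z') = D z + D z'"
    and D_mult: "a \<in> carrier A \<Longrightarrow> b \<in> carrier A \<Longrightarrow> D (\<Phi> a * \<Phi> b) = D (\<Phi> a) * \<Phi> b + \<Phi> a * D (\<Phi> b)"
    and D_smult: "D (\<kappa> c * z) = \<kappa> c * D z"
begin

abbreviation "E \<equiv> tsq_free A"
abbreviation "N \<equiv> generate (tsq_free A) (tsq_rels A)"
abbreviation "tc \<equiv> tsq_class A"

lemma E_simps [simp]: "x \<otimes>\<^bsub>E\<^esub> y = x + y" "\<one>\<^bsub>E\<^esub> = 0"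
  by (simp_all add: tsq_free_def)

lemma carrier_E: "carrier E = {p. Poly_Mapping.keys p \<subseteq> carrier A \<times> carrier A}"
  by (auto simp: tsq_free_def)

lemma E_inv: "x \<in> carrier E \<Longrightarrow> inv\<^bsub>E\<^esub> x = - x"
  by (simp add: tsq_free_def)

lemma E_frag [simp]: "frag_of (a, b) \<in> carrier E \<longleftrightarrow> a \<in> carrier A \<and> b \<in> carrier A"
  by (simp add: carrier_E)

lemma E_diff [simp]: "x \<in> carrier E \<Longrightarrow> y \<in> carrier E \<Longrightarrow> x - y \<in> carrier E"
  using keys_diff[of x y] by (auto simp: carrier_E)

lemma E_zero [simp]: "0 \<in> carrier E" by (simp add: carrier_E)

lemma E_minus [simp]: "x \<in> carrier E \<Longrightarrow> - x \<in> carrier E" by (simp add: carrier_E)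

lemma E_add [simp]: "x \<in> carrier E \<Longrightarrow> y \<in> carrier E \<Longrightarrow> x + y \<in> carrier E"
  using E_diff[of x "- y"] by simp

lemma E_comm_group: "comm_group E"
  by (simp add: tsq_free_def abelian_free_Abelian_group)

lemma rels_E: "tsq_rels A \<subseteq> carrier E"
  unfolding tsq_rels_def by (auto simp: smult_closed)

lemma N_closed:
  "0 \<in> N" "x \<in> tsq_rels A \<Longrightarrow> x \<in> N" "x \<in> N \<Longrightarrow> y \<in> N \<Longrightarrow> x + y \<in> N" "x \<in> N \<Longrightarrow> - x \<in> N"
  "x \<in> N \<Longrightarrow> x \<in> carrier E"
proof -
  have N: "subgroup N E"
    using group.generate_is_subgroup[OF comm_group.axioms(2)[OF E_comm_group] rels_E] .
  show "0 \<in> N" using subgroup.one_closed[OF N] by simp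
  show "x \<in> tsq_rels A \<Longrightarrow> x \<in> N" by (rule generate.incl)
  show "x \<in> N \<Longrightarrow> y \<in> N \<Longrightarrow> x + y \<in> N" using subgroup.m_closed[OF N, of x y] by simp
  show c: "x \<in> N \<Longrightarrow> x \<in> carrier E" using subgroup.mem_carrier[OF N] .
  show "x \<in> N \<Longrightarrow> - x \<in> N" using subgroup.m_inv_closed[OF N, of x] c E_inv by simp
qed

lemma N_diff: "x \<in> N \<Longrightarrow> y \<in> N \<Longrightarrow> x - y \<in> N"
  using N_closed(3)[of x "- y"] N_closed(4) by simp

text \<open>An additive map that sends the relations into a subgroup sends everything they generate there.\<close>

lemma N_additive:
  assumes "additive h" "\<And>r. r \<in> tsq_rels A \<Longrightarrow> h r \<in> S"
    and S: "0 \<in> S" "\<And>x y. x \<in> S \<Longrightarrow> y \<in> S \<Longrightarrow> x - y \<in> S" and "x \<in> N"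
  shows "h x \<in> S"
  using assms(5)
proof (induction rule: generate.induct)
  case one
  then show ?case using S by (simp add: additive.zero[OF assms(1)])
next
  case (incl r)
  then show ?case by (rule assms(2))
next
  case (inv r)
  then show ?case using S(2)[OF S(1) assms(2)[OF inv]] rels_E
    by (simp add: E_inv subset_iff additive.minus[OF assms(1)])
next
  case (eng x y)
  then show ?case using S(2)[of "h x" "- h y"] S(2)[OF S(1), of "h y"] by (simp add: additive.add[OF assms(1)])
qed

lemma tc_eq_iff: "p \<in> carrier E \<Longrightarrow> q \<in> carrier E \<Longrightarrow> tc p = tc q \<longleftrightarrow> p - q \<in> N"
  using coset_eq_iff[OF E_comm_group rels_E, of p q] by (simp add: tsq_class_def E_inv)

lemma induced_tc:
  "p \<in> carrier E \<Longrightarrow> (\<And>q. q \<in> carrier E \<Longrightarrow> q - p \<in> N \<Longrightarrow> f q = f p) \<Longrightarrow> induced f (tc p) = f p"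
  using induced_coset[OF E_comm_group rels_E, of p f] by (simp add: tsq_class_def E_inv)

lemma ts_carrier: "carrier (tensor_square A) = tc ` carrier E"
  by (auto simp: tensor_square_def Let_def FactGroup_def RCOSETS_def tsq_class_def)

lemma tc_add: "p \<in> carrier E \<Longrightarrow> q \<in> carrier E \<Longrightarrow> tc p \<oplus>\<^bsub>tensor_square A\<^esub> tc q = tc (p + q)"
  using coset_mult[OF E_comm_group rels_E, of p q]
  by (simp add: tensor_square_def Let_def FactGroup_def tsq_class_def)

lemma frag_extend_additive: "additive (frag_extend h)"
  by standard (simp add: frag_extend_add)

lemma E_induct [consumes 1, case_names zero frag diff]:
  assumes "p \<in> carrier E" "P 0" "\<And>a b. a \<in> carrier A \<Longrightarrow> b \<in> carrier A \<Longrightarrow> P (frag_of (a, b))"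
    "\<And>p q. p \<in> carrier E \<Longrightarrow> q \<in> carrier E \<Longrightarrow> P p \<Longrightarrow> P q \<Longrightarrow> P (p - q)"
  shows "P p"
  using free_Abelian_group_induct[of p "carrier A \<times> carrier A" P] assms unfolding carrier_E by auto

lemma lact_E: "p \<in> carrier E \<Longrightarrow> a \<in> carrier A \<Longrightarrow> frag_extend (\<lambda>(b, c). frag_of (a \<otimes> b, c)) p \<in> carrier E"
  by (induction p rule: E_induct) (simp_all add: frag_extend_diff)

lemma ract_E: "p \<in> carrier E \<Longrightarrow> a \<in> carrier A \<Longrightarrow> frag_extend (\<lambda>(b, c). frag_of (b, c \<otimes> a)) p \<in> carrier E"
  by (induction p rule: E_induct) (simp_all add: frag_extend_diff)

lemma smult_lmult: "a \<in> carrier A \<Longrightarrow> b \<in> carrier A \<Longrightarrow> a \<otimes> (c \<odot> b) = c \<odot> (a \<otimes> b)"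
  and smult_rmult: "a \<in> carrier A \<Longrightarrow> b \<in> carrier A \<Longrightarrow> (c \<odot> b) \<otimes> a = c \<odot> (b \<otimes> a)"
  by (rule inj_onD[OF \<Phi>_inj]; simp add: \<Phi>_mult \<Phi>_smult smult_closed mult.assoc; simp add: \<kappa>_central mult.assoc)+

lemma lact:
  assumes a: "a \<in> carrier A" and p: "p \<in> carrier E"
  shows "a \<odot>\<^bsub>tensor_square A\<^esub> tc p = tc (frag_extend (\<lambda>(b, c). frag_of (a \<otimes> b, c)) p)"
proof -
  let ?l = "frag_extend (\<lambda>(b, c). frag_of (a \<otimes> b, c))"
  have "?l r \<in> N" if "r \<in> tsq_rels A" for r
  proof -
    have "?l r \<in> tsq_rels A" using that unfolding tsq_rels_def
      by (elim UnE CollectE exE conjE; simp add: frag_extend_diff a r_distr smult_lmult)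
        (use a in blast)+
    then show ?thesis by (rule N_closed)
  qed
  then have "?l x \<in> N" if "x \<in> N" for x
    by (rule N_additive[OF frag_extend_additive _ N_closed(1) N_diff that])
  then show ?thesis
    unfolding tensor_square_def Let_def
    by (simp, intro induced_tc[OF p] tc_eq_iff[THEN iffD2])
      (simp_all add: lact_E a p flip: frag_extend_diff)
qed

lemma ract:
  assumes a: "a \<in> carrier A" and p: "p \<in> carrier E"
  shows "rsmult (tensor_square A) (tc p) a = tc (frag_extend (\<lambda>(b, c). frag_of (b, c \<otimes> a)) p)"
proof -
  let ?l = "frag_extend (\<lambda>(b, c). frag_of (b, c \<otimes> a))"
  have "?l r \<in> N" if "r \<in> tsq_rels A" for r
  proof -
    have "?l r \<in> tsq_rels A" using that unfolding tsq_rels_def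
      by (elim UnE CollectE exE conjE; simp add: frag_extend_diff a l_distr smult_rmult)
        (use a in blast)+
    then show ?thesis by (rule N_closed)
  qed
  then have "?l x \<in> N" if "x \<in> N" for x
    by (rule N_additive[OF frag_extend_additive _ N_closed(1) N_diff that])
  then show ?thesis
    unfolding tensor_square_def Let_def
    by (simp, intro induced_tc[OF p] tc_eq_iff[THEN iffD2])
      (simp_all add: ract_E a p flip: frag_extend_diff)
qed

text \<open>The multiplication map and the map \<open>a \<otimes> b \<mapsto> \<Phi>(a) D(\<Phi>(b))\<close> on representatives, with values in \<open>'f\<close>.\<close>

definition mult_eval :: "('a \<times> 'a \<Rightarrow>\<^sub>0 int) \<Rightarrow> 'f"
  where "mult_eval = lin_ext (\<lambda>(a, b) n. of_int n * (\<Phi> a * \<Phi> b))"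

definition der_eval :: "('a \<times> 'a \<Rightarrow>\<^sub>0 int) \<Rightarrow> 'f"
  where "der_eval = lin_ext (\<lambda>(a, b) n. of_int n * (\<Phi> a * D (\<Phi> b)))"

lemma mult_eval_additive: "additive mult_eval" and der_eval_additive: "additive der_eval"
  unfolding mult_eval_def der_eval_def by (intro lin_ext_additive; clarsimp simp: additive_of_int)+

lemma mult_eval_frag [simp]: "mult_eval (frag_of (a, b)) = \<Phi> a * \<Phi> b" and der_eval_frag [simp]: "der_eval (frag_of (a, b)) = \<Phi> a * D (\<Phi> b)"
  unfolding mult_eval_def der_eval_def by (subst lin_ext_single; simp)+

lemmas mult_eval_simps = additive.add[OF mult_eval_additive] additive.diff[OF mult_eval_additive] additive.zero[OF mult_eval_additive] additive.minus[OF mult_eval_additive]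
lemmas der_eval_simps = additive.add[OF der_eval_additive] additive.diff[OF der_eval_additive] additive.zero[OF der_eval_additive] additive.minus[OF der_eval_additive]

lemma \<Phi>_zero: "\<Phi> \<zero> = 0"
  using \<Phi>_add[OF zero_closed zero_closed] by simp

lemma \<Phi>_a_inv: "a \<in> carrier A \<Longrightarrow> \<Phi> (\<ominus> a) = - \<Phi> a"
  using \<Phi>_add[of a "\<ominus> a"] by (simp add: r_neg \<Phi>_zero eq_neg_iff_add_eq_0 add.commute)

lemma \<Phi>_minus: "a \<in> carrier A \<Longrightarrow> b \<in> carrier A \<Longrightarrow> \<Phi> (a \<ominus> b) = \<Phi> a - \<Phi> b"
  by (simp add: a_minus_def \<Phi>_add \<Phi>_a_inv)

lemma \<Phi>_nat_pow: "a \<in> carrier A \<Longrightarrow> \<Phi> (add_pow A (n::nat) a) = of_nat n * \<Phi> a"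
  by (induction n) (simp_all add: \<Phi>_zero \<Phi>_add algebra_simps)

lemma \<Phi>_int_pow: "a \<in> carrier A \<Longrightarrow> \<Phi> (add_pow A (n::int) a) = of_int n * \<Phi> a"
  by (cases "0 \<le> n") (simp_all add: add_pow_int_ge add_pow_int_lt \<Phi>_nat_pow \<Phi>_a_inv)

lemma \<Phi>_finsum: "finite S \<Longrightarrow> f \<in> S \<rightarrow> carrier A \<Longrightarrow> \<Phi> (finsum A f S) = (\<Sum>x\<in>S. \<Phi> (f x))"
  by (induction S rule: finite_induct) (simp_all add: \<Phi>_zero \<Phi>_add)

text \<open>The same sum, formed in the algebra. It is sent to \<open>mult_eval\<close> by \<open>\<Phi>\<close>.\<close>

definition mult_sum :: "('a \<times> 'a \<Rightarrow>\<^sub>0 int) \<Rightarrow> 'a"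
  where "mult_sum p = (\<Oplus>bc \<in> Poly_Mapping.keys p. add_pow A (Poly_Mapping.lookup p bc) (fst bc \<otimes> snd bc))"

lemma mult_sum:
  assumes "p \<in> carrier E"
  shows "mult_sum p \<in> carrier A" "\<Phi> (mult_sum p) = mult_eval p"
proof -
  have *: "(\<lambda>bc. add_pow A (Poly_Mapping.lookup p bc) (fst bc \<otimes> snd bc)) \<in> Poly_Mapping.keys p \<rightarrow> carrier A"
    using assms by (fastforce simp: carrier_E intro!: add.int_pow_closed)
  then show "mult_sum p \<in> carrier A" unfolding mult_sum_def by (rule finsum_closed)
  show "\<Phi> (mult_sum p) = mult_eval p" unfolding mult_sum_def mult_eval_def lin_ext_def
    using assms by (subst \<Phi>_finsum[OF finite_keys *]) (fastforce simp: carrier_E \<Phi>_int_pow \<Phi>_mult intro!: sum.cong)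
qed

lemma mult_eval_N: "x \<in> N \<Longrightarrow> mult_eval x = 0" and der_eval_N: "x \<in> N \<Longrightarrow> der_eval x = 0"
proof -
  have c: "\<Phi> a * (\<kappa> c * z) = \<kappa> c * (\<Phi> a * z)" for a c z
    by (metis \<kappa>_central mult.assoc)
  have "mult_eval r = 0 \<and> der_eval r = 0" if "r \<in> tsq_rels A" for r
    using that unfolding tsq_rels_def
    by (auto simp: mult_eval_simps der_eval_simps \<Phi>_add D_add distrib_left distrib_right \<Phi>_smult D_smult mult.assoc c)
  then show "x \<in> N \<Longrightarrow> mult_eval x = 0" "x \<in> N \<Longrightarrow> der_eval x = 0"
    using N_additive[OF mult_eval_additive, of "{0}"] N_additive[OF der_eval_additive, of "{0}"] by auto
qed

lemma tsq_mult_tc: "p \<in> carrier E \<Longrightarrow> tsq_mult A (tc p) = mult_sum p"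
  unfolding tsq_mult_def mult_sum_def[symmetric]
proof (rule induced_tc)
  fix q assume pq: "p \<in> carrier E" "q \<in> carrier E" "q - p \<in> N"
  then have "mult_eval q = mult_eval p" using mult_eval_N[OF pq(3)] by (simp add: mult_eval_simps)
  then show "mult_sum q = mult_sum p" using mult_sum pq by (metis inj_onD[OF \<Phi>_inj])
qed

lemma carrier_Omega1: "carrier (Omega1 A) = tc ` {p \<in> carrier E. mult_eval p = 0}"
proof -
  have "mult_sum p = \<zero> \<longleftrightarrow> mult_eval p = 0" if "p \<in> carrier E" for p
    using mult_sum[OF that] inj_onD[OF \<Phi>_inj, of "mult_sum p" \<zero>] \<Phi>_zero by auto
  then show ?thesis unfolding Omega1_def by (auto simp: ts_carrier tsq_mult_tc)
qed

lemma Omega1_ops: "m \<oplus>\<^bsub>Omega1 A\<^esub> m' = m \<oplus>\<^bsub>tensor_square A\<^esub> m'" "a \<odot>\<^bsub>Omega1 A\<^esub> m = a \<odot>\<^bsub>tensor_square A\<^esub> m"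
  "rsmult (Omega1 A) m a = rsmult (tensor_square A) m a"
  by (simp_all add: Omega1_def)

lemma mult_eval_lact: "p \<in> carrier E \<Longrightarrow> a \<in> carrier A \<Longrightarrow> mult_eval (frag_extend (\<lambda>(b, c). frag_of (a \<otimes> b, c)) p) = \<Phi> a * mult_eval p"
  by (induction p rule: E_induct) (simp_all add: frag_extend_diff mult_eval_simps \<Phi>_mult algebra_simps)

lemma der_eval_lact: "p \<in> carrier E \<Longrightarrow> a \<in> carrier A \<Longrightarrow> der_eval (frag_extend (\<lambda>(b, c). frag_of (a \<otimes> b, c)) p) = \<Phi> a * der_eval p"
  by (induction p rule: E_induct) (simp_all add: frag_extend_diff der_eval_simps \<Phi>_mult algebra_simps)

lemma mult_eval_ract: "p \<in> carrier E \<Longrightarrow> a \<in> carrier A \<Longrightarrow> mult_eval (frag_extend (\<lambda>(b, c). frag_of (b, c \<otimes> a)) p) = mult_eval p * \<Phi> a"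
  by (induction p rule: E_induct) (simp_all add: frag_extend_diff mult_eval_simps \<Phi>_mult algebra_simps)

lemma der_eval_ract: "p \<in> carrier E \<Longrightarrow> a \<in> carrier A \<Longrightarrow>
    der_eval (frag_extend (\<lambda>(b, c). frag_of (b, c \<otimes> a)) p) = der_eval p * \<Phi> a + mult_eval p * D (\<Phi> a)"
  by (induction p rule: E_induct) (simp_all add: frag_extend_diff mult_eval_simps der_eval_simps \<Phi>_mult D_mult algebra_simps)

text \<open>The map \<open>a \<otimes> b \<mapsto> \<Phi>(a) D(\<Phi>(b))\<close>. It is left linear; it is right linear on the kernel of
  multiplication, where the second term of \<open>D(bc) = D(b) c + b D(c)\<close> contributes
  \<open>(\<Sum> a\<^sub>i b\<^sub>i) D(c) = 0\<close>.\<close>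

definition form1_map :: "'a tsq \<Rightarrow> 'f"
  where "form1_map = induced der_eval"

lemma form1_map: "p \<in> carrier E \<Longrightarrow> form1_map (tc p) = der_eval p"
  unfolding form1_map_def by (rule induced_tc) (use der_eval_N[of "_ - p"] in \<open>auto simp: der_eval_simps\<close>)

sublocale Om: ten_lift A "Omega1 A" \<Phi> form1_map
proof
  show "m \<oplus>\<^bsub>Omega1 A\<^esub> m' \<in> carrier (Omega1 A)" "form1_map (m \<oplus>\<^bsub>Omega1 A\<^esub> m') = form1_map m + form1_map m'"
    if m: "m \<in> carrier (Omega1 A)" "m' \<in> carrier (Omega1 A)" for m m'
    using m by (auto simp: Omega1_ops carrier_Omega1 tc_add mult_eval_simps form1_map der_eval_simps intro!: imageI)
  show "a \<odot>\<^bsub>Omega1 A\<^esub> m \<in> carrier (Omega1 A)" "form1_map (a \<odot>\<^bsub>Omega1 A\<^esub> m) = \<Phi> a * form1_map m"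
    if "a \<in> carrier A" "m \<in> carrier (Omega1 A)" for a m
    using that by (auto simp: Omega1_ops carrier_Omega1 lact lact_E mult_eval_lact form1_map der_eval_lact intro!: imageI)
  show "rsmult (Omega1 A) m a \<in> carrier (Omega1 A)" "form1_map (rsmult (Omega1 A) m a) = form1_map m * \<Phi> a"
    if "a \<in> carrier A" "m \<in> carrier (Omega1 A)" for a m
    using that by (auto simp: Omega1_ops carrier_Omega1 ract ract_E mult_eval_ract form1_map der_eval_ract intro!: imageI)
qed (simp_all add: \<Phi>_add \<Phi>_mult \<Phi>_one)

abbreviation "\<Omega> \<equiv> Omega A"

lemma Om_T: "Om.T = \<Omega>" by (simp add: Omega_def)

text \<open>The induced homomorphism from forms to \<open>'f\<close>. It sends \<open>a\<close> to \<open>\<Phi>(a)\<close> and \<open>da\<close> to \<open>D(\<Phi>(a))\<close>.\<close>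

definition \<Psi> :: "'a ncform \<Rightarrow> 'f"
  where "\<Psi> = Om.lift_hom"

lemma univ_der_closed: "a \<in> carrier A \<Longrightarrow> univ_der A a \<in> carrier (Omega1 A)"
  by (auto simp: carrier_Omega1 univ_der_def mult_eval_simps \<Phi>_one intro!: imageI)

lemma D_one: "D 1 = 0"
  using D_mult[of \<one> \<one>] by (simp add: \<Phi>_one)

lemma form1_map_univ_der: "a \<in> carrier A \<Longrightarrow> form1_map (univ_der A a) = D (\<Phi> a)"
  by (simp add: univ_der_def form1_map der_eval_simps \<Phi>_one D_one)

lemma \<Psi>_form0: "a \<in> carrier A \<Longrightarrow> \<Psi> (form0 A a) = \<Phi> a"
  and \<Psi>_dform: "a \<in> carrier A \<Longrightarrow> \<Psi> (dform A a) = D (\<Phi> a)"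
  by (simp_all add: \<Psi>_def form0_def dform_def Om.lift_hom_base Om.lift_hom_gen univ_der_closed form1_map_univ_der)

lemma form0_closed [simp]: "a \<in> carrier A \<Longrightarrow> form0 A a \<in> carrier \<Omega>"
  and dform_closed [simp]: "a \<in> carrier A \<Longrightarrow> dform A a \<in> carrier \<Omega>"
  by (simp_all add: form0_def dform_def univ_der_closed flip: Om_T)

lemma form0_hom:
  "a \<in> carrier A \<Longrightarrow> b \<in> carrier A \<Longrightarrow> form0 A (a \<oplus> b) = form0 A a \<oplus>\<^bsub>\<Omega>\<^esub> form0 A b"
  "a \<in> carrier A \<Longrightarrow> b \<in> carrier A \<Longrightarrow> form0 A (a \<otimes> b) = form0 A a \<otimes>\<^bsub>\<Omega>\<^esub> form0 A b"
  "form0 A \<one> = \<one>\<^bsub>\<Omega>\<^esub>"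
  by (simp_all add: form0_def Om.base_add Om.base_mult Om.base_one flip: Om_T)

lemma dform_add:
  assumes "a \<in> carrier A" "b \<in> carrier A"
  shows "dform A (a \<oplus> b) = dform A a \<oplus>\<^bsub>\<Omega>\<^esub> dform A b"
proof -
  have r: "frag_of (\<one>, a \<oplus> b) - frag_of (\<one>, a) - frag_of (\<one>, b) \<in> tsq_rels A"
    "frag_of (a \<oplus> b, \<one>) - frag_of (a, \<one>) - frag_of (b, \<one>) \<in> tsq_rels A"
    unfolding tsq_rels_def using assms one_closed by blast+
  have "univ_der A (a \<oplus> b) = univ_der A a \<oplus>\<^bsub>Omega1 A\<^esub> univ_der A b"
    unfolding univ_der_def Omega1_ops using assms N_diff[OF N_closed(2)[OF r(1)] N_closed(2)[OF r(2)]]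
    by (simp add: tc_add tc_eq_iff algebra_simps)
  then show ?thesis using assms by (simp add: dform_def Om.gen_add univ_der_closed flip: Om_T)
qed

lemma dform_mult:
  assumes "a \<in> carrier A" "b \<in> carrier A"
  shows "dform A (a \<otimes> b) = dform A a \<otimes>\<^bsub>\<Omega>\<^esub> form0 A b \<oplus>\<^bsub>\<Omega>\<^esub> form0 A a \<otimes>\<^bsub>\<Omega>\<^esub> dform A b"
proof -
  have "univ_der A (a \<otimes> b) = rsmult (Omega1 A) (univ_der A a) b \<oplus>\<^bsub>Omega1 A\<^esub> a \<odot>\<^bsub>Omega1 A\<^esub> univ_der A b"
    unfolding univ_der_def Omega1_ops using assms
    by (simp add: lact ract frag_extend_diff tc_add)
  then show ?thesis using assms
    by (simp add: dform_def form0_def Om.gen_add Om.gen_l Om.gen_r Om.M_l Om.M_r univ_der_closed flip: Om_T)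
qed

lemma gen_zero: "ten_gen A (Omega1 A) (tc 0) = \<zero>\<^bsub>\<Omega>\<^esub>"
proof -
  have "tc 0 \<in> carrier (Omega1 A)" by (auto simp: carrier_Omega1 mult_eval_simps intro!: imageI)
  moreover have "tc 0 \<oplus>\<^bsub>Omega1 A\<^esub> tc 0 = tc 0" by (simp add: Omega1_ops tc_add)
  ultimately have "ten_gen A (Omega1 A) (tc 0) \<oplus>\<^bsub>Om.T\<^esub> ten_gen A (Omega1 A) (tc 0) = ten_gen A (Omega1 A) (tc 0)"
    "ten_gen A (Omega1 A) (tc 0) \<in> carrier Om.T"
    using Om.gen_add[of "tc 0" "tc 0"] by simp_all
  then show ?thesis unfolding Om_T[symmetric] by (simp add: Om.T.add.r_cancel_one')
qed

lemma gen_diff: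
  assumes "p \<in> carrier E" "mult_eval p = 0" "q \<in> carrier E" "mult_eval q = 0"
  shows "ten_gen A (Omega1 A) (tc (p - q)) = ten_gen A (Omega1 A) (tc p) \<ominus>\<^bsub>\<Omega>\<^esub> ten_gen A (Omega1 A) (tc q)"
proof -
  have c: "tc p \<in> carrier (Omega1 A)" "tc q \<in> carrier (Omega1 A)" "tc (p - q) \<in> carrier (Omega1 A)"
    using assms by (auto simp: carrier_Omega1 mult_eval_simps intro!: imageI)
  have "tc (p - q) \<oplus>\<^bsub>Omega1 A\<^esub> tc q = tc p" using assms by (simp add: Omega1_ops tc_add)
  from Om.gen_add[OF c(3,2), unfolded this] show ?thesis
    unfolding Om_T[symmetric] using c by (intro a_minus_eqI[symmetric, OF Om.T.is_abelian_group]) simp_all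
qed

lemma dform_const: "dform A (c \<odot> \<one>) = \<zero>\<^bsub>\<Omega>\<^esub>"
proof -
  have "frag_of (c \<odot> \<one>, \<one>) - frag_of (\<one>, c \<odot> \<one>) \<in> tsq_rels A"
    unfolding tsq_rels_def using one_closed by blast
  from N_closed(4)[OF N_closed(2)[OF this]]
  have u: "univ_der A (c \<odot> \<one>) = tc 0"
    unfolding univ_der_def by (simp add: tc_eq_iff smult_closed)
  show ?thesis unfolding dform_def u by (rule gen_zero)
qed

text \<open>Modulo the relations \<open>\<Sum> a\<^sub>i b\<^sub>i \<otimes> 1\<close> only depends on \<open>\<Sum> a\<^sub>i b\<^sub>i\<close>.\<close>

lemma tc_mult_sum:
  assumes "p \<in> carrier E"
  shows "frag_extend (\<lambda>(a, b). frag_of (a \<otimes> b, \<one>)) p - frag_of (mult_sum p, \<one>) \<in> N"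
  using assms
proof (induction p rule: E_induct)
  case zero
  \<comment> \<open>\<open>0 \<otimes> 1\<close> vanishes modulo the relation \<open>(0 + 0) \<otimes> 1 - 0 \<otimes> 1 - 0 \<otimes> 1\<close>.\<close>
  have "mult_sum 0 = \<zero>" by (simp add: mult_sum_def)
  moreover have "frag_of (\<zero> \<oplus> \<zero>, \<one>) - frag_of (\<zero>, \<one>) - frag_of (\<zero>, \<one>) \<in> tsq_rels A"
    unfolding tsq_rels_def using one_closed zero_closed by blast
  ultimately show ?case using N_closed(2) by simp
next
  case (frag a b)
  have "mult_sum (frag_of (a, b)) = a \<otimes> b"
    by (rule inj_onD[OF \<Phi>_inj]) (simp_all add: mult_sum frag \<Phi>_mult)
  then show ?case by (simp add: N_closed)
next
  case (diff p q)
  have m: "mult_sum p \<in> carrier A" "mult_sum q \<in> carrier A" using mult_sum diff by auto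
  have d: "mult_sum (p - q) \<in> carrier A" using mult_sum(1)[of "p - q"] diff by simp
  have e: "mult_sum p = mult_sum (p - q) \<oplus> mult_sum q"
    by (rule inj_onD[OF \<Phi>_inj]) (use mult_sum m diff in \<open>auto simp: \<Phi>_add mult_eval_simps\<close>)
  have "frag_of (mult_sum (p - q) \<oplus> mult_sum q, \<one>) - frag_of (mult_sum (p - q), \<one>) - frag_of (mult_sum q, \<one>) \<in> tsq_rels A"
    unfolding tsq_rels_def using d m(2) one_closed by blast
  then have "frag_of (mult_sum p, \<one>) - frag_of (mult_sum (p - q), \<one>) - frag_of (mult_sum q, \<one>) \<in> tsq_rels A"
    unfolding e[symmetric] .
  from N_closed(3)[OF N_diff[OF diff.IH] N_closed(2)[OF this]]
  show ?case by (simp add: frag_extend_diff)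
qed

text \<open>Forms are generated by the elements \<open>a\<close> and \<open>da\<close>: if \<open>\<Sum> a\<^sub>i b\<^sub>i = 0\<close>, then \<open>\<Sum> a\<^sub>i \<otimes> b\<^sub>i\<close> is
  \<open>\<Sum> (a\<^sub>i \<otimes> b\<^sub>i - a\<^sub>i b\<^sub>i \<otimes> 1) = \<Sum> a\<^sub>i db\<^sub>i\<close>.\<close>

lemma Omega_induct [consumes 1, case_names form0 dform diff mult]:
  assumes t: "t \<in> carrier \<Omega>"
    and form0: "\<And>a. a \<in> carrier A \<Longrightarrow> P (form0 A a)"
    and dform: "\<And>a. a \<in> carrier A \<Longrightarrow> P (dform A a)"
    and diff: "\<And>s t. s \<in> carrier \<Omega> \<Longrightarrow> t \<in> carrier \<Omega> \<Longrightarrow> P s \<Longrightarrow> P t \<Longrightarrow> P (s \<ominus>\<^bsub>\<Omega>\<^esub> t)"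
    and mult: "\<And>s t. s \<in> carrier \<Omega> \<Longrightarrow> t \<in> carrier \<Omega> \<Longrightarrow> P s \<Longrightarrow> P t \<Longrightarrow> P (s \<otimes>\<^bsub>\<Omega>\<^esub> t)"
  shows "P t"
  using t unfolding Om_T[symmetric]
proof (induction t rule: Om.ten_induct)
  case (gen m)
  then obtain p where p: "p \<in> carrier E" "mult_eval p = 0" "m = tc p" by (auto simp: carrier_Omega1)
  let ?h = "frag_extend (\<lambda>(a, b). frag_of (a \<otimes> b, \<one>))"
  let ?G = "\<lambda>p. ten_gen A (Omega1 A) (tc p)"
  have h: "?h p \<in> carrier E \<and> mult_eval (p - ?h p) = 0" if "p \<in> carrier E" for p
    using that by (induction p rule: E_induct) (simp_all add: frag_extend_diff mult_eval_simps \<Phi>_mult \<Phi>_one)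
  have "P (?G (p - ?h p))"
    using p(1)
  proof (induction p rule: E_induct)
    case zero
    show ?case using diff[OF dform_closed dform_closed dform dform, of \<one> \<one>]
      using gen_zero Om.T.minus_eq dform_closed[OF one_closed] by (simp add: Om.T.r_neg a_minus_def[of \<Omega>] flip: Om_T)
  next
    case (frag a b)
    have "tc (frag_of (a, b) - frag_of (a \<otimes> b, \<one>)) = a \<odot>\<^bsub>Omega1 A\<^esub> univ_der A b"
      unfolding univ_der_def Omega1_ops using frag by (simp add: lact frag_extend_diff)
    then show ?case using frag mult[OF form0_closed dform_closed form0 dform, of a b]
      by (simp add: Om.gen_l univ_der_closed Om_T form0_def dform_def)
  next
    case (diff p q)
    have "?G (p - q - ?h (p - q)) = ?G (p - ?h p) \<ominus>\<^bsub>\<Omega>\<^esub> ?G (q - ?h q)"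
      using gen_diff[of "p - ?h p" "q - ?h q"] diff h by (simp add: frag_extend_diff algebra_simps)
    moreover have "?G (r - ?h r) \<in> carrier \<Omega>" if "r \<in> carrier E" for r
      unfolding Om_T[symmetric] using that h[OF that] by (intro Om.gen_closed) (auto simp: carrier_Omega1 intro!: imageI)
    ultimately show ?case using assms(4) diff by simp
  qed
  moreover have "tc (p - ?h p) = tc p"
  proof -
    have "mult_sum p = \<zero>" by (rule inj_onD[OF \<Phi>_inj]) (use mult_sum[OF p(1)] p(2) \<Phi>_zero in auto)
    then have "?h p - frag_of (\<zero>, \<one>) \<in> N" using tc_mult_sum[OF p(1)] by simp
    moreover have "frag_of (\<zero> \<oplus> \<zero>, \<one>) - frag_of (\<zero>, \<one>) - frag_of (\<zero>, \<one>) \<in> tsq_rels A"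
      unfolding tsq_rels_def using one_closed zero_closed by blast
    ultimately have "?h p \<in> N" using N_diff[OF _ N_closed(2)] by fastforce
    then show ?thesis using p(1) h[OF p(1)] N_closed(4)[of "?h p"] by (simp add: tc_eq_iff)
  qed
  ultimately show ?case using p by simp
qed (use form0 diff mult in \<open>auto simp: form0_def Om_T\<close>)

end

section \<open>Recognising free algebras\<close>

lemma finsupp_induct [consumes 1, case_names zero single add]:
  fixes p :: "'x \<Rightarrow>\<^sub>0 'c::comm_monoid_add"
  assumes "Poly_Mapping.keys p \<subseteq> S" "P 0" "\<And>w c. w \<in> S \<Longrightarrow> P (Poly_Mapping.single w c)"
    "\<And>p q. Poly_Mapping.keys p \<subseteq> S \<Longrightarrow> Poly_Mapping.keys q \<subseteq> S \<Longrightarrow> P p \<Longrightarrow> P q \<Longrightarrow> P (p + q)"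
  shows "P p"
proof -
  let ?f = "\<lambda>w. Poly_Mapping.single w (Poly_Mapping.lookup p w)"
  have "Poly_Mapping.keys (sum ?f K) \<subseteq> S \<and> P (sum ?f K)" if "K \<subseteq> Poly_Mapping.keys p" for K
    using finite_subset[OF that finite_keys] that
  proof (induction K rule: finite_induct)
    case (insert w K)
    have "Poly_Mapping.keys (?f w) \<subseteq> S" "P (?f w)" using insert.prems assms(1,3) by (auto split: if_splits)
    moreover have "Poly_Mapping.keys (?f w + sum ?f K) \<subseteq> S"
      using keys_add[of "?f w" "sum ?f K"] insert calculation(1) by blast
    ultimately show ?case using assms(4)[of "?f w" "sum ?f K"] insert by simp
  qed (simp add: assms)
  from this[OF subset_refl] show ?thesis using poly_mapping_sum_single[of p] by simp
qed

text \<open>A ring \<open>T\<close> generated by central scalars \<open>\<kappa>\<close> and elements \<open>\<gamma> j\<close>, together with a homomorphism to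
  the free algebra that sends these generators to the scalars and the letters. Such a
  homomorphism is bijective onto the free algebra over \<open>J\<close>.\<close>

locale free_pres = ring T for T :: "('t, 'z) ring_scheme" (structure) +
  fixes h :: "'t \<Rightarrow> 'x list \<Rightarrow>\<^sub>0 'k::field" and \<kappa> :: "'k \<Rightarrow> 't" and \<gamma> :: "'x \<Rightarrow> 't" and J :: "'x set"
  assumes h_add: "a \<in> carrier T \<Longrightarrow> b \<in> carrier T \<Longrightarrow> h (a \<oplus> b) = h a + h b"
    and h_mult: "a \<in> carrier T \<Longrightarrow> b \<in> carrier T \<Longrightarrow> h (a \<otimes> b) = h a * h b"
    and \<kappa>_closed [simp]: "\<kappa> c \<in> carrier T" and \<gamma>_closed [simp]: "j \<in> J \<Longrightarrow> \<gamma> j \<in> carrier T"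
    and \<kappa>_add: "\<kappa> (c + d) = \<kappa> c \<oplus> \<kappa> d" and \<kappa>_mult: "\<kappa> (c * d) = \<kappa> c \<otimes> \<kappa> d" and \<kappa>_one: "\<kappa> 1 = \<one>"
    and \<kappa>_\<gamma>: "j \<in> J \<Longrightarrow> \<kappa> c \<otimes> \<gamma> j = \<gamma> j \<otimes> \<kappa> c"
    and h_\<kappa>: "h (\<kappa> c) = mon [] c" and h_\<gamma>: "j \<in> J \<Longrightarrow> h (\<gamma> j) = mon [j] 1"
    and generated: "\<And>P t. t \<in> carrier T \<Longrightarrow> (\<And>c. P (\<kappa> c)) \<Longrightarrow> (\<And>j. j \<in> J \<Longrightarrow> P (\<gamma> j)) \<Longrightarrow>
      (\<And>a b. a \<in> carrier T \<Longrightarrow> b \<in> carrier T \<Longrightarrow> P a \<Longrightarrow> P b \<Longrightarrow> P (a \<ominus> b)) \<Longrightarrow>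
      (\<And>a b. a \<in> carrier T \<Longrightarrow> b \<in> carrier T \<Longrightarrow> P a \<Longrightarrow> P b \<Longrightarrow> P (a \<otimes> b)) \<Longrightarrow> P t"
begin

text \<open>The product in \<open>T\<close> that a word spells.\<close>

definition wrd :: "'x list \<Rightarrow> 't"
  where "wrd w = foldr (\<lambda>j t. \<gamma> j \<otimes> t) w \<one>"

lemma wrd_simps [simp]: "wrd [] = \<one>" "wrd (j # w) = \<gamma> j \<otimes> wrd w"
  by (simp_all add: wrd_def)

lemma wrd_closed [simp]: "w \<in> lists J \<Longrightarrow> wrd w \<in> carrier T"
  by (induction w) auto

lemma wrd_append: "u \<in> lists J \<Longrightarrow> v \<in> lists J \<Longrightarrow> wrd (u @ v) = wrd u \<otimes> wrd v"
  by (induction u) (auto simp: m_assoc)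

lemma \<kappa>_wrd: "w \<in> lists J \<Longrightarrow> \<kappa> c \<otimes> wrd w = wrd w \<otimes> \<kappa> c"
proof (induction w)
  case (Cons j w)
  have "\<kappa> c \<otimes> (\<gamma> j \<otimes> wrd w) = \<kappa> c \<otimes> \<gamma> j \<otimes> wrd w" using Cons.prems by (simp add: m_assoc)
  also have "\<dots> = \<gamma> j \<otimes> (\<kappa> c \<otimes> wrd w)" using Cons.prems \<kappa>_\<gamma>[of j c] by (simp add: m_assoc)
  finally have "\<kappa> c \<otimes> (\<gamma> j \<otimes> wrd w) = \<gamma> j \<otimes> (\<kappa> c \<otimes> wrd w)" .
  then show ?case using Cons by (simp add: m_assoc)
qed simp

text \<open>Substitution of the elements \<open>\<gamma> j\<close> for the letters; this is the inverse of \<open>h\<close>.\<close>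

definition \<psi> :: "('x list \<Rightarrow>\<^sub>0 'k) \<Rightarrow> 't"
  where "\<psi> p = (\<Oplus>w\<in>Poly_Mapping.keys p. \<kappa> (Poly_Mapping.lookup p w) \<otimes> wrd w)"

abbreviation "FJ \<equiv> {p. Poly_Mapping.keys p \<subseteq> lists J}"

lemma \<kappa>_zero: "\<kappa> 0 = \<zero>"
  using \<kappa>_add[of 0 0] by (simp add: add.r_cancel_one')

lemma \<psi>_superset:
  assumes "finite S" "Poly_Mapping.keys p \<subseteq> S" "S \<subseteq> lists J"
  shows "\<psi> p = (\<Oplus>w\<in>S. \<kappa> (Poly_Mapping.lookup p w) \<otimes> wrd w)"
  unfolding \<psi>_def
proof (rule add.finprod_mono_neutral_cong_left)
  show "\<kappa> (Poly_Mapping.lookup p w) \<otimes> wrd w = \<zero>" if "w \<in> S - Poly_Mapping.keys p" for w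
    using that assms(3) by (auto simp: in_keys_iff \<kappa>_zero intro!: l_null wrd_closed)
qed (use assms in \<open>auto intro!: m_closed wrd_closed\<close>)

lemma \<psi>_closed [simp]: "p \<in> FJ \<Longrightarrow> \<psi> p \<in> carrier T"
  unfolding \<psi>_def by (rule finsum_closed) (auto intro!: m_closed wrd_closed)

lemma \<psi>_add:
  assumes "p \<in> FJ" "q \<in> FJ"
  shows "\<psi> (p + q) = \<psi> p \<oplus> \<psi> q"
proof -
  let ?S = "Poly_Mapping.keys p \<union> Poly_Mapping.keys q"
  have S: "finite ?S" "?S \<subseteq> lists J" using assms by auto
  have "\<psi> (p + q) = (\<Oplus>w\<in>?S. \<kappa> (Poly_Mapping.lookup p w) \<otimes> wrd w \<oplus> \<kappa> (Poly_Mapping.lookup q w) \<otimes> wrd w)"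
    using S(2) by (subst \<psi>_superset[OF S(1) _ S(2)]) (use keys_add[of p q] in \<open>auto simp: lookup_add \<kappa>_add l_distr intro!: finsum_cong' m_closed wrd_closed a_closed l_distr\<close>)
  also have "\<dots> = \<psi> p \<oplus> \<psi> q"
    using S(2) by (subst (1 2) \<psi>_superset[OF S(1) _ S(2)]) (auto intro!: finsum_addf m_closed wrd_closed)
  finally show ?thesis .
qed

lemma \<psi>_single: "w \<in> lists J \<Longrightarrow> \<psi> (mon w c) = \<kappa> c \<otimes> wrd w"
  by (cases "c = 0") (auto simp: \<psi>_def \<kappa>_zero)

lemma FJ_add: "p \<in> FJ \<Longrightarrow> q \<in> FJ \<Longrightarrow> p + q \<in> FJ"
  using keys_add[of p q] by auto

lemma FJ_mult: "p \<in> FJ \<Longrightarrow> q \<in> FJ \<Longrightarrow> p * q \<in> FJ"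
  using keys_mult[of p q] by (fastforce simp: plus_list_def)

lemma \<psi>_zero: "\<psi> 0 = \<zero>" by (simp add: \<psi>_def)

lemma \<psi>_mult:
  assumes "p \<in> FJ" "q \<in> FJ"
  shows "\<psi> (p * q) = \<psi> p \<otimes> \<psi> q"
proof -
  have 1: "\<psi> (mon u c * mon v d) = \<psi> (mon u c) \<otimes> \<psi> (mon v d)" if "u \<in> lists J" "v \<in> lists J" for u v c d
  proof -
    have "\<kappa> c \<otimes> wrd u \<otimes> (\<kappa> d \<otimes> wrd v) = \<kappa> c \<otimes> (wrd u \<otimes> \<kappa> d) \<otimes> wrd v" using that by (simp add: m_assoc)
    also have "\<dots> = \<kappa> c \<otimes> (\<kappa> d \<otimes> wrd u) \<otimes> wrd v" using \<kappa>_wrd[OF that(1), of d] by simp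
    finally show ?thesis using that by (simp add: mon_mult \<psi>_single wrd_append \<kappa>_mult m_assoc)
  qed
  have s: "mon u c \<in> FJ" if "u \<in> lists J" for u c using that by simp
  have 2: "\<psi> (mon u c * q) = \<psi> (mon u c) \<otimes> \<psi> q" if u: "u \<in> lists J" for u c
    using assms(2) unfolding mem_Collect_eq
  proof (induction q rule: finsupp_induct)
    case (add p q)
    then show ?case using s[OF u, of c] FJ_mult[OF s[OF u, of c]] by (simp add: distrib_left \<psi>_add r_distr del: keys_single)
  qed (use u in \<open>simp_all add: \<psi>_zero 1 \<psi>_single\<close>)
  show ?thesis using assms(1) unfolding mem_Collect_eq
  proof (induction p rule: finsupp_induct)
    case (add p p')
    then show ?case using assms(2) FJ_mult[OF _ assms(2)] by (simp add: distrib_right \<psi>_add l_distr)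
  qed (use assms(2) in \<open>simp_all add: \<psi>_zero 2\<close>)
qed

lemma h_zero: "h \<zero> = 0"
  using h_add[OF zero_closed zero_closed] by simp

lemma h_wrd: "w \<in> lists J \<Longrightarrow> h (wrd w) = mon w 1"
proof (induction w)
  case Nil
  show ?case using h_\<kappa>[of 1] by (simp add: \<kappa>_one)
qed (simp add: h_mult h_\<gamma> mon_mult)

lemma h_\<psi>: "p \<in> FJ \<Longrightarrow> h (\<psi> p) = p"
  unfolding mem_Collect_eq
  by (induction p rule: finsupp_induct) (simp_all add: \<psi>_zero h_zero \<psi>_single h_mult h_\<kappa> h_wrd mon_mult \<psi>_add h_add)

lemma \<psi>_surj:
  assumes "t \<in> carrier T"
  shows "\<exists>p\<in>FJ. t = \<psi> p"
proof (rule generated[OF assms])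
  show "\<exists>p\<in>FJ. \<kappa> c = \<psi> p" for c by (rule bexI[of _ "mon [] c"]) (simp_all add: \<psi>_single)
  show "\<exists>p\<in>FJ. \<gamma> j = \<psi> p" if "j \<in> J" for j
    using that by (intro bexI[of _ "mon [j] 1"]) (simp_all add: \<psi>_single \<kappa>_one)
  show "\<exists>p\<in>FJ. a \<otimes> b = \<psi> p" if "\<exists>p\<in>FJ. a = \<psi> p" "\<exists>p\<in>FJ. b = \<psi> p" for a b
    using that FJ_mult \<psi>_mult by metis
  fix a b assume "a \<in> carrier T" "b \<in> carrier T" "\<exists>p\<in>FJ. a = \<psi> p" "\<exists>p\<in>FJ. b = \<psi> p"
  then obtain p q where pq: "p \<in> FJ" "a = \<psi> p" "q \<in> FJ" "b = \<psi> q" by blast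
  have m: "p - q \<in> FJ" using keys_diff[of p q] pq by auto
  have "a \<ominus> b = \<psi> (p - q)"
    by (rule a_minus_eqI[OF is_abelian_group]) (use pq m \<psi>_add[OF m pq(3)] in simp_all)
  then show "\<exists>p\<in>FJ. a \<ominus> b = \<psi> p" using m by blast
qed

lemma h_bij: "bij_betw h (carrier T) FJ"
  by (rule bij_betwI[of _ _ _ \<psi>]) (use \<psi>_surj h_\<psi> in \<open>force+\<close>)

end

section \<open>The tensor algebra of a dual space and its forms\<close>

text \<open>Scalar multiplication of functionals.\<close>

abbreviation fscale :: "'k::field \<Rightarrow> ('e \<Rightarrow> 'k) \<Rightarrow> 'e \<Rightarrow> 'k"
  where "fscale \<equiv> \<lambda>c \<phi> v. c * \<phi> v"

lemma vector_space_fscale: "vector_space (fscale :: 'k::field \<Rightarrow> ('e \<Rightarrow> 'k) \<Rightarrow> _)"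
  by unfold_locales (auto simp: algebra_simps fun_eq_iff)

lemma dual_space_iff:
  assumes "vector_space s"
  shows "\<phi> \<in> dual_space s \<longleftrightarrow> (\<forall>x y. \<phi> (x + y) = \<phi> x + \<phi> y) \<and> (\<forall>c x. \<phi> (s c x) = c * \<phi> x)"
proof -
  have "vector_space ((*) :: 'a \<Rightarrow> 'a \<Rightarrow> 'a)" by unfold_locales (auto simp: algebra_simps)
  then show ?thesis using assms by (simp add: dual_space_def Vector_Spaces.linear_iff)
qed

text \<open>Linear coordinates \<open>z i\<close> on the vector space with scalar multiplication \<open>s\<close>: a finite basis of
  the dual space.\<close>

locale coords =
  fixes s :: "'k::field_char_0 \<Rightarrow> 'e::ab_group_add \<Rightarrow> 'e" and I :: "'i set" and z :: "'i \<Rightarrow> 'e \<Rightarrow> 'k"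
  assumes vs: "vector_space s" and finite_I: "finite I" and inj_z: "inj_on z I"
    and indep: "\<not> Modules.module.dependent fscale (z ` I)"
    and span: "Modules.module.span fscale (z ` I) = dual_space s"
begin

sublocale V: vector_space "fscale :: 'k \<Rightarrow> ('e \<Rightarrow> 'k) \<Rightarrow> _" by (rule vector_space_fscale)

text \<open>The coordinates of a functional in the basis \<open>z\<close>.\<close>

definition coef :: "('e \<Rightarrow> 'k) \<Rightarrow> 'i \<Rightarrow> 'k"
  where "coef \<phi> i = V.representation (z ` I) \<phi> (z i)"

lemma coef_add: "\<phi> \<in> dual_space s \<Longrightarrow> \<psi> \<in> dual_space s \<Longrightarrow> coef (\<phi> + \<psi>) i = coef \<phi> i + coef \<psi> i"
  using V.representation_add[OF indep, of \<psi> \<phi>] by (simp add: coef_def span)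

lemma coef_scale: "\<phi> \<in> dual_space s \<Longrightarrow> coef (fscale c \<phi>) i = c * coef \<phi> i"
  using V.representation_scale[OF indep, of \<phi> c] by (simp add: coef_def span)

lemma coef_z: "i \<in> I \<Longrightarrow> j \<in> I \<Longrightarrow> coef (z i) j = (if j = i then 1 else 0)"
  using V.representation_basis[OF indep, of "z i"] inj_onD[OF inj_z] by (auto simp: coef_def)

lemma coef_sum: "\<phi> \<in> dual_space s \<Longrightarrow> (\<Sum>i\<in>I. fscale (coef \<phi> i) (z i)) = \<phi>"
  using V.sum_representation_eq[OF indep, of \<phi> "z ` I"] finite_I
  unfolding sum.reindex[OF inj_z] coef_def o_def by (simp add: span)

lemma z_dual: "i \<in> I \<Longrightarrow> z i \<in> dual_space s"
  using V.span_base[of "z i" "z ` I"] by (simp add: span)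

lemma dual_add: "\<phi> \<in> dual_space s \<Longrightarrow> \<psi> \<in> dual_space s \<Longrightarrow> \<phi> + \<psi> \<in> dual_space s"
  and dual_scale: "\<phi> \<in> dual_space s \<Longrightarrow> fscale c \<phi> \<in> dual_space s"
  by (auto simp: dual_space_iff[OF vs] algebra_simps)

text \<open>The functional \<open>\<Sum> c\<^sub>i z\<^sub>i\<close> as a linear combination of letters.\<close>

definition dual_map :: "('e \<Rightarrow> 'k) \<Rightarrow> ('i, 'k) forms"
  where "dual_map \<phi> = (\<Sum>i\<in>I. mon [Inl i] (coef \<phi> i))"

abbreviation "K \<equiv> ring_of_type_algebra :: 'k ring"

lemma K_simps [simp]: "carrier K = UNIV" "a \<oplus>\<^bsub>K\<^esub> b = a + b" "a \<otimes>\<^bsub>K\<^esub> b = a * b" "\<one>\<^bsub>K\<^esub> = 1" "\<zero>\<^bsub>K\<^esub> = 0"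
  by (simp_all add: ring_of_type_algebra_def)

lemma dual_bimodule_simps [simp]: "carrier (dual_bimodule s) = dual_space s" "\<phi> \<oplus>\<^bsub>dual_bimodule s\<^esub> \<psi> = \<phi> + \<psi>"
  "c \<odot>\<^bsub>dual_bimodule s\<^esub> \<phi> = fscale c \<phi>" "rsmult (dual_bimodule s) \<phi> c = fscale c \<phi>"
  by (simp_all add: dual_bimodule_def mult.commute)

sublocale TA: ten_lift K "dual_bimodule s" "\<lambda>c. mon [] c :: ('i, 'k) forms" dual_map
proof
  show "dual_map (m \<oplus>\<^bsub>dual_bimodule s\<^esub> m') = dual_map m + dual_map m'"
    if "m \<in> carrier (dual_bimodule s)" "m' \<in> carrier (dual_bimodule s)" for m m'
    using that by (simp add: dual_map_def coef_add single_add sum.distrib)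
  show "dual_map (a \<odot>\<^bsub>dual_bimodule s\<^esub> m) = mon [] a * dual_map m" if "m \<in> carrier (dual_bimodule s)" for a m
    using that by (simp add: dual_map_def coef_scale sum_distrib_left mon_mult)
  show "dual_map (rsmult (dual_bimodule s) m a) = dual_map m * mon [] a" if "m \<in> carrier (dual_bimodule s)" for a m
    using that by (simp add: dual_map_def coef_scale sum_distrib_right mon_mult mult.commute)
qed (simp_all add: dual_add dual_scale single_add mon_mult one_mon del: single_one)

abbreviation "A \<equiv> tensor_algebra_dual s"

lemma A_T: "TA.T = A" by (simp add: tensor_algebra_dual_def)

sublocale A: ring A using TA.T.ring_axioms by (simp add: A_T)

text \<open>Scalars in the tensor algebra, and the homomorphism from the tensor algebra to the free model.\<close>

definition cst :: "'k \<Rightarrow> ('k, 'e \<Rightarrow> 'k) ten" where "cst = ten_base K (dual_bimodule s)"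

definition \<Phi> :: "('k, 'e \<Rightarrow> 'k) ten \<Rightarrow> ('i, 'k) forms" where "\<Phi> = TA.lift_hom"

lemma coord_eq: "coord s \<phi> = ten_gen K (dual_bimodule s) \<phi>" by (simp add: coord_def)

lemma A_smult: "c \<odot>\<^bsub>A\<^esub> a = cst c \<otimes>\<^bsub>A\<^esub> a"
  using TA.T_smult by (simp add: A_T cst_def)

lemma cst: "cst c \<in> carrier A" "cst (c + d) = cst c \<oplus>\<^bsub>A\<^esub> cst d" "cst (c * d) = cst c \<otimes>\<^bsub>A\<^esub> cst d" "cst 1 = \<one>\<^bsub>A\<^esub>"
  using TA.base_closed[of c] TA.base_add[of c d] TA.base_mult[of c d] TA.base_one by (simp_all add: cst_def A_T)

lemma coord_closed [simp]: "\<phi> \<in> dual_space s \<Longrightarrow> coord s \<phi> \<in> carrier A"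
  using TA.gen_closed[of \<phi>] by (simp add: coord_eq A_T)

lemma coord_add: "\<phi> \<in> dual_space s \<Longrightarrow> \<psi> \<in> dual_space s \<Longrightarrow> coord s (\<phi> + \<psi>) = coord s \<phi> \<oplus>\<^bsub>A\<^esub> coord s \<psi>"
  using TA.gen_add[of \<phi> \<psi>] by (simp add: coord_eq A_T)

lemma coord_scale: "\<phi> \<in> dual_space s \<Longrightarrow> coord s (fscale c \<phi>) = cst c \<otimes>\<^bsub>A\<^esub> coord s \<phi>"
  "\<phi> \<in> dual_space s \<Longrightarrow> coord s (fscale c \<phi>) = coord s \<phi> \<otimes>\<^bsub>A\<^esub> cst c"
  using TA.gen_l[of c \<phi>] TA.gen_r[of c \<phi>] by (simp_all add: coord_eq cst_def A_T)

lemma \<Phi>_coord_z: "i \<in> I \<Longrightarrow> \<Phi> (coord s (z i)) = mon [Inl i] 1"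
proof -
  assume i: "i \<in> I"
  have "dual_map (z i) = (\<Sum>j\<in>I. if j = i then mon [Inl i] 1 else 0)"
    unfolding dual_map_def using i by (intro sum.cong) (auto simp: coef_z)
  then show ?thesis using i finite_I TA.lift_hom_gen[of "z i"] by (simp add: \<Phi>_def coord_eq z_dual)
qed

text \<open>The algebra is generated by the scalars and the coordinates.\<close>

lemma A_induct [consumes 1, case_names scal coord diff mult]:
  assumes t: "t \<in> carrier A"
    and scal: "\<And>c. P (cst c)" and coord: "\<And>i. i \<in> I \<Longrightarrow> P (coord s (z i))"
    and diff: "\<And>a b. a \<in> carrier A \<Longrightarrow> b \<in> carrier A \<Longrightarrow> P a \<Longrightarrow> P b \<Longrightarrow> P (a \<ominus>\<^bsub>A\<^esub> b)"
    and mult: "\<And>a b. a \<in> carrier A \<Longrightarrow> b \<in> carrier A \<Longrightarrow> P a \<Longrightarrow> P b \<Longrightarrow> P (a \<otimes>\<^bsub>A\<^esub> b)"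
  shows "P t"
  using t unfolding A_T[symmetric]
proof (induction t rule: TA.ten_induct)
  case (gen \<phi>)
  have cst0: "cst 0 = \<zero>\<^bsub>A\<^esub>"
    using cst(2)[of 0 0] cst(1)[of 0] by (simp add: A.add.r_cancel_one')
  have 0: "P (\<zero>\<^bsub>A\<^esub>)" using scal[of 0] cst0 by simp
  have add: "P (a \<oplus>\<^bsub>A\<^esub> b)" if ab: "a \<in> carrier A" "b \<in> carrier A" "P a" "P b" for a b
  proof -
    have "a \<oplus>\<^bsub>A\<^esub> b = a \<ominus>\<^bsub>A\<^esub> (\<zero>\<^bsub>A\<^esub> \<ominus>\<^bsub>A\<^esub> b)" using ab by (simp add: a_minus_def)
    then show ?thesis using diff[OF ab(1) _ ab(3) diff[OF A.zero_closed ab(2) 0 ab(4)]] ab by simp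
  qed
  have "(\<Sum>i\<in>L. fscale (c i) (z i)) \<in> dual_space s \<and> P (coord s (\<Sum>i\<in>L. fscale (c i) (z i)))" if "L \<subseteq> I" for L c
    using finite_subset[OF that finite_I] that
  proof (induction L rule: finite_induct)
    case empty
    have z: "(0 :: 'e \<Rightarrow> 'k) \<in> dual_space s" by (simp add: dual_space_iff[OF vs])
    then have "coord s 0 = \<zero>\<^bsub>A\<^esub>"
      using coord_add[OF z z] by (simp add: A.add.r_cancel_one')
    then show ?case using z 0 unfolding sum.empty by (simp only: simp_thms)
  next
    case (insert i L)
    have i: "z i \<in> dual_space s" using insert z_dual by auto
    have "P (coord s (fscale (c i) (z i)))"
      unfolding coord_scale(1)[OF i] using insert i by (intro mult cst(1) scal coord coord_closed) auto
    moreover have "(\<Sum>i\<in>L. fscale (c i) (z i)) \<in> dual_space s" "P (coord s (\<Sum>i\<in>L. fscale (c i) (z i)))"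
      using insert by auto
    ultimately show ?case
      using add coord_add[OF dual_scale[OF i]] dual_add[OF dual_scale[OF i]] coord_closed dual_scale[OF i]
      unfolding sum.insert[OF insert.hyps] by presburger
  qed
  from this[OF subset_refl, of "coef \<phi>"] show ?case using gen coef_sum[of \<phi>] by (simp add: coord_eq)
qed (use assms in \<open>auto simp: cst_def A_T\<close>)

lemma \<Phi>_hom: "a \<in> carrier A \<Longrightarrow> b \<in> carrier A \<Longrightarrow> \<Phi> (a \<oplus>\<^bsub>A\<^esub> b) = \<Phi> a + \<Phi> b"
  "a \<in> carrier A \<Longrightarrow> b \<in> carrier A \<Longrightarrow> \<Phi> (a \<otimes>\<^bsub>A\<^esub> b) = \<Phi> a * \<Phi> b" "\<Phi> \<one>\<^bsub>A\<^esub> = 1" "\<Phi> (cst c) = mon [] c"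
  using TA.lift_hom_add[of a b] TA.lift_hom_mult[of a b] TA.lift_hom_one TA.lift_hom_base[of c] by (simp_all add: \<Phi>_def A_T cst_def)

lemma cst_coord: "i \<in> I \<Longrightarrow> cst c \<otimes>\<^bsub>A\<^esub> coord s (z i) = coord s (z i) \<otimes>\<^bsub>A\<^esub> cst c"
  using coord_scale[of "z i" c] z_dual by simp

sublocale PA: free_pres A \<Phi> cst "case_sum (\<lambda>i. coord s (z i)) (\<lambda>_. undefined)" "Inl ` I"
proof
  fix P t
  assume "t \<in> carrier A" and 1: "\<And>c. P (cst c)" "\<And>j. j \<in> Inl ` I \<Longrightarrow> P (case_sum (\<lambda>i. coord s (z i)) (\<lambda>_. undefined) j)"
    and 2: "\<And>a b. a \<in> carrier A \<Longrightarrow> b \<in> carrier A \<Longrightarrow> P a \<Longrightarrow> P b \<Longrightarrow> P (a \<ominus>\<^bsub>A\<^esub> b)"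
      "\<And>a b. a \<in> carrier A \<Longrightarrow> b \<in> carrier A \<Longrightarrow> P a \<Longrightarrow> P b \<Longrightarrow> P (a \<otimes>\<^bsub>A\<^esub> b)"
  from \<open>t \<in> carrier A\<close> show "P t"
    by (induction t rule: A_induct) (use 1(1) 1(2)[of "Inl _"] 2 in auto)
qed (auto simp: \<Phi>_hom cst z_dual \<Phi>_coord_z cst_coord)

lemma hforms_I_0: "hforms I 0 = {p :: ('i, 'k) forms. Poly_Mapping.keys p \<subseteq> lists (Inl ` I)}"
proof -
  have "w \<in> lists (I <+> I) \<and> fdeg w = 0 \<longleftrightarrow> w \<in> lists (Inl ` I)" for w :: "('i + 'i) list"
    by (induction w) (auto simp: fdeg_def isl_def)
  then show ?thesis by (auto simp: hforms_def)
qed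

lemma \<Phi>_bij: "bij_betw \<Phi> (carrier A) (hforms I 0)"
  using PA.h_bij by (simp add: hforms_I_0)

lemma \<Phi>_hforms: "a \<in> carrier A \<Longrightarrow> \<Phi> a \<in> hforms I 0"
  using \<Phi>_bij by (auto simp: bij_betw_def)

lemma \<Phi>_eps: "a \<in> carrier A \<Longrightarrow> eps (\<Phi> a) = \<Phi> a"
  using hforms_eps[OF \<Phi>_hforms, of a] by (simp flip: one_mon)

sublocale emb_alg A \<Phi> "\<lambda>c. mon [] c" dd
proof
  show "inj_on \<Phi> (carrier A)" using \<Phi>_bij by (rule bij_betw_imp_inj_on)
  show "dd (mon [] c * p) = mon [] c * dd p" for c and p :: "('i, 'k) forms" by (simp add: dd_mult)
  show "mon [] c * p = p * mon [] c" for c and p :: "('i, 'k) forms" by (rule scalar_central)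
qed (auto simp: \<Phi>_hom A_smult cst dd_add dd_mult \<Phi>_eps)

end

section \<open>Additive generation of forms\<close>

context emb_alg begin

lemma Om_ring: "ring \<Omega>" using Om.T.ring_axioms by (simp add: Om_T)

sublocale Om0: ring "Omega A" by (rule Om_ring)

lemma std_form_simps: "std_form A a [] = form0 A a"
  "std_form A a (as @ [b]) = std_form A a as \<otimes>\<^bsub>\<Omega>\<^esub> dform A b"
  by (simp_all add: std_form_def)

lemma std_form_closed [simp]: "a \<in> carrier A \<Longrightarrow> as \<in> lists (carrier A) \<Longrightarrow> std_form A a as \<in> carrier \<Omega>"
  by (induction as rule: rev_induct) (auto simp: std_form_simps)

text \<open>The additive span of the forms \<open>a\<^sub>0 da\<^sub>1 \<cdots> da\<^sub>m\<close>.\<close>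

inductive_set stdspan where
  std: "a \<in> carrier A \<Longrightarrow> as \<in> lists (carrier A) \<Longrightarrow> std_form A a as \<in> stdspan"
| diff: "p \<in> stdspan \<Longrightarrow> q \<in> stdspan \<Longrightarrow> p \<ominus>\<^bsub>\<Omega>\<^esub> q \<in> stdspan"

lemma stdspan_closed: "p \<in> stdspan \<Longrightarrow> p \<in> carrier \<Omega>"
  by (induction rule: stdspan.induct) auto

lemma Om_diff_distrib: "p \<in> carrier \<Omega> \<Longrightarrow> q \<in> carrier \<Omega> \<Longrightarrow> r \<in> carrier \<Omega> \<Longrightarrow>
    (p \<ominus>\<^bsub>\<Omega>\<^esub> q) \<otimes>\<^bsub>\<Omega>\<^esub> r = p \<otimes>\<^bsub>\<Omega>\<^esub> r \<ominus>\<^bsub>\<Omega>\<^esub> q \<otimes>\<^bsub>\<Omega>\<^esub> r"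
  "p \<in> carrier \<Omega> \<Longrightarrow> q \<in> carrier \<Omega> \<Longrightarrow> r \<in> carrier \<Omega> \<Longrightarrow>
    r \<otimes>\<^bsub>\<Omega>\<^esub> (p \<ominus>\<^bsub>\<Omega>\<^esub> q) = r \<otimes>\<^bsub>\<Omega>\<^esub> p \<ominus>\<^bsub>\<Omega>\<^esub> r \<otimes>\<^bsub>\<Omega>\<^esub> q"
  by (simp_all add: a_minus_def Om0.l_distr Om0.r_distr Om0.l_minus Om0.r_minus)

lemma stdspan_dform: "p \<in> stdspan \<Longrightarrow> b \<in> carrier A \<Longrightarrow> p \<otimes>\<^bsub>\<Omega>\<^esub> dform A b \<in> stdspan"
proof (induction rule: stdspan.induct)
  case (std a as)
  then show ?case using stdspan.std[of a "as @ [b]"] by (simp add: std_form_simps)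
next
  case (diff p q)
  then show ?case by (simp add: Om_diff_distrib stdspan_closed stdspan.diff)
qed

text \<open>The rule \<open>(da) b = d(ab) - a db\<close> moves a function to the left across all differentials.\<close>

lemma stdspan_std_form0:
  "as \<in> lists (carrier A) \<Longrightarrow> a \<in> carrier A \<Longrightarrow> b \<in> carrier A \<Longrightarrow> std_form A a as \<otimes>\<^bsub>\<Omega>\<^esub> form0 A b \<in> stdspan"
proof (induction as arbitrary: b rule: rev_induct)
  case Nil
  then show ?case using stdspan.std[of "a \<otimes> b" "[]"] by (simp add: std_form_simps form0_hom)
next
  case (snoc c as)
  then have cs: "c \<in> carrier A" "as \<in> lists (carrier A)" by auto
  let ?s = "std_form A a as"
  have s: "?s \<in> carrier \<Omega>" using snoc cs by simp
  have e: "?s \<otimes>\<^bsub>\<Omega>\<^esub> dform A (c \<otimes> b) =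
    ?s \<otimes>\<^bsub>\<Omega>\<^esub> dform A c \<otimes>\<^bsub>\<Omega>\<^esub> form0 A b \<oplus>\<^bsub>\<Omega>\<^esub> ?s \<otimes>\<^bsub>\<Omega>\<^esub> form0 A c \<otimes>\<^bsub>\<Omega>\<^esub> dform A b"
    using s cs snoc.prems by (simp add: dform_mult Om0.r_distr Om0.m_assoc)
  have "?s \<otimes>\<^bsub>\<Omega>\<^esub> dform A (c \<otimes> b) \<ominus>\<^bsub>\<Omega>\<^esub> ?s \<otimes>\<^bsub>\<Omega>\<^esub> form0 A c \<otimes>\<^bsub>\<Omega>\<^esub> dform A b \<in> stdspan"
    using snoc cs by (intro stdspan.diff stdspan_dform stdspan.std) auto
  also have "?s \<otimes>\<^bsub>\<Omega>\<^esub> dform A (c \<otimes> b) \<ominus>\<^bsub>\<Omega>\<^esub> ?s \<otimes>\<^bsub>\<Omega>\<^esub> form0 A c \<otimes>\<^bsub>\<Omega>\<^esub> dform A b = ?s \<otimes>\<^bsub>\<Omega>\<^esub> dform A c \<otimes>\<^bsub>\<Omega>\<^esub> form0 A b"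
    by (rule a_minus_eqI[OF Om0.is_abelian_group]) (use s cs snoc.prems e in auto)
  finally show ?case by (simp add: std_form_simps)
qed

lemma stdspan_form0: "p \<in> stdspan \<Longrightarrow> b \<in> carrier A \<Longrightarrow> p \<otimes>\<^bsub>\<Omega>\<^esub> form0 A b \<in> stdspan"
proof (induction rule: stdspan.induct)
  case (std a as)
  then show ?case by (simp add: stdspan_std_form0)
next
  case (diff p q)
  then show ?case by (simp add: Om_diff_distrib stdspan_closed stdspan.diff)
qed

lemma stdspan_all:
  assumes "t \<in> carrier \<Omega>"
  shows "t \<in> stdspan"
proof -
  have "\<forall>p\<in>stdspan. p \<otimes>\<^bsub>\<Omega>\<^esub> t \<in> stdspan"
    using assms
  proof (induction t rule: Omega_induct)
    case (mult s t)
    then show ?case by (auto simp: stdspan_closed simp flip: Om0.m_assoc)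
  qed (auto simp: stdspan_form0 stdspan_dform Om_diff_distrib stdspan_closed intro: stdspan.diff)
  moreover have "\<one>\<^bsub>\<Omega>\<^esub> \<in> stdspan" using stdspan.std[of \<one> "[]"] by (simp add: std_form_simps form0_hom)
  ultimately show ?thesis using assms by force
qed

lemma \<Psi>_hom: "p \<in> carrier \<Omega> \<Longrightarrow> q \<in> carrier \<Omega> \<Longrightarrow> \<Psi> (p \<oplus>\<^bsub>\<Omega>\<^esub> q) = \<Psi> p + \<Psi> q"
  "p \<in> carrier \<Omega> \<Longrightarrow> q \<in> carrier \<Omega> \<Longrightarrow> \<Psi> (p \<otimes>\<^bsub>\<Omega>\<^esub> q) = \<Psi> p * \<Psi> q"
  using Om.lift_hom_add[of p q] Om.lift_hom_mult[of p q] by (simp_all add: \<Psi>_def Om_T)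

end

context free_pres begin

lemma h_a_inv: "a \<in> carrier T \<Longrightarrow> h (\<ominus> a) = - h a"
  using h_add[of a "\<ominus> a"] by (simp add: r_neg h_zero eq_neg_iff_add_eq_0 add.commute)

lemma h_minus: "a \<in> carrier T \<Longrightarrow> b \<in> carrier T \<Longrightarrow> h (a \<ominus> b) = h a - h b"
  by (simp add: a_minus_def h_add h_a_inv)

lemma h_nat_pow: "a \<in> carrier T \<Longrightarrow> h (add_pow T (n::nat) a) = mon [] (of_nat n) * h a"
  by (induction n) (simp_all add: h_zero h_add single_add distrib_right flip: one_mon)

lemma h_int_pow: "a \<in> carrier T \<Longrightarrow> h (add_pow T (n::int) a) = mon [] (of_int n) * h a"
  by (cases "0 \<le> n") (simp_all add: add_pow_int_ge add_pow_int_lt h_nat_pow h_a_inv single_uminus)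

lemma h_inj: "a \<in> carrier T \<Longrightarrow> b \<in> carrier T \<Longrightarrow> h a = h b \<Longrightarrow> a = b"
  using h_bij by (auto simp: bij_betw_def inj_on_def)

lemma h_FJ: "a \<in> carrier T \<Longrightarrow> Poly_Mapping.keys (h a) \<subseteq> lists J"
  using h_bij by (auto simp: bij_betw_def)

lemma \<psi>_h: "a \<in> carrier T \<Longrightarrow> \<psi> (h a) = a"
  by (rule h_inj) (use h_FJ[of a] in \<open>auto simp: h_\<psi>\<close>)

end

context coords begin

lemma A_smult_one: "c \<odot>\<^bsub>A\<^esub> \<one>\<^bsub>A\<^esub> = cst c"
  by (simp add: A_smult cst)

lemma dform_cst: "dform A (cst c) = \<zero>\<^bsub>\<Omega>\<^esub>"
  using dform_const[of c] by (simp add: A_smult_one)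

lemma form0_minus: "a \<in> carrier A \<Longrightarrow> b \<in> carrier A \<Longrightarrow> form0 A (a \<ominus>\<^bsub>A\<^esub> b) = form0 A a \<ominus>\<^bsub>\<Omega>\<^esub> form0 A b"
  by (rule a_minus_eqI[OF Om0.is_abelian_group, symmetric])
     (simp_all flip: form0_hom(1) add: a_minus_def A.a_assoc A.l_neg)

lemma dform_minus: "a \<in> carrier A \<Longrightarrow> b \<in> carrier A \<Longrightarrow> dform A (a \<ominus>\<^bsub>A\<^esub> b) = dform A a \<ominus>\<^bsub>\<Omega>\<^esub> dform A b"
  by (rule a_minus_eqI[OF Om0.is_abelian_group, symmetric])
     (simp_all flip: dform_add add: a_minus_def A.a_assoc A.l_neg)

text \<open>The forms that correspond to the letters of the model.\<close>

definition lgen :: "'i + 'i \<Rightarrow> ('k, 'e \<Rightarrow> 'k) ten ncform"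
  where "lgen = case_sum (\<lambda>i. form0 A (coord s (z i))) (\<lambda>i. dform A (coord s (z i)))"

lemma lgen_simps [simp]: "lgen (Inl i) = form0 A (coord s (z i))" "lgen (Inr i) = dform A (coord s (z i))"
  by (simp_all add: lgen_def)

sublocale PO: free_pres "Omega A" \<Psi> "\<lambda>c. form0 A (cst c)" lgen "I <+> I"
proof
  fix P t
  assume t: "t \<in> carrier \<Omega>" and c: "\<And>c. P (form0 A (cst c))" and j: "\<And>j. j \<in> I <+> I \<Longrightarrow> P (lgen j)"
    and diff: "\<And>a b. a \<in> carrier \<Omega> \<Longrightarrow> b \<in> carrier \<Omega> \<Longrightarrow> P a \<Longrightarrow> P b \<Longrightarrow> P (a \<ominus>\<^bsub>\<Omega>\<^esub> b)"
    and mult: "\<And>a b. a \<in> carrier \<Omega> \<Longrightarrow> b \<in> carrier \<Omega> \<Longrightarrow> P a \<Longrightarrow> P b \<Longrightarrow> P (a \<otimes>\<^bsub>\<Omega>\<^esub> b)"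
  have 0: "P (\<zero>\<^bsub>\<Omega>\<^esub>)" using diff[OF _ _ c c, of 1 1] by (simp add: a_minus_def Om0.r_neg cst)
  have add: "P (a \<oplus>\<^bsub>\<Omega>\<^esub> b)" if ab: "a \<in> carrier \<Omega>" "b \<in> carrier \<Omega>" "P a" "P b" for a b
  proof -
    have "a \<oplus>\<^bsub>\<Omega>\<^esub> b = a \<ominus>\<^bsub>\<Omega>\<^esub> (\<zero>\<^bsub>\<Omega>\<^esub> \<ominus>\<^bsub>\<Omega>\<^esub> b)" using ab by (simp add: a_minus_def)
    then show ?thesis using diff[OF ab(1) _ ab(3) diff[OF Om0.zero_closed ab(2) 0 ab(4)]] ab by simp
  qed
  have f: "P (form0 A a)" if "a \<in> carrier A" for a
    using that
  proof (induction a rule: A_induct)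
    case (coord i)
    then show ?case using j[of "Inl i"] by simp
  qed (use c diff mult in \<open>simp_all add: form0_minus form0_hom\<close>)
  have d: "P (dform A a)" if "a \<in> carrier A" for a
    using that
  proof (induction a rule: A_induct)
    case (coord i)
    then show ?case using j[of "Inr i"] by simp
  qed (use 0 diff in \<open>simp_all add: dform_minus dform_mult dform_cst add mult f\<close>)
  from t show "P t" by (induction t rule: Omega_induct) (use f d diff mult in auto)
next
  fix j c assume "j \<in> I <+> I"
  then obtain i where i: "i \<in> I" "j = Inl i \<or> j = Inr i" by auto
  have a: "coord s (z i) \<in> carrier A" using i z_dual by simp
  have "dform A (cst c \<otimes>\<^bsub>A\<^esub> coord s (z i)) = dform A (coord s (z i) \<otimes>\<^bsub>A\<^esub> cst c)"
    "form0 A (cst c \<otimes>\<^bsub>A\<^esub> coord s (z i)) = form0 A (coord s (z i) \<otimes>\<^bsub>A\<^esub> cst c)"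
    using cst_coord[OF i(1)] by simp_all
  then show "form0 A (cst c) \<otimes>\<^bsub>\<Omega>\<^esub> lgen j = lgen j \<otimes>\<^bsub>\<Omega>\<^esub> form0 A (cst c)"
    using i(2) a by (auto simp: form0_hom dform_mult dform_cst cst)
next
  show "\<Psi> (lgen j) = mon [j] 1" if "j \<in> I <+> I" for j
    using that by (auto simp: \<Psi>_form0 \<Psi>_dform z_dual \<Phi>_coord_z)
  show "lgen j \<in> carrier \<Omega>" if "j \<in> I <+> I" for j
    using that by (auto simp: z_dual)
qed (auto simp: \<Psi>_hom cst form0_hom \<Psi>_form0 \<Phi>_hom)

end

context coords begin

text \<open>The model of all forms, and the isomorphism \<open>\<iota>\<close> from it to \<open>\<Omega>\<close>, inverse to \<open>\<Psi>\<close>.\<close>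

definition FO :: "('i, 'k) forms set"
  where "FO = {p. Poly_Mapping.keys p \<subseteq> lists (I <+> I)}"

abbreviation "\<iota> \<equiv> PO.\<psi>"

lemma iota: "p \<in> FO \<Longrightarrow> \<iota> p \<in> carrier \<Omega>" "p \<in> FO \<Longrightarrow> \<Psi> (\<iota> p) = p" "t \<in> carrier \<Omega> \<Longrightarrow> \<iota> (\<Psi> t) = t"
  "t \<in> carrier \<Omega> \<Longrightarrow> \<Psi> t \<in> FO"
  using PO.\<psi>_closed[of p] PO.h_\<psi>[of p] PO.\<psi>_h[of t] PO.h_FJ[of t] by (auto simp: FO_def)

lemma iota_add: "p \<in> FO \<Longrightarrow> q \<in> FO \<Longrightarrow> \<iota> (p + q) = \<iota> p \<oplus>\<^bsub>\<Omega>\<^esub> \<iota> q"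
  using PO.\<psi>_add[of p q] by (simp add: FO_def)

lemma FO_add: "p \<in> FO \<Longrightarrow> q \<in> FO \<Longrightarrow> p + q \<in> FO"
  using PO.FJ_add[of p q] by (simp add: FO_def)

lemma FO_diff: "p \<in> FO \<Longrightarrow> q \<in> FO \<Longrightarrow> p - q \<in> FO"
  using keys_diff[of p q] by (auto simp: FO_def)

lemma FO_0: "0 \<in> FO" by (simp add: FO_def)

lemma hforms_FO: "p \<in> hforms I q \<Longrightarrow> p \<in> FO" by (auto simp: hforms_def FO_def)

lemma mon_hforms: "w \<in> lists (I <+> I) \<Longrightarrow> mon w c \<in> hforms I (fdeg w)"
  by (auto simp: hforms_def)

lemma FO_closed:
  fixes F :: "('i, 'k) forms \<Rightarrow> ('i, 'k) forms"
  assumes "additive F" "\<And>w c. w \<in> lists (I <+> I) \<Longrightarrow> F (mon w c) \<in> FO" "p \<in> FO"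
  shows "F p \<in> FO"
proof (rule additive_closed[OF assms(1) FO_0 FO_add])
  fix w c assume "w \<in> Poly_Mapping.keys p"
  then show "F (mon w c) \<in> FO" using assms(2,3) unfolding FO_def by blast
qed

lemma dd_FO: "p \<in> FO \<Longrightarrow> dd p \<in> FO"
  by (rule FO_closed[OF dd_additive hforms_FO[OF hforms_dd[OF mon_hforms]]])

lemma Omega_degree_Psi: "t \<in> Omega_degree A q \<Longrightarrow> \<Psi> t \<in> hforms I q"
  unfolding \<Psi>_def Omega_degree_def
proof (rule Om.lift_hom_degree[where H = "hforms I"])
  show "form1_map m \<in> hforms I (Suc 0)" if m: "m \<in> carrier (Omega1 A)" for m
  proof -
    obtain p where p: "p \<in> carrier E" "m = tc p" using m by (auto simp: carrier_Omega1)
    have "der_eval p \<in> hforms I 1" using p(1)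
    proof (induction p rule: E_induct)
      case (frag a b)
      then show ?case using hforms_mult[OF \<Phi>_hforms hforms_dd[OF \<Phi>_hforms], of a b] by simp
    qed (simp_all add: der_eval_simps hforms_diff)
    then show ?thesis using p by (simp add: form1_map)
  qed
  show "1 \<in> hforms I 0" by (auto simp: one_mon intro!: hforms_mon simp del: single_one)
qed (auto simp: \<Phi>_hforms hforms_diff hforms_mult)

lemma Omega_degree_rules:
  "t \<in> Omega_degree A q \<Longrightarrow> t \<in> carrier \<Omega>" "\<zero>\<^bsub>\<Omega>\<^esub> \<in> Omega_degree A q"
  "t \<in> Omega_degree A q \<Longrightarrow> t' \<in> Omega_degree A q \<Longrightarrow> t \<oplus>\<^bsub>\<Omega>\<^esub> t' \<in> Omega_degree A q"
  "t \<in> Omega_degree A q \<Longrightarrow> t' \<in> Omega_degree A q' \<Longrightarrow> t \<otimes>\<^bsub>\<Omega>\<^esub> t' \<in> Omega_degree A (q + q')"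
  "a \<in> carrier A \<Longrightarrow> form0 A a \<in> Omega_degree A 0"
  "a \<in> carrier A \<Longrightarrow> dform A a \<in> Omega_degree A (Suc 0)"
  using Om.degree_closed[of t q] Om.degree_0[of q] Om.degree_add[of t q t'] Om.degree_mult[of t q t' q']
    Om.degree_base[of a] Om.degree_gen[OF univ_der_closed, of a]
  by (simp_all add: Omega_degree_def Om_T form0_def dform_def)

lemma lgen_degree: "j \<in> I <+> I \<Longrightarrow> lgen j \<in> Omega_degree A (fdeg [j])"
  by (auto simp: z_dual intro!: Omega_degree_rules)

lemma wrd_degree: "w \<in> lists (I <+> I) \<Longrightarrow> PO.wrd w \<in> Omega_degree A (fdeg w)"
proof (induction w)
  case Nil
  then show ?case using Omega_degree_rules(5)[OF A.one_closed] by (simp add: form0_hom)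
next
  case (Cons j w)
  then show ?case using Omega_degree_rules(4)[OF lgen_degree[of j] Cons.IH] fdeg_simps(4)[of "[j]" w] by simp
qed

lemma iota_degree:
  assumes "p \<in> hforms I q"
  shows "\<iota> p \<in> Omega_degree A q"
proof -
  have "Poly_Mapping.keys p \<subseteq> {w \<in> lists (I <+> I). fdeg w = q}" using assms by (auto simp: hforms_def)
  then show ?thesis
  proof (induction p rule: finsupp_induct)
    case zero
    then show ?case by (simp add: PO.\<psi>_zero Omega_degree_rules)
  next
    case (single w c)
    then show ?case
      using Omega_degree_rules(4)[OF Omega_degree_rules(5)[OF cst(1)] wrd_degree, of w c] by (auto simp: PO.\<psi>_single)
  next
    case (add p q)
    then show ?case by (subst PO.\<psi>_add) (auto intro: Omega_degree_rules(3))
  qed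
qed

lemma Omega_degree_eq: "Omega_degree A q = \<iota> ` hforms I q"
proof -
  have "t \<in> \<iota> ` hforms I q" if "t \<in> Omega_degree A q" for t
    using iota(3)[OF Omega_degree_rules(1)[OF that]] Omega_degree_Psi[OF that] by (metis imageI)
  then show ?thesis using iota_degree by auto
qed

section \<open>The differential\<close>

lemma Psi_std_form: "a \<in> carrier A \<Longrightarrow> as \<in> lists (carrier A) \<Longrightarrow>
    \<Psi> (std_form A a as) = \<Phi> a * prod_list (map (\<lambda>b. dd (\<Phi> b)) as)"
  by (induction as rule: rev_induct) (auto simp: std_form_simps \<Psi>_form0 \<Psi>_dform \<Psi>_hom mult.assoc)

lemma dd_prod: "dd (prod_list (map (\<lambda>b. dd (\<Phi> b)) as)) = 0"
  by (induction as) (simp_all add: dd_mult dd_dd)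

lemma hom_diff:
  assumes G: "G \<in> hom (add_monoid \<Omega>) (add_monoid \<Omega>)" and pq: "p \<in> carrier \<Omega>" "q \<in> carrier \<Omega>"
  shows "G (p \<ominus>\<^bsub>\<Omega>\<^esub> q) = G p \<ominus>\<^bsub>\<Omega>\<^esub> G q"
proof -
  have dr_of: "G x \<in> carrier \<Omega>" if "x \<in> carrier \<Omega>" for x using hom_in_carrier[OF G] that by simp
  have "G ((p \<ominus>\<^bsub>\<Omega>\<^esub> q) \<oplus>\<^bsub>\<Omega>\<^esub> q) = G (p \<ominus>\<^bsub>\<Omega>\<^esub> q) \<oplus>\<^bsub>\<Omega>\<^esub> G q" using hom_mult[OF G] pq by simp
  also have "(p \<ominus>\<^bsub>\<Omega>\<^esub> q) \<oplus>\<^bsub>\<Omega>\<^esub> q = p" using pq by (simp add: a_minus_def Om0.a_assoc Om0.l_neg)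
  finally show ?thesis using pq dr_of by (intro a_minus_eqI[OF Om0.is_abelian_group, symmetric]) auto
qed

text \<open>The differential of the model, carried over by the isomorphism, has the defining property of
  \<open>Omega_d\<close>; uniqueness is the additive generation by standard forms.\<close>

lemma Omega_d: "Omega_d A = (\<lambda>t\<in>carrier \<Omega>. \<iota> (dd (\<Psi> t)))"
proof -
  define G where "G = (\<lambda>t\<in>carrier \<Omega>. \<iota> (dd (\<Psi> t)))"
  let ?P = "\<lambda>D. D \<in> extensional (carrier \<Omega>) \<and> D \<in> hom (add_monoid \<Omega>) (add_monoid \<Omega>) \<and>
     (\<forall>a \<in> carrier A. \<forall>as \<in> lists (carrier A). D (std_form A a as) = std_form A \<one>\<^bsub>A\<^esub> (a # as))"
  have c: "G t \<in> carrier \<Omega>" "\<Psi> (G t) = dd (\<Psi> t)" if "t \<in> carrier \<Omega>" for t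
    using iota(1,2)[OF dd_FO[OF iota(4)[OF that]]] that by (auto simp: G_def)
  have G_hom: "G \<in> hom (add_monoid \<Omega>) (add_monoid \<Omega>)"
  proof (rule homI)
    fix x y assume "x \<in> carrier (add_monoid \<Omega>)" "y \<in> carrier (add_monoid \<Omega>)"
    then show "G (x \<otimes>\<^bsub>add_monoid \<Omega>\<^esub> y) = G x \<otimes>\<^bsub>add_monoid \<Omega>\<^esub> G y"
      by (intro PO.h_inj) (simp_all add: c \<Psi>_hom dd_add)
  qed (simp add: c)
  have G_std: "G (std_form A a as) = std_form A \<one>\<^bsub>A\<^esub> (a # as)" if a: "a \<in> carrier A" "as \<in> lists (carrier A)" for a as
  proof (rule PO.h_inj)
    show "\<Psi> (G (std_form A a as)) = \<Psi> (std_form A \<one>\<^bsub>A\<^esub> (a # as))"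
      using a Psi_std_form[of "\<one>\<^bsub>A\<^esub>" "a # as"] by (simp add: c Psi_std_form dd_mult dd_prod \<Phi>_hom)
  qed (use a c in auto)
  have D: "?P G" using G_hom G_std by (simp add: G_def)
  have "(THE D. ?P D) = G"
  proof (rule the_equality[where P = ?P, OF D])
    fix D assume D': "?P D"
    then have D_hom: "D \<in> hom (add_monoid \<Omega>) (add_monoid \<Omega>)" by blast
    show "D = G"
    proof (rule extensionalityI)
      fix t assume "t \<in> carrier \<Omega>"
      then have "t \<in> stdspan" by (rule stdspan_all)
      then show "D t = G t"
      proof (induction rule: stdspan.induct)
        case (std a as)
        then show ?case using G_std D' by simp
      next
        case (diff p q)
        then show ?case using hom_diff[OF D_hom, of p q] hom_diff[OF G_hom, of p q] stdspan_closed by simp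
      qed
    qed (use D' G_def in auto)
  qed
  then show ?thesis unfolding Omega_d_def G_def .
qed

lemma Omega_d_iota: "p \<in> FO \<Longrightarrow> Omega_d A (\<iota> p) = \<iota> (dd p)"
  using iota(1,2)[of p] by (simp add: Omega_d)

section \<open>Derivations and contractions\<close>

text \<open>The values of a derivation on letters. They are set to \<open>0\<close> outside \<open>I\<close>, so that
  derivations correspond one to one to elements of \<open>fields\<close>.\<close>

definition der_field :: "(('k, 'e \<Rightarrow> 'k) ten \<Rightarrow> ('k, 'e \<Rightarrow> 'k) ten) \<Rightarrow> 'i \<Rightarrow> ('i, 'k) forms"
  where "der_field \<theta> i = (if i \<in> I then \<Phi> (\<theta> (coord s (z i))) else 0)"

text \<open>The model of \<open>Der(A)\<close>.\<close>

definition fields :: "('i \<Rightarrow> ('i, 'k) forms) set"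
  where "fields = {v. (\<forall>i\<in>I. v i \<in> hforms I 0) \<and> (\<forall>i. i \<notin> I \<longrightarrow> v i = 0)}"

lemma fields_hforms: "v \<in> fields \<Longrightarrow> v i \<in> hforms I 0"
  by (cases "i \<in> I") (auto simp: fields_def)

lemma fields_even: "v \<in> fields \<Longrightarrow> even_field v"
  unfolding even_field_def using hforms_eps[OF fields_hforms] by (metis mult_1 one_mon power_0)

lemma ii_hforms: "v \<in> fields \<Longrightarrow> p \<in> hforms I q \<Longrightarrow> ii v p \<in> hforms I (q - 1)"
  "v \<in> fields \<Longrightarrow> p \<in> hforms I 0 \<Longrightarrow> ii v p = 0"
  using hforms_ii[of I v p q] hforms_ii(2)[of I v p 0] fields_hforms by auto

lemma ii_FO: "v \<in> fields \<Longrightarrow> p \<in> FO \<Longrightarrow> ii v p \<in> FO"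
  by (rule FO_closed[OF ii_additive hforms_FO[OF ii_hforms(1)[OF _ mon_hforms]]])

lemma Der_closed: "\<theta> \<in> Der A \<Longrightarrow> a \<in> carrier A \<Longrightarrow> \<theta> a \<in> carrier A"
  by (auto simp: Der_def)

lemma DerD: assumes "\<theta> \<in> Der A"
  shows "a \<in> carrier A \<Longrightarrow> b \<in> carrier A \<Longrightarrow> \<theta> (a \<oplus>\<^bsub>A\<^esub> b) = \<theta> a \<oplus>\<^bsub>A\<^esub> \<theta> b"
    "a \<in> carrier A \<Longrightarrow> \<theta> (c \<odot>\<^bsub>A\<^esub> a) = c \<odot>\<^bsub>A\<^esub> \<theta> a"
    "a \<in> carrier A \<Longrightarrow> b \<in> carrier A \<Longrightarrow> \<theta> (a \<otimes>\<^bsub>A\<^esub> b) = \<theta> a \<otimes>\<^bsub>A\<^esub> b \<oplus>\<^bsub>A\<^esub> a \<otimes>\<^bsub>A\<^esub> \<theta> b"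
    "\<theta> \<in> extensional (carrier A)"
  using assms by (auto simp: Der_def PiE_def)

lemma der_field_fields: "\<theta> \<in> Der A \<Longrightarrow> der_field \<theta> \<in> fields"
  by (auto simp: fields_def der_field_def Der_closed z_dual intro!: \<Phi>_hforms)

text \<open>A derivation acts on the algebra as \<open>i\<^sub>\<theta> d\<close>; both sides are derivations that agree on letters.\<close>

lemma Phi_Der:
  assumes \<theta>: "\<theta> \<in> Der A" and a: "a \<in> carrier A"
  shows "\<Phi> (\<theta> a) = ii (der_field \<theta>) (dd (\<Phi> a))"
  using a
proof (induction a rule: A_induct)
  case (scal c)
  have o: "\<theta> \<one>\<^bsub>A\<^esub> \<in> carrier A" using Der_closed[OF \<theta>] by simp
  have "\<Phi> (\<theta> \<one>\<^bsub>A\<^esub>) = \<Phi> (\<theta> \<one>\<^bsub>A\<^esub>) + \<Phi> (\<theta> \<one>\<^bsub>A\<^esub>)"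
    using DerD(3)[OF \<theta>, of "\<one>\<^bsub>A\<^esub>" "\<one>\<^bsub>A\<^esub>"] o \<Phi>_hom(1)[OF o o] by simp
  then have "\<Phi> (\<theta> \<one>\<^bsub>A\<^esub>) = 0" by simp
  then have "\<Phi> (\<theta> (cst c)) = 0"
    using DerD(2)[OF \<theta>, of "\<one>\<^bsub>A\<^esub>" c] o by (simp add: A_smult_one \<Phi>_smult)
  then show ?case by (simp add: \<Phi>_hom)
next
  case (coord i)
  then show ?case by (simp add: \<Phi>_coord_z der_field_def flip: one_mon)
next
  case (diff a b)
  have "\<Phi> (\<theta> ((a \<ominus>\<^bsub>A\<^esub> b) \<oplus>\<^bsub>A\<^esub> b)) = \<Phi> (\<theta> (a \<ominus>\<^bsub>A\<^esub> b)) + \<Phi> (\<theta> b)"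
    using diff Der_closed[OF \<theta>] by (simp add: DerD(1)[OF \<theta>] \<Phi>_hom)
  also have "(a \<ominus>\<^bsub>A\<^esub> b) \<oplus>\<^bsub>A\<^esub> b = a" using diff by (simp add: a_minus_def A.a_assoc A.l_neg)
  finally show ?case using diff by (simp add: \<Phi>_minus dd_diff ii_diff)
next
  case (mult a b)
  have "ii (der_field \<theta>) (\<Phi> a) = 0" "ii (der_field \<theta>) (\<Phi> b) = 0" using mult ii_hforms(2)[OF der_field_fields[OF \<theta>] \<Phi>_hforms] by auto
  then show ?case using mult Der_closed[OF \<theta>]
    by (simp add: DerD(3)[OF \<theta>] \<Phi>_hom dd_mult ii_add ii_mult \<Phi>_eps eps_dd)
qed

text \<open>On a free algebra every choice of values on the letters extends to a derivation.\<close>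

lemma ex_Der:
  assumes v: "v \<in> fields"
  shows "\<exists>\<theta>\<in>Der A. der_field \<theta> = v"
proof -
  define \<theta> where "\<theta> = (\<lambda>a\<in>carrier A. PA.\<psi> (ii v (dd (\<Phi> a))))"
  have h: "ii v (dd (\<Phi> a)) \<in> hforms I 0" if "a \<in> carrier A" for a
    using ii_hforms(1)[OF v hforms_dd[OF \<Phi>_hforms[OF that]]] by simp
  have c: "\<theta> a \<in> carrier A" "\<Phi> (\<theta> a) = ii v (dd (\<Phi> a))" if "a \<in> carrier A" for a
    using h[OF that] that PA.\<psi>_closed PA.h_\<psi> by (auto simp: \<theta>_def hforms_I_0)
  have "\<theta> \<in> Der A"
    unfolding Der_def
  proof (intro CollectI conjI ballI allI)
    show "\<theta> \<in> carrier A \<rightarrow>\<^sub>E carrier A" using c by (auto simp: \<theta>_def)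
    fix a assume a: "a \<in> carrier A"
    show "\<theta> (k \<odot>\<^bsub>A\<^esub> a) = k \<odot>\<^bsub>A\<^esub> \<theta> a" for k
      by (rule PA.h_inj) (use a in \<open>simp_all add: c smult_closed \<Phi>_smult dd_mult ii_mult\<close>)
    fix b assume b: "b \<in> carrier A"
    show "\<theta> (a \<oplus>\<^bsub>A\<^esub> b) = \<theta> a \<oplus>\<^bsub>A\<^esub> \<theta> b"
      by (rule PA.h_inj) (use a b in \<open>simp_all add: c \<Phi>_hom dd_add ii_add\<close>)
    have "ii v (\<Phi> a) = 0" "ii v (\<Phi> b) = 0" using a b ii_hforms(2)[OF v \<Phi>_hforms] by auto
    then show "\<theta> (a \<otimes>\<^bsub>A\<^esub> b) = \<theta> a \<otimes>\<^bsub>A\<^esub> b \<oplus>\<^bsub>A\<^esub> a \<otimes>\<^bsub>A\<^esub> \<theta> b"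
      by (intro PA.h_inj) (use a b in \<open>simp_all add: c \<Phi>_hom dd_mult ii_add ii_mult \<Phi>_eps eps_dd\<close>)
  qed
  moreover have "der_field \<theta> = v"
    using v by (auto simp: der_field_def fun_eq_iff c z_dual \<Phi>_coord_z fields_def simp flip: one_mon)
  ultimately show ?thesis by blast
qed

lemma der_field_inj: "\<theta> \<in> Der A \<Longrightarrow> \<eta> \<in> Der A \<Longrightarrow> der_field \<theta> = der_field \<eta> \<Longrightarrow> \<theta> = \<eta>"
proof (rule extensionalityI)
  fix a assume *: "\<theta> \<in> Der A" "\<eta> \<in> Der A" "der_field \<theta> = der_field \<eta>" "a \<in> carrier A"
  then show "\<theta> a = \<eta> a" by (intro PA.h_inj) (simp_all add: Phi_Der Der_closed)
qed (auto dest: DerD(4))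

text \<open>Uniqueness is shown on products of letters, since the Leibniz rule that characterises the
  contraction is restricted to a homogeneous first factor.\<close>

lemma Omega_contr:
  assumes \<theta>: "\<theta> \<in> Der A"
  shows "Omega_contr A \<theta> = (\<lambda>t\<in>carrier \<Omega>. \<iota> (ii (der_field \<theta>) (\<Psi> t)))"
proof -
  let ?v = "der_field \<theta>"
  have v: "?v \<in> fields" by (rule der_field_fields[OF \<theta>])
  define G where "G = (\<lambda>t\<in>carrier \<Omega>. \<iota> (ii ?v (\<Psi> t)))"
  let ?P = "\<lambda>D. D \<in> extensional (carrier (Omega A)) \<and>
     D \<in> hom (add_monoid (Omega A)) (add_monoid (Omega A)) \<and>
     (\<forall>q. D ` Omega_degree A (Suc q) \<subseteq> Omega_degree A q) \<and>
     (\<forall>q. \<forall>\<alpha> \<in> Omega_degree A q. \<forall>\<beta> \<in> carrier (Omega A).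
        D (\<alpha> \<otimes>\<^bsub>Omega A\<^esub> \<beta>) = D \<alpha> \<otimes>\<^bsub>Omega A\<^esub> \<beta>
          \<oplus>\<^bsub>Omega A\<^esub> add_pow (Omega A) ((-1 :: int) ^ q) (\<alpha> \<otimes>\<^bsub>Omega A\<^esub> D \<beta>)) \<and>
     (\<forall>a \<in> carrier A. D (form0 A a) = \<zero>\<^bsub>Omega A\<^esub>) \<and>
     (\<forall>a \<in> carrier A. D (dform A a) = form0 A (\<theta> a))"
  have c: "G t \<in> carrier \<Omega>" "\<Psi> (G t) = ii ?v (\<Psi> t)" if "t \<in> carrier \<Omega>" for t
    using iota(1,2)[OF ii_FO[OF v iota(4)[OF that]]] that by (auto simp: G_def)
  have D: "?P G"
  proof (intro conjI ballI allI subsetI)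
    show "G \<in> extensional (carrier \<Omega>)" by (simp add: G_def)
    show "G \<in> hom (add_monoid \<Omega>) (add_monoid \<Omega>)"
    proof (rule homI)
      fix x y assume "x \<in> carrier (add_monoid \<Omega>)" "y \<in> carrier (add_monoid \<Omega>)"
      then show "G (x \<otimes>\<^bsub>add_monoid \<Omega>\<^esub> y) = G x \<otimes>\<^bsub>add_monoid \<Omega>\<^esub> G y"
        by (intro PO.h_inj) (simp_all add: c \<Psi>_hom ii_add)
    qed (simp add: c)
  next
    fix q t assume "t \<in> G ` Omega_degree A (Suc q)"
    then obtain r where r: "r \<in> Omega_degree A (Suc q)" "t = G r" by blast
    then show "t \<in> Omega_degree A q"
      using iota_degree[OF ii_hforms(1)[OF v Omega_degree_Psi[OF r(1)]]] Omega_degree_rules(1)[OF r(1)] by (simp add: G_def)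
  next
    fix q \<alpha> \<beta> assume ab: "\<alpha> \<in> Omega_degree A q" "\<beta> \<in> carrier \<Omega>"
    have a: "\<alpha> \<in> carrier \<Omega>" using ab(1) by (rule Omega_degree_rules(1))
    show "G (\<alpha> \<otimes>\<^bsub>Omega A\<^esub> \<beta>) = G \<alpha> \<otimes>\<^bsub>Omega A\<^esub> \<beta>
          \<oplus>\<^bsub>Omega A\<^esub> add_pow (Omega A) ((-1 :: int) ^ q) (\<alpha> \<otimes>\<^bsub>Omega A\<^esub> G \<beta>)"
      using a ab(2) hforms_eps[OF Omega_degree_Psi[OF ab(1)]]
      by (intro PO.h_inj) (simp_all add: c \<Psi>_hom PO.h_int_pow ii_mult mult.assoc Om0.add.int_pow_closed)
  next
    fix a assume a: "a \<in> carrier A"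
    show "G (form0 A a) = \<zero>\<^bsub>Omega A\<^esub>"
      using a ii_hforms(2)[OF v \<Phi>_hforms[OF a]] by (simp add: \<Psi>_form0 PO.\<psi>_zero G_def)
    show "G (dform A a) = form0 A (\<theta> a)"
      using a Phi_Der[OF \<theta> a] by (intro PO.h_inj) (simp_all add: c \<Psi>_form0 \<Psi>_dform Der_closed[OF \<theta>])
  qed
  have "(THE D. ?P D) = G"
  proof (rule the_equality[where P = ?P, OF D])
    fix D assume D': "?P D"
    have hadd: "H (p \<oplus>\<^bsub>\<Omega>\<^esub> q) = H p \<oplus>\<^bsub>\<Omega>\<^esub> H q"
      if "?P H" "p \<in> carrier \<Omega>" "q \<in> carrier \<Omega>" for H p q
      using that hom_mult[of H "add_monoid \<Omega>" "add_monoid \<Omega>" p q] by simp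
    have leib: "H (\<alpha> \<otimes>\<^bsub>\<Omega>\<^esub> \<beta>) = H \<alpha> \<otimes>\<^bsub>\<Omega>\<^esub> \<beta> \<oplus>\<^bsub>\<Omega>\<^esub> add_pow \<Omega> ((-1 :: int) ^ q) (\<alpha> \<otimes>\<^bsub>\<Omega>\<^esub> H \<beta>)"
      if "?P H" "\<alpha> \<in> Omega_degree A q" "\<beta> \<in> carrier \<Omega>" for H q \<alpha> \<beta>
      using that by blast
    have f0: "H (form0 A a) = \<zero>\<^bsub>\<Omega>\<^esub>" if "?P H" "a \<in> carrier A" for H a using that by blast
    have d0: "H (dform A a) = form0 A (\<theta> a)" if "?P H" "a \<in> carrier A" for H a using that by blast
    have 0: "D (form0 A a) = G (form0 A a)" if "a \<in> carrier A" for a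
      using f0[OF D that] f0[OF D' that] by (simp only:)
    have gen: "D (lgen j) = G (lgen j)" if j: "j \<in> I <+> I" for j
    proof -
      obtain i where i: "i \<in> I" "j = Inl i \<or> j = Inr i" using j by auto
      have a: "coord s (z i) \<in> carrier A" using i z_dual by simp
      from i(2) show ?thesis
        using f0[OF D a] f0[OF D' a] d0[OF D a] d0[OF D' a] by (elim disjE) (simp_all only: lgen_simps)
    qed
    have w: "D (PO.wrd w) = G (PO.wrd w)" if "w \<in> lists (I <+> I)" for w
      using that
    proof (induction w)
      case Nil
      then show ?case using 0[OF A.one_closed] by (simp only: form0_hom PO.wrd_simps)
    next
      case (Cons j w)
      then show ?case using leib[OF D' lgen_degree PO.wrd_closed, of j w] leib[OF D lgen_degree PO.wrd_closed, of j w] gen[of j]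
        by (simp only: PO.wrd_simps)
    qed
    have "D (\<iota> p) = G (\<iota> p)" if "Poly_Mapping.keys p \<subseteq> lists (I <+> I)" for p
      using that
    proof (induction p rule: finsupp_induct)
      case zero
      have "\<iota> 0 = form0 A (cst 0)" using PO.\<kappa>_zero by (simp only: PO.\<psi>_zero)
      then show ?case using 0[OF cst(1), of 0] by (simp only:)
    next
      case (single u c)
      then show ?case
        using leib[OF D' Omega_degree_rules(5)[OF cst(1)] PO.wrd_closed[of u], of c]
          leib[OF D Omega_degree_rules(5)[OF cst(1)] PO.wrd_closed[of u], of c] w[of u] 0[OF cst(1), of c]
        by (simp only: PO.\<psi>_single)
    next
      case (add p q)
      then have pq: "p \<in> FO" "q \<in> FO" by (auto simp: FO_def)
      show ?case
        using add.IH hadd[OF D' iota(1)[OF pq(1)] iota(1)[OF pq(2)]] hadd[OF D iota(1)[OF pq(1)] iota(1)[OF pq(2)]]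
        by (simp only: iota_add[OF pq])
    qed
    then have m: "D (\<iota> p) = G (\<iota> p)" if "p \<in> FO" for p using that by (simp add: FO_def)
    show "D = G"
    proof (rule extensionalityI)
      fix t assume t: "t \<in> carrier \<Omega>"
      show "D t = G t" using m[OF iota(4)[OF t]] iota(3)[OF t] by (simp only:)
    qed (use D' D in auto)
  qed
  then show ?thesis unfolding Omega_contr_def G_def .
qed

lemma Omega_contr_iota: "\<theta> \<in> Der A \<Longrightarrow> p \<in> FO \<Longrightarrow> Omega_contr A \<theta> (\<iota> p) = \<iota> (ii (der_field \<theta>) p)"
  using iota(1,2)[of p] by (simp add: Omega_contr)

lemma Omega_Lie_iota: "\<theta> \<in> Der A \<Longrightarrow> p \<in> FO \<Longrightarrow> Omega_Lie A \<theta> (\<iota> p) = \<iota> (ll (der_field \<theta>) p)"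
  by (simp add: Omega_Lie_def Omega_contr_iota Omega_d_iota ii_FO dd_FO der_field_fields ll_def iota_add)

end

section \<open>The de Rham complex and cyclic words in the model\<close>

context free_pres begin

lemma h_finsum: "finite S \<Longrightarrow> f \<in> S \<rightarrow> carrier T \<Longrightarrow> h (finsum T f S) = (\<Sum>x\<in>S. h (f x))"
  by (induction S rule: finite_induct) (simp_all add: h_zero h_add)

lemma add_comm_group: "comm_group (add_monoid T)"
  by (rule a_comm_group)

end

context coords begin

abbreviation "scomm_span \<equiv> generate (add_monoid \<Omega>) (super_commutators A)"

lemma super_commutators_Omega: "super_commutators A \<subseteq> carrier (add_monoid \<Omega>)"
proof
  fix x assume "x \<in> super_commutators A"
  then obtain \<alpha> \<beta> p q where x: "x = \<alpha> \<otimes>\<^bsub>\<Omega>\<^esub> \<beta> \<ominus>\<^bsub>\<Omega>\<^esub> add_pow \<Omega> ((-1 :: int) ^ (p * q)) (\<beta> \<otimes>\<^bsub>\<Omega>\<^esub> \<alpha>)"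
    "\<alpha> \<in> Omega_degree A p" "\<beta> \<in> Omega_degree A q" by (auto simp: super_commutators_def)
  from x(2,3)[THEN Omega_degree_rules(1)] show "x \<in> carrier (add_monoid \<Omega>)"
    unfolding x(1) by (simp add: Om0.add.int_pow_closed)
qed

lemma Psi_super_commutator:
  assumes "\<alpha> \<in> Omega_degree A p" "\<beta> \<in> Omega_degree A q"
  shows "\<Psi> (\<alpha> \<otimes>\<^bsub>\<Omega>\<^esub> \<beta> \<ominus>\<^bsub>\<Omega>\<^esub> add_pow \<Omega> ((-1 :: int) ^ (p * q)) (\<beta> \<otimes>\<^bsub>\<Omega>\<^esub> \<alpha>)) =
    \<Psi> \<alpha> * \<Psi> \<beta> - mon [] ((-1) ^ (p * q)) * (\<Psi> \<beta> * \<Psi> \<alpha>)"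
  using assms[THEN Omega_degree_rules(1)] by (simp add: PO.h_minus PO.h_int_pow \<Psi>_hom Om0.add.int_pow_closed)

lemma scomm_span_closed:
  "\<zero>\<^bsub>\<Omega>\<^esub> \<in> scomm_span" "x \<in> super_commutators A \<Longrightarrow> x \<in> scomm_span" "x \<in> scomm_span \<Longrightarrow> y \<in> scomm_span \<Longrightarrow> x \<oplus>\<^bsub>\<Omega>\<^esub> y \<in> scomm_span"
  using generate.one[of "add_monoid \<Omega>" "super_commutators A"] generate.incl[of x "super_commutators A" "add_monoid \<Omega>"]
    generate.eng[of x "add_monoid \<Omega>" "super_commutators A" y] by simp_all

text \<open>Under the isomorphism the span of super-commutators of \<open>\<Omega>\<close> becomes that of the model. For the
  converse direction the form has letters in \<open>I\<close> only, so commutators of such words suffice.\<close>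

lemma scomm_span_iff:
  assumes t: "t \<in> carrier \<Omega>"
  shows "t \<in> scomm_span \<longleftrightarrow> \<Psi> t \<in> scom UNIV"
proof
  assume "t \<in> scomm_span"
  then have "t \<in> carrier \<Omega> \<and> \<Psi> t \<in> scom UNIV"
  proof (induction rule: generate.induct)
    case one
    then show ?case by (simp add: PO.h_zero scom_0)
  next
    case (incl x)
    then obtain \<alpha> \<beta> p q where x: "x = \<alpha> \<otimes>\<^bsub>\<Omega>\<^esub> \<beta> \<ominus>\<^bsub>\<Omega>\<^esub> add_pow \<Omega> ((-1 :: int) ^ (p * q)) (\<beta> \<otimes>\<^bsub>\<Omega>\<^esub> \<alpha>)"
      "\<alpha> \<in> Omega_degree A p" "\<beta> \<in> Omega_degree A q" by (auto simp: super_commutators_def)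
    have "\<Psi> x \<in> scom UNIV" unfolding x(1) Psi_super_commutator[OF x(2,3)]
      using x(2,3)[THEN Omega_degree_Psi] by (intro scom_commutator) (auto simp: hforms_def)
    then show ?case using incl super_commutators_Omega by auto
  next
    case (inv x)
    then obtain \<alpha> \<beta> p q where x: "x = \<alpha> \<otimes>\<^bsub>\<Omega>\<^esub> \<beta> \<ominus>\<^bsub>\<Omega>\<^esub> add_pow \<Omega> ((-1 :: int) ^ (p * q)) (\<beta> \<otimes>\<^bsub>\<Omega>\<^esub> \<alpha>)"
      "\<alpha> \<in> Omega_degree A p" "\<beta> \<in> Omega_degree A q" by (auto simp: super_commutators_def)
    have "\<Psi> x \<in> scom UNIV" unfolding x(1) Psi_super_commutator[OF x(2,3)]
      using x(2,3)[THEN Omega_degree_Psi] by (intro scom_commutator) (auto simp: hforms_def)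
    moreover have "x \<in> carrier \<Omega>" using inv super_commutators_Omega by auto
    ultimately show ?case by (simp add: PO.h_a_inv scom_minus flip: a_inv_def)
  next
    case (eng x y)
    then show ?case by (simp add: \<Psi>_hom scom_add)
  qed
  then show "\<Psi> t \<in> scom UNIV" ..
next
  have *: "\<iota> p \<in> scomm_span \<and> p \<in> FO" if "p \<in> scom (I <+> I)" for p
    using that
  proof (induction rule: scom.induct)
    case scom_0
    then show ?case by (simp add: PO.\<psi>_zero scomm_span_closed FO_0)
  next
    case (scom_step p u v c)
    let ?g = "mon (u @ v) c - mon (v @ u) ((-1) ^ (fdeg u * fdeg v) * c)"
    have g: "?g \<in> FO" using scom_step by (intro FO_diff) (auto simp: FO_def)
    have U: "\<iota> (mon u c) \<in> Omega_degree A (fdeg u)" "\<iota> (mon v 1) \<in> Omega_degree A (fdeg v)"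
      using iota_degree[OF mon_hforms] scom_step by auto
    have P: "\<Psi> (\<iota> (mon u c)) = mon u c" "\<Psi> (\<iota> (mon v 1)) = mon v 1"
      using iota(2)[OF hforms_FO[OF mon_hforms]] scom_step by auto
    have "\<iota> ?g = \<iota> (mon u c) \<otimes>\<^bsub>\<Omega>\<^esub> \<iota> (mon v 1) \<ominus>\<^bsub>\<Omega>\<^esub>
        add_pow \<Omega> ((-1 :: int) ^ (fdeg u * fdeg v)) (\<iota> (mon v 1) \<otimes>\<^bsub>\<Omega>\<^esub> \<iota> (mon u c))" (is "_ = ?s")
    proof (rule PO.h_inj)
      show "?s \<in> carrier \<Omega>"
        using U[THEN Omega_degree_rules(1)] by (simp add: Om0.add.int_pow_closed)
      show "\<Psi> (\<iota> ?g) = \<Psi> ?s"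
        unfolding Psi_super_commutator[OF U] P iota(2)[OF g] by (simp add: mon_mult mult.commute)
    qed (rule iota(1)[OF g])
    moreover have "?s \<in> super_commutators A" unfolding super_commutators_def using U by blast
    ultimately have "\<iota> ?g \<in> scomm_span" using scomm_span_closed(2) by simp
    then show ?case using scom_step g scomm_span_closed(3) by (simp add: iota_add FO_add)
  qed
  assume "\<Psi> t \<in> scom UNIV"
  then have "\<Psi> t \<in> scom (I <+> I)" by (rule scom_restrict[OF _ PO.h_FJ[OF t]])
  from *[OF this] show "t \<in> scomm_span" using iota(3)[OF t] by simp
qed

text \<open>The class in \<open>DR(A)\<close> of a form of the model.\<close>

definition dr_of :: "('i, 'k) forms \<Rightarrow> ('k, 'e \<Rightarrow> 'k) ten dr"
  where "dr_of p = DR_class A (\<iota> p)"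

lemma DR_class_eq: "t \<in> carrier \<Omega> \<Longrightarrow> DR_class A t = dr_of (\<Psi> t)"
  by (simp add: dr_of_def iota)

lemma dr_of_eq_iff: "p \<in> FO \<Longrightarrow> q \<in> FO \<Longrightarrow> dr_of p = dr_of q \<longleftrightarrow> p - q \<in> scom UNIV"
proof -
  assume pq: "p \<in> FO" "q \<in> FO"
  have m: "\<iota> p \<ominus>\<^bsub>\<Omega>\<^esub> \<iota> q \<in> carrier \<Omega>" "\<Psi> (\<iota> p \<ominus>\<^bsub>\<Omega>\<^esub> \<iota> q) = p - q"
    using pq by (simp_all add: iota PO.h_minus)
  show ?thesis
    using coset_eq_iff[OF PO.add_comm_group super_commutators_Omega, of "\<iota> p" "\<iota> q"] scomm_span_iff[OF m(1)] pq
    unfolding dr_of_def DR_class_def a_r_coset_def by (simp add: m iota flip: a_inv_def a_minus_def)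
qed

lemma dr_of_induced:
  assumes p: "p \<in> FO" and f: "\<And>q. q \<in> FO \<Longrightarrow> q - p \<in> scom UNIV \<Longrightarrow> f (\<iota> q) = f (\<iota> p)"
  shows "induced f (dr_of p) = f (\<iota> p)"
  unfolding dr_of_def DR_class_def a_r_coset_def
proof (rule induced_coset[OF PO.add_comm_group super_commutators_Omega])
  show "\<iota> p \<in> carrier (add_monoid \<Omega>)" using p by (simp add: iota)
  fix y assume y: "y \<in> carrier (add_monoid \<Omega>)"
    "y \<otimes>\<^bsub>add_monoid \<Omega>\<^esub> inv\<^bsub>add_monoid \<Omega>\<^esub> \<iota> p \<in> scomm_span"
  then have "y \<ominus>\<^bsub>\<Omega>\<^esub> \<iota> p \<in> scomm_span" by (simp flip: a_inv_def a_minus_def)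
  then have "\<Psi> y - p \<in> scom UNIV" using y p scomm_span_iff[of "y \<ominus>\<^bsub>\<Omega>\<^esub> \<iota> p"] by (simp add: iota PO.h_minus)
  with f[of "\<Psi> y"] y iota(3,4)[of y] show "f y = f (\<iota> p)" by simp
qed

lemma DR_d_dr_of: "p \<in> FO \<Longrightarrow> DR_d A (dr_of p) = dr_of (dd p)"
  unfolding DR_d_def
proof (subst dr_of_induced)
  fix q assume pq: "p \<in> FO" "q \<in> FO" "q - p \<in> scom UNIV"
  show "DR_class A (Omega_d A (\<iota> q)) = DR_class A (Omega_d A (\<iota> p))"
    unfolding Omega_d_iota[OF pq(1)] Omega_d_iota[OF pq(2)] dr_of_def[symmetric]
    using dr_of_eq_iff[OF dd_FO[OF pq(2)] dd_FO[OF pq(1)]] scom_dd[OF pq(3)] by (simp add: dd_diff)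
qed (simp_all add: Omega_d_iota dr_of_def)

lemma DR_contr_dr_of: "\<theta> \<in> Der A \<Longrightarrow> p \<in> FO \<Longrightarrow> DR_contr A \<theta> (dr_of p) = dr_of (ii (der_field \<theta>) p)"
  unfolding DR_contr_def
proof (subst dr_of_induced)
  fix q assume \<theta>: "\<theta> \<in> Der A" and pq: "p \<in> FO" "q \<in> FO" "q - p \<in> scom UNIV"
  note v = der_field_fields[OF \<theta>]
  show "DR_class A (Omega_contr A \<theta> (\<iota> q)) = DR_class A (Omega_contr A \<theta> (\<iota> p))"
    unfolding Omega_contr_iota[OF \<theta> pq(1)] Omega_contr_iota[OF \<theta> pq(2)] dr_of_def[symmetric]
    using dr_of_eq_iff[OF ii_FO[OF v pq(2)] ii_FO[OF v pq(1)]] scom_ii[OF pq(3) fields_even[OF v]] by (simp add: ii_diff)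
qed (simp_all add: Omega_contr_iota dr_of_def)

lemma ll_FO: "v \<in> fields \<Longrightarrow> p \<in> FO \<Longrightarrow> ll v p \<in> FO"
  unfolding ll_def by (intro FO_add ii_FO dd_FO)

lemma scom_ll: "v \<in> fields \<Longrightarrow> p \<in> scom UNIV \<Longrightarrow> ll v p \<in> scom UNIV"
  unfolding ll_def by (intro scom_add scom_ii scom_dd fields_even)

lemma DR_Lie_dr_of: "\<theta> \<in> Der A \<Longrightarrow> p \<in> FO \<Longrightarrow> DR_Lie A \<theta> (dr_of p) = dr_of (ll (der_field \<theta>) p)"
  unfolding DR_Lie_def
proof (subst dr_of_induced)
  fix q assume \<theta>: "\<theta> \<in> Der A" and pq: "p \<in> FO" "q \<in> FO" "q - p \<in> scom UNIV"
  note v = der_field_fields[OF \<theta>]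
  show "DR_class A (Omega_Lie A \<theta> (\<iota> q)) = DR_class A (Omega_Lie A \<theta> (\<iota> p))"
    unfolding Omega_Lie_iota[OF \<theta> pq(1)] Omega_Lie_iota[OF \<theta> pq(2)] dr_of_def[symmetric]
    using dr_of_eq_iff[OF ll_FO[OF v pq(2)] ll_FO[OF v pq(1)]] scom_ll[OF v pq(3)] by (simp add: additive.diff[OF ll_additive])
qed (simp_all add: Omega_Lie_iota dr_of_def)

lemma DR_dr_of: "DR A q = dr_of ` hforms I q"
  by (auto simp: DR_def Omega_degree_eq dr_of_def)

lemma DR_zero_dr_of: "DR_zero A = dr_of 0"
  by (simp add: DR_zero_def dr_of_def PO.\<psi>_zero)

abbreviation "F0 \<equiv> hforms I 0 :: ('i, 'k) forms set"

text \<open>The class in \<open>A/[A,A]\<close> of an element of the model without \<open>d\<close>-letters.\<close>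

definition cyc_of :: "('i, 'k) forms \<Rightarrow> ('k, 'e \<Rightarrow> 'k) ten set"
  where "cyc_of p = cyc_class A (PA.\<psi> p)"

lemma PA_iota: "p \<in> F0 \<Longrightarrow> PA.\<psi> p \<in> carrier A" "p \<in> F0 \<Longrightarrow> \<Phi> (PA.\<psi> p) = p" "a \<in> carrier A \<Longrightarrow> PA.\<psi> (\<Phi> a) = a"
  using PA.\<psi>_closed[of p] PA.h_\<psi>[of p] PA.\<psi>_h[of a] by (auto simp: hforms_I_0)

abbreviation "comms \<equiv> {b \<otimes>\<^bsub>A\<^esub> c \<ominus>\<^bsub>A\<^esub> c \<otimes>\<^bsub>A\<^esub> b | b c. b \<in> carrier A \<and> c \<in> carrier A}"
abbreviation "comm_span \<equiv> generate (add_monoid A) comms"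

lemma comms_A: "comms \<subseteq> carrier (add_monoid A)"
  by auto

lemma comm_span_closed:
  "\<zero>\<^bsub>A\<^esub> \<in> comm_span" "x \<in> comms \<Longrightarrow> x \<in> comm_span" "x \<in> comm_span \<Longrightarrow> y \<in> comm_span \<Longrightarrow> x \<oplus>\<^bsub>A\<^esub> y \<in> comm_span"
  using generate.one[of "add_monoid A" comms] generate.incl[of x comms "add_monoid A"]
    generate.eng[of x "add_monoid A" comms y] by simp_all

lemma Phi_comm: "b \<in> carrier A \<Longrightarrow> c \<in> carrier A \<Longrightarrow> \<Phi> (b \<otimes>\<^bsub>A\<^esub> c \<ominus>\<^bsub>A\<^esub> c \<otimes>\<^bsub>A\<^esub> b) \<in> scom UNIV"
  using scom_commutator[of "\<Phi> b" UNIV 0 "\<Phi> c" 0] \<Phi>_hforms[of b] \<Phi>_hforms[of c]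
  by (simp add: \<Phi>_minus \<Phi>_hom hforms_def flip: one_mon)

text \<open>In degree zero super-commutators are commutators, and those of words without \<open>d\<close>-letters
  suffice. In particular \<open>A/[A,A]\<close> embeds into \<open>DR(A)\<close>.\<close>

lemma comm_span_iff:
  assumes t: "t \<in> carrier A"
  shows "t \<in> comm_span \<longleftrightarrow> \<Phi> t \<in> scom UNIV"
proof
  assume "t \<in> comm_span"
  then have "t \<in> carrier A \<and> \<Phi> t \<in> scom UNIV"
  proof (induction rule: generate.induct)
    case one
    then show ?case by (simp add: PA.h_zero scom_0)
  next
    case (incl x)
    then show ?case using Phi_comm by auto
  next
    case (inv x)
    then have "x \<in> carrier A" "\<Phi> x \<in> scom UNIV" using Phi_comm by auto
    then show ?case by (simp add: PA.h_a_inv scom_minus flip: a_inv_def)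
  next
    case (eng x y)
    then show ?case by (simp add: \<Phi>_hom scom_add)
  qed
  then show "\<Phi> t \<in> scom UNIV" ..
next
  have mF: "mon w c \<in> F0" if "w \<in> lists (Inl ` I)" for w c
    using that unfolding hforms_I_0 by auto
  have *: "PA.\<psi> p \<in> comm_span \<and> p \<in> F0" if "p \<in> scom (Inl ` I)" for p
    using that
  proof (induction rule: scom.induct)
    case scom_0
    then show ?case by (simp add: PA.\<psi>_zero comm_span_closed)
  next
    case (scom_step p u v c)
    have uv: "u \<in> lists (Inl ` I)" "v \<in> lists (Inl ` I)" using scom_step by auto
    have s: "(-1) ^ (fdeg u * fdeg v) * c = c"
      using mF[OF uv(1), of 1] by (simp add: hforms_def)
    have g: "mon (u @ v) c - mon (v @ u) c \<in> F0" using uv mF by (intro hforms_diff) auto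
    have "PA.\<psi> (mon (u @ v) c - mon (v @ u) c) = PA.\<psi> (mon u c) \<otimes>\<^bsub>A\<^esub> PA.\<psi> (mon v 1) \<ominus>\<^bsub>A\<^esub> PA.\<psi> (mon v 1) \<otimes>\<^bsub>A\<^esub> PA.\<psi> (mon u c)"
      using g PA_iota mF[OF uv(1)] mF[OF uv(2)]
      by (intro PA.h_inj) (simp_all add: \<Phi>_minus \<Phi>_hom mon_mult)
    moreover have "\<dots> \<in> comms" using PA_iota(1)[OF mF[OF uv(1)]] PA_iota(1)[OF mF[OF uv(2)]] by blast
    ultimately have "PA.\<psi> (mon (u @ v) c - mon (v @ u) c) \<in> comm_span" using comm_span_closed(2) by simp
    moreover have "p \<in> F0" "PA.\<psi> p \<in> comm_span" using scom_step.IH by auto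
    moreover have "PA.\<psi> (p + (mon (u @ v) c - mon (v @ u) c)) = PA.\<psi> p \<oplus>\<^bsub>A\<^esub> PA.\<psi> (mon (u @ v) c - mon (v @ u) c)"
      using PA.\<psi>_add[of p "mon (u @ v) c - mon (v @ u) c"] g scom_step.IH unfolding hforms_I_0 by blast
    ultimately show ?case unfolding s using comm_span_closed(3) hforms_add[OF _ g] by simp
  qed
  assume "\<Phi> t \<in> scom UNIV"
  then have "\<Phi> t \<in> scom (Inl ` I)" by (rule scom_restrict[OF _ PA.h_FJ[OF t]])
  from *[OF this] show "t \<in> comm_span" using PA_iota(3)[OF t] by simp
qed

lemma cyc_class_eq: "t \<in> carrier A \<Longrightarrow> cyc_class A t = cyc_of (\<Phi> t)"
  by (simp add: cyc_of_def PA_iota)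

lemma cyc_of_eq_iff: "p \<in> F0 \<Longrightarrow> q \<in> F0 \<Longrightarrow> cyc_of p = cyc_of q \<longleftrightarrow> p - q \<in> scom UNIV"
proof -
  assume pq: "p \<in> F0" "q \<in> F0"
  have m: "PA.\<psi> p \<ominus>\<^bsub>A\<^esub> PA.\<psi> q \<in> carrier A" "\<Phi> (PA.\<psi> p \<ominus>\<^bsub>A\<^esub> PA.\<psi> q) = p - q"
    using pq by (simp_all add: PA_iota PA.h_minus)
  show ?thesis
    using coset_eq_iff[OF PA.add_comm_group comms_A, of "PA.\<psi> p" "PA.\<psi> q"] comm_span_iff[OF m(1)] pq
    unfolding cyc_of_def cyc_class_def a_r_coset_def by (simp add: m PA_iota flip: a_inv_def a_minus_def)
qed

lemma cyc_of_induced: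
  assumes p: "p \<in> F0" and f: "\<And>q. q \<in> F0 \<Longrightarrow> q - p \<in> scom UNIV \<Longrightarrow> f (PA.\<psi> q) = f (PA.\<psi> p)"
  shows "induced f (cyc_of p) = f (PA.\<psi> p)"
  unfolding cyc_of_def cyc_class_def a_r_coset_def
proof (rule induced_coset[OF PA.add_comm_group comms_A])
  show "PA.\<psi> p \<in> carrier (add_monoid A)" using p by (simp add: PA_iota)
  fix y assume y: "y \<in> carrier (add_monoid A)"
    "y \<otimes>\<^bsub>add_monoid A\<^esub> inv\<^bsub>add_monoid A\<^esub> PA.\<psi> p \<in> comm_span"
  then have "y \<ominus>\<^bsub>A\<^esub> PA.\<psi> p \<in> comm_span" by (simp flip: a_inv_def a_minus_def)
  then have "\<Phi> y - p \<in> scom UNIV" using y p comm_span_iff[of "y \<ominus>\<^bsub>A\<^esub> PA.\<psi> p"] by (simp add: PA_iota PA.h_minus)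
  with f[of "\<Phi> y"] y PA_iota(3)[of y] \<Phi>_hforms[of y] show "f y = f (PA.\<psi> p)" by simp
qed

lemma cyc_space_cyc_of: "cyc_space A = cyc_of ` F0"
proof -
  have "carrier A = PA.\<psi> ` F0"
  proof
    show "carrier A \<subseteq> PA.\<psi> ` F0"
    proof
      fix a assume "a \<in> carrier A"
      then show "a \<in> PA.\<psi> ` F0" using PA_iota(3)[of a] \<Phi>_hforms[of a] by (intro image_eqI[of _ _ "\<Phi> a"]) simp_all
    qed
    show "PA.\<psi> ` F0 \<subseteq> carrier A" using PA_iota(1) by blast
  qed
  then show ?thesis by (auto simp: cyc_space_def cyc_of_def)
qed

lemma cyc_to_DR_cyc_of: "p \<in> F0 \<Longrightarrow> cyc_to_DR A (cyc_of p) = dr_of p"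
  unfolding cyc_to_DR_def
proof (subst cyc_of_induced)
  have *: "DR_class A (form0 A (PA.\<psi> r)) = dr_of r" if "r \<in> F0" for r
    using that by (simp add: DR_class_eq \<Psi>_form0 PA_iota)
  show "p \<in> F0 \<Longrightarrow> DR_class A (form0 A (PA.\<psi> p)) = dr_of p" by (rule *)
  fix q assume "p \<in> F0" "q \<in> F0" "q - p \<in> scom UNIV"
  then show "DR_class A (form0 A (PA.\<psi> q)) = DR_class A (form0 A (PA.\<psi> p))"
    using * dr_of_eq_iff[of q p] hforms_FO by auto
qed

lemma cyc_of_add:
  assumes "p \<in> F0" "q \<in> F0"
  shows "set_add A (cyc_of p) (cyc_of q) = cyc_of (p + q)"
proof -
  have "PA.\<psi> (p + q) = PA.\<psi> p \<oplus>\<^bsub>A\<^esub> PA.\<psi> q" using assms PA.\<psi>_add[of p q] by (auto simp: hforms_I_0)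
  then show ?thesis
    using coset_mult[OF PA.add_comm_group comms_A, of "PA.\<psi> p" "PA.\<psi> q"] PA_iota(1)[OF assms(1)] PA_iota(1)[OF assms(2)]
    by (simp add: cyc_of_def cyc_class_def a_r_coset_def set_add_def)
qed

lemma cyc_of_smult:
  assumes "p \<in> F0"
  shows "induced (\<lambda>a. cyc_class A (c \<odot>\<^bsub>A\<^esub> a)) (cyc_of p) = cyc_of (mon [] c * p)"
proof -
  have *: "cyc_class A (c \<odot>\<^bsub>A\<^esub> PA.\<psi> q) = cyc_of (mon [] c * q)" if "q \<in> F0" for q
    using that by (simp add: cyc_class_eq smult_closed PA_iota \<Phi>_smult)
  show ?thesis
  proof (subst cyc_of_induced[OF assms])
    fix q assume q: "q \<in> F0" "q - p \<in> scom UNIV"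
    have "mon [] c * q - mon [] c * p \<in> scom UNIV" using scom_scale[OF q(2), of c] by (simp add: right_diff_distrib)
    then show "cyc_class A (c \<odot>\<^bsub>A\<^esub> PA.\<psi> q) = cyc_class A (c \<odot>\<^bsub>A\<^esub> PA.\<psi> p)"
      using cyc_of_eq_iff[OF hforms_scale[OF q(1)] hforms_scale[OF assms]] *[OF q(1)] *[OF assms] by simp
  qed (rule *[OF assms])
qed

lemma const_class_cyc_of: "const_class A c = cyc_of (mon [] c)"
  by (simp add: const_class_def A_smult_one cyc_class_eq cst \<Phi>_hom)

lemma cyc_zero_cyc_of: "cyc_class A \<zero>\<^bsub>A\<^esub> = cyc_of 0"
  by (simp add: cyc_class_eq \<Phi>_zero)

end

section \<open>Contraction as a function of the field\<close>

lemma ii_field_add: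
  fixes p :: "('i, 'k::comm_ring_1) forms"
  shows "ii (\<lambda>i. v i + w i) p = ii v p + ii w p"
proof (rule twisted_derivation_eqI[of "ii (\<lambda>i. v i + w i)" "\<lambda>p. ii v p + ii w p" eps])
  show "ii (\<lambda>i. v i + w i) (mon [l] 1) = ii v (mon [l] 1) + ii w (mon [l] 1)" for l
    by (cases l) (simp_all flip: one_mon)
qed (simp_all add: ii_mult ii_additive additive_plus algebra_simps)

lemma ii_field_scale:
  fixes p :: "('i, 'k::comm_ring_1) forms"
  shows "ii (\<lambda>i. mon [] c * v i) p = mon [] c * ii v p"
proof (rule twisted_derivation_eqI[of "ii (\<lambda>i. mon [] c * v i)" "\<lambda>p. mon [] c * ii v p" eps])
  show "mon [] c * ii v (p * q) = mon [] c * ii v p * q + eps p * (mon [] c * ii v q)" for p q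
    by (simp only: ii_mult distrib_left mult.assoc[symmetric] scalar_central[of c "eps p"])
  show "ii (\<lambda>i. mon [] c * v i) (mon [l] 1) = mon [] c * ii v (mon [l] 1)" for l
    by (cases l) (simp_all flip: one_mon)
qed (simp_all add: ii_mult ii_additive additive_mult_l)

lemma ii_ii:
  fixes p :: "('i, 'k::comm_ring_1) forms"
  assumes "even_field v" "\<And>i. ii v (v i) = 0"
  shows "ii v (ii v p) = 0"
proof -
  have "ii v (ii v p) = (\<lambda>p. 0) p"
  proof (rule twisted_derivation_eqI[of "\<lambda>p. ii v (ii v p)" "\<lambda>p. 0" "\<lambda>p. p"])
    show "ii v (ii v (mon [l] 1)) = 0" for l
      by (cases l) (simp_all add: assms(2) flip: one_mon)
  qed (simp_all add: ii_mult ii_add eps_ii[OF assms(1)] additive_const0 additive_comp[OF ii_additive ii_additive])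
  then show ?thesis .
qed

section \<open>Images of Lie algebras\<close>

text \<open>The axioms are equations, so they pass to the image of a map that respects the operations.\<close>

lemma lie_algebra_image:
  fixes G :: "('k::field, 'g) lie_alg" and H :: "('k, 'h) lie_alg"
  assumes G: "lie_algebra G" and surj: "f ` carrier G = carrier H"
    and add: "\<And>u v. u \<in> carrier G \<Longrightarrow> v \<in> carrier G \<Longrightarrow> f (u \<oplus>\<^bsub>G\<^esub> v) = f u \<oplus>\<^bsub>H\<^esub> f v"
    and smult: "\<And>c u. u \<in> carrier G \<Longrightarrow> f (c \<odot>\<^bsub>G\<^esub> u) = c \<odot>\<^bsub>H\<^esub> f u"
    and bracket: "\<And>u v. u \<in> carrier G \<Longrightarrow> v \<in> carrier G \<Longrightarrow> f (lie_bracket G u v) = lie_bracket H (f u) (f v)"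
    and zero: "f \<zero>\<^bsub>G\<^esub> = \<zero>\<^bsub>H\<^esub>"
  shows "lie_algebra H"
proof -
  interpret G: Module.module "ring_of_type_algebra :: 'k ring" G using G by (simp add: lie_algebra_def)
  have UK: "c \<in> carrier (ring_of_type_algebra :: 'k ring)" for c by (simp add: ring_of_type_algebra_def)
  have bc: "lie_bracket G u v \<in> carrier G" if "u \<in> carrier G" "v \<in> carrier G" for u v
    using G that by (auto simp: lie_algebra_def)
  have sc: "c \<odot>\<^bsub>G\<^esub> u \<in> carrier G" if "u \<in> carrier G" for c u using G.smult_closed[OF UK that] .
  have all: "(\<forall>u\<in>carrier H. P u) \<longleftrightarrow> (\<forall>u\<in>carrier G. P (f u))" for P
    unfolding surj[symmetric] by blast
  have mem: "f u \<in> carrier H" if "u \<in> carrier G" for u using that surj by blast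
  note r = add[symmetric] smult[symmetric] bracket[symmetric] zero[symmetric]
  have "abelian_group H"
  proof (rule abelian_groupI)
    fix x y z assume "x \<in> carrier H" "y \<in> carrier H" "z \<in> carrier H"
    then obtain u v w where u: "u \<in> carrier G" "x = f u" and v: "v \<in> carrier G" "y = f v" and w: "w \<in> carrier G" "z = f w"
      unfolding surj[symmetric] by blast
    show "x \<oplus>\<^bsub>H\<^esub> y \<in> carrier H" "x \<oplus>\<^bsub>H\<^esub> y = y \<oplus>\<^bsub>H\<^esub> x" "\<zero>\<^bsub>H\<^esub> \<oplus>\<^bsub>H\<^esub> x = x"
      "x \<oplus>\<^bsub>H\<^esub> y \<oplus>\<^bsub>H\<^esub> z = x \<oplus>\<^bsub>H\<^esub> (y \<oplus>\<^bsub>H\<^esub> z)"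
      using u v w by (simp_all add: r mem G.a_ac)
    show "\<exists>y\<in>carrier H. y \<oplus>\<^bsub>H\<^esub> x = \<zero>\<^bsub>H\<^esub>"
      using u by (intro bexI[of _ "f (\<ominus>\<^bsub>G\<^esub> u)"]) (simp_all add: r mem G.l_neg)
  next
    show "\<zero>\<^bsub>H\<^esub> \<in> carrier H" using mem[OF G.zero_closed] by (simp add: zero)
  qed
  then have "Module.module (ring_of_type_algebra :: 'k ring) H"
  proof (intro moduleI)
    show "cring (ring_of_type_algebra :: 'k ring)" by (rule cring_from_type_algebra)
    fix a b :: 'k and x y assume "x \<in> carrier H" "y \<in> carrier H"
    then obtain u v where u: "u \<in> carrier G" "x = f u" and v: "v \<in> carrier G" "y = f v"
      unfolding surj[symmetric] by blast
    show "a \<odot>\<^bsub>H\<^esub> x \<in> carrier H" "a \<odot>\<^bsub>H\<^esub> (x \<oplus>\<^bsub>H\<^esub> y) = a \<odot>\<^bsub>H\<^esub> x \<oplus>\<^bsub>H\<^esub> a \<odot>\<^bsub>H\<^esub> y"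
      "(a \<oplus>\<^bsub>ring_of_type_algebra\<^esub> b) \<odot>\<^bsub>H\<^esub> x = a \<odot>\<^bsub>H\<^esub> x \<oplus>\<^bsub>H\<^esub> b \<odot>\<^bsub>H\<^esub> x"
      "(a \<otimes>\<^bsub>ring_of_type_algebra\<^esub> b) \<odot>\<^bsub>H\<^esub> x = a \<odot>\<^bsub>H\<^esub> (b \<odot>\<^bsub>H\<^esub> x)"
      "\<one>\<^bsub>ring_of_type_algebra\<^esub> \<odot>\<^bsub>H\<^esub> x = x"
      using u v G.smult_r_distr[OF UK, of u v a] G.smult_l_distr[OF UK UK, of u a b] G.smult_assoc1[OF UK UK, of u a b]
      by (simp_all add: r mem sc)
  qed
  then show ?thesis
    using G unfolding lie_algebra_def all by (simp add: r sc bc mem)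
qed

section \<open>The canonical symplectic form\<close>

text \<open>Coordinates indexed by \<open>M \<times> bool\<close>: \<open>z (m, False)\<close> is \<open>x\<^sub>m\<close> and \<open>z (m, True)\<close> is \<open>y\<^sub>m\<close>.\<close>

locale symp = coords s "M \<times> (UNIV :: bool set)" z
  for s :: "'k::field_char_0 \<Rightarrow> 'e::ab_group_add \<Rightarrow> 'e" and M :: "'m set" and z :: "'m \<times> bool \<Rightarrow> 'e \<Rightarrow> 'k" +
  assumes finite_M: "finite M"
begin

abbreviation "om \<equiv> omega0 M :: ('m \<times> bool, 'k) forms"

text \<open>The class of the canonical form.\<close>

definition \<omega> :: "('k, 'e \<Rightarrow> 'k) ten dr" where "\<omega> = dr_of om"

lemma om_FO: "om \<in> FO" using omega0_hforms hforms_FO by blast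

lemma ii_om_hforms: "v \<in> fields \<Longrightarrow> ii v om \<in> hforms (M \<times> UNIV) 1"
  using ii_hforms(1)[OF _ omega0_hforms] by fastforce

text \<open>By \<open>cycpart_ii_omega0\<close> the values of \<open>v\<close> are, up to sign, the cyclic coordinates of \<open>i\<^sub>v \<omega>\<close>.\<close>

lemma field_unique:
  assumes v: "v \<in> fields" and w: "w \<in> fields" and d: "ii v om - ii w om \<in> scom UNIV"
  shows "v = w"
proof
  fix i :: "'m \<times> bool"
  have e: "cycpart j (ii v om) = cycpart j (ii w om)" for j
    using cycpart_scom[OF d, of j] by (simp add: additive.diff[OF cycpart_additive])
  have "v (m, b) = w (m, b)" if m: "m \<in> M" for m b
    using e[of "(m, True)"] e[of "(m, False)"] cycpart_ii_omega0[OF finite_M m, of v] cycpart_ii_omega0[OF finite_M m, of w]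
      fields_hforms[OF v] fields_hforms[OF w] by (cases b) simp_all
  moreover obtain m b where "i = (m, b)" by (cases i)
  ultimately show "v i = w i" using v w by (cases "m \<in> M") (auto simp: fields_def)
qed

lemma field_exists:
  assumes p: "p \<in> hforms (M \<times> UNIV) 1"
  shows "\<exists>v\<in>fields. ii v om - p \<in> scom UNIV"
proof -
  \<comment> \<open>The signs come from \<open>i\<^sub>v \<omega> = \<Sum> v(x\<^sub>m) dy\<^sub>m - v(y\<^sub>m) dx\<^sub>m\<close> modulo super-commutators.\<close>
  define v where "v = (\<lambda>(m, b). if m \<in> M then if b then - cycpart (m, False) p else cycpart (m, True) p else 0)"
  have "v \<in> fields" using hforms_cycpart[OF p] by (auto simp: v_def fields_def intro: hforms_minus)
  moreover have "p - ii v om \<in> scom UNIV"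
    by (rule one_form_eq_ii_omega0[OF finite_M p]) (simp_all add: v_def)
  then have "ii v om - p \<in> scom UNIV" using scom_minus by fastforce
  ultimately show ?thesis by blast
qed

lemma nc_symplectic: "nc_symplectic A \<omega>"
  unfolding nc_symplectic_def
proof (intro conjI)
  show "\<omega> \<in> DR A 2" by (auto simp: \<omega>_def DR_dr_of omega0_hforms)
  show "DR_d A \<omega> = DR_zero A" by (simp add: \<omega>_def DR_d_dr_of om_FO DR_zero_dr_of dd_omega0)
  show "bij_betw (\<lambda>\<theta>. DR_contr A \<theta> \<omega>) (Der A) (DR A 1)"
    unfolding bij_betw_def
  proof (intro conjI inj_onI subset_antisym subsetI)
    fix \<theta> \<eta> assume d: "\<theta> \<in> Der A" "\<eta> \<in> Der A" and e: "DR_contr A \<theta> \<omega> = DR_contr A \<eta> \<omega>"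
    note v = d[THEN der_field_fields]
    have "ii (der_field \<theta>) om - ii (der_field \<eta>) om \<in> scom UNIV"
      using e d dr_of_eq_iff[OF ii_FO[OF v(1) om_FO] ii_FO[OF v(2) om_FO]] by (simp add: \<omega>_def DR_contr_dr_of om_FO)
    then show "\<theta> = \<eta>" using field_unique[OF v] der_field_inj[OF d] by simp
  next
    fix x assume "x \<in> (\<lambda>\<theta>. DR_contr A \<theta> \<omega>) ` Der A"
    then obtain \<theta> where "\<theta> \<in> Der A" "x = DR_contr A \<theta> \<omega>" by blast
    then have "x = dr_of (ii (der_field \<theta>) om)" "ii (der_field \<theta>) om \<in> hforms (M \<times> UNIV) 1"
      by (simp_all only: \<omega>_def DR_contr_dr_of om_FO ii_om_hforms der_field_fields)
    then show "x \<in> DR A 1" unfolding DR_dr_of by blast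
  next
    fix x assume "x \<in> DR A 1"
    then obtain p where p: "p \<in> hforms (M \<times> UNIV) 1" "x = dr_of p" by (auto simp: DR_dr_of)
    obtain v where v: "v \<in> fields" "ii v om - p \<in> scom UNIV" using field_exists[OF p(1)] by blast
    obtain \<theta> where \<theta>: "\<theta> \<in> Der A" "der_field \<theta> = v" using ex_Der[OF v(1)] by blast
    have "DR_contr A \<theta> \<omega> = x"
      using \<theta> v p dr_of_eq_iff[OF ii_FO[OF v(1) om_FO] hforms_FO[OF p(1)]] by (simp add: \<omega>_def DR_contr_dr_of om_FO)
    then show "x \<in> (\<lambda>\<theta>. DR_contr A \<theta> \<omega>) ` Der A" using \<theta>(1) by blast
  qed
qed

section \<open>Hamiltonian fields and the necklace bracket\<close>

text \<open>The Hamiltonian field of \<open>p\<close>: the solution of \<open>i\<^sub>v \<omega> = dp\<close> modulo super-commutators.\<close>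

definition ham_field :: "('m \<times> bool, 'k) forms \<Rightarrow> 'm \<times> bool \<Rightarrow> ('m \<times> bool, 'k) forms"
  where "ham_field p = (THE v. v \<in> fields \<and> ii v om - dd p \<in> scom UNIV)"

lemma ham_field_eqI:
  assumes "v \<in> fields" "ii v om - dd p \<in> scom UNIV"
  shows "ham_field p = v"
  unfolding ham_field_def
proof (rule the_equality)
  fix w assume w: "w \<in> fields \<and> ii w om - dd p \<in> scom UNIV"
  have "ii w om - ii v om \<in> scom UNIV" using scom_diff[OF _ assms(2), of "ii w om - dd p"] w by simp
  then show "w = v" using field_unique[of w v] w assms(1) by blast
qed (use assms in blast)

lemma ham_field:
  assumes "p \<in> F0"
  shows "ham_field p \<in> fields" "ii (ham_field p) om - dd p \<in> scom UNIV"
proof -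
  have "dd p \<in> hforms (M \<times> UNIV) 1" using hforms_dd[OF assms] by simp
  from field_exists[OF this] obtain v where "v \<in> fields" "ii v om - dd p \<in> scom UNIV" by blast
  then show "ham_field p \<in> fields" "ii (ham_field p) om - dd p \<in> scom UNIV" using ham_field_eqI by simp_all
qed

lemma ham_cyc_of:
  assumes p: "p \<in> F0"
  shows "ham A \<omega> (cyc_of p) \<in> Der A" "der_field (ham A \<omega> (cyc_of p)) = ham_field p"
proof -
  obtain \<theta> where \<theta>: "\<theta> \<in> Der A" "der_field \<theta> = ham_field p" using ex_Der[OF ham_field(1)[OF p]] by blast
  have dp: "dd p \<in> FO" using dd_FO hforms_FO[OF p] by blast
  have iff: "DR_contr A \<eta> \<omega> = DR_d A (cyc_to_DR A (cyc_of p)) \<longleftrightarrow> ii (der_field \<eta>) om - dd p \<in> scom UNIV" if "\<eta> \<in> Der A" for \<eta>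
    using that dr_of_eq_iff[OF ii_FO[OF der_field_fields[OF that] om_FO] dp]
    by (simp add: \<omega>_def DR_contr_dr_of om_FO cyc_to_DR_cyc_of p DR_d_dr_of hforms_FO[OF p])
  have "ham A \<omega> (cyc_of p) = \<theta>"
    unfolding ham_def
  proof (rule the_equality)
    show "\<theta> \<in> Der A \<and> DR_contr A \<theta> \<omega> = DR_d A (cyc_to_DR A (cyc_of p))"
      using \<theta> iff[OF \<theta>(1)] ham_field(2)[OF p] by simp
    fix \<eta> assume \<eta>: "\<eta> \<in> Der A \<and> DR_contr A \<eta> \<omega> = DR_d A (cyc_to_DR A (cyc_of p))"
    then have "ham_field p = der_field \<eta>" using iff ham_field_eqI[OF der_field_fields] by blast
    then show "\<eta> = \<theta>" using der_field_inj[OF _ \<theta>(1)] \<theta>(2) \<eta> by simp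
  qed
  then show "ham A \<omega> (cyc_of p) \<in> Der A" "der_field (ham A \<omega> (cyc_of p)) = ham_field p" using \<theta> by simp_all
qed

text \<open>A representative of the bracket: the Hamiltonian derivation of \<open>p\<close> applied to \<open>q\<close>.\<close>

definition necklace :: "('m \<times> bool, 'k) forms \<Rightarrow> ('m \<times> bool, 'k) forms \<Rightarrow> ('m \<times> bool, 'k) forms"
  where "necklace p q = ii (ham_field p) (dd q)"

lemma ii_dd_F0: "v \<in> fields \<Longrightarrow> q \<in> F0 \<Longrightarrow> ii v (dd q) \<in> F0"
  using ii_hforms(1)[OF _ hforms_dd] by fastforce

lemma necklace_F0: "p \<in> F0 \<Longrightarrow> q \<in> F0 \<Longrightarrow> necklace p q \<in> F0"
  unfolding necklace_def by (intro ii_dd_F0 ham_field)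

lemma cyc_bracket_cyc_of:
  assumes p: "p \<in> F0" and q: "q \<in> F0"
  shows "cyc_bracket A \<omega> (cyc_of p) (cyc_of q) = cyc_of (necklace p q)"
proof -
  have inj: "inj_on (cyc_to_DR A) (cyc_space A)"
    unfolding cyc_space_cyc_of by (rule inj_onI, elim imageE) (simp add: cyc_to_DR_cyc_of dr_of_eq_iff cyc_of_eq_iff hforms_FO)
  have "DR_contr A (ham A \<omega> (cyc_of p)) (DR_d A (cyc_to_DR A (cyc_of q))) = dr_of (necklace p q)"
    using ham_cyc_of[OF p] by (simp add: cyc_to_DR_cyc_of q DR_d_dr_of hforms_FO[OF q] DR_contr_dr_of dd_FO necklace_def)
  also have "\<dots> = cyc_to_DR A (cyc_of (necklace p q))" by (simp add: cyc_to_DR_cyc_of necklace_F0 p q)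
  finally show ?thesis unfolding cyc_bracket_def
    using inv_into_f_f[OF inj] necklace_F0[OF p q] by (simp add: cyc_space_cyc_of)
qed

lemma fields_add: "v \<in> fields \<Longrightarrow> w \<in> fields \<Longrightarrow> (\<lambda>i. v i + w i) \<in> fields"
  by (auto simp: fields_def intro: hforms_add)

lemma fields_scale: "v \<in> fields \<Longrightarrow> (\<lambda>i. mon [] c * v i) \<in> fields"
  by (auto simp: fields_def intro: hforms_scale)

lemma ham_field_add:
  assumes "p \<in> F0" "q \<in> F0"
  shows "ham_field (p + q) = (\<lambda>i. ham_field p i + ham_field q i)"
proof (rule ham_field_eqI)
  show "ii (\<lambda>i. ham_field p i + ham_field q i) om - dd (p + q) \<in> scom UNIV"
    using scom_add[OF ham_field(2)[OF assms(1)] ham_field(2)[OF assms(2)]] by (simp add: ii_field_add dd_add algebra_simps)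
qed (intro fields_add ham_field assms)

lemma ham_field_scale:
  assumes "p \<in> F0"
  shows "ham_field (mon [] c * p) = (\<lambda>i. mon [] c * ham_field p i)"
proof (rule ham_field_eqI)
  show "ii (\<lambda>i. mon [] c * ham_field p i) om - dd (mon [] c * p) \<in> scom UNIV"
    using scom_scale[OF ham_field(2)[OF assms], of c] by (simp add: ii_field_scale dd_mult right_diff_distrib)
qed (intro fields_scale ham_field assms)

lemma necklace_add: "p \<in> F0 \<Longrightarrow> q \<in> F0 \<Longrightarrow> necklace (p + q) r = necklace p r + necklace q r" "necklace r (p + q) = necklace r p + necklace r q"
  by (simp_all add: necklace_def ham_field_add ii_field_add dd_add ii_add)

lemma necklace_scale: "p \<in> F0 \<Longrightarrow> necklace (mon [] c * p) q = mon [] c * necklace p q" "necklace q (mon [] c * p) = mon [] c * necklace q p"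
  by (simp_all add: necklace_def ham_field_scale ii_field_scale dd_mult ii_mult)

lemma necklace_scom: "p \<in> F0 \<Longrightarrow> q \<in> scom UNIV \<Longrightarrow> necklace p q \<in> scom UNIV"
  unfolding necklace_def by (intro scom_ii scom_dd fields_even ham_field)

text \<open>Contracting \<open>i\<^sub>v \<omega> = dp\<close> once more with \<open>v\<close> gives \<open>{p, p} = i\<^sub>v i\<^sub>v \<omega> = 0\<close>.\<close>

lemma necklace_self:
  assumes p: "p \<in> F0"
  shows "necklace p p \<in> scom UNIV"
proof -
  note v = ham_field(1)[OF p]
  have "ii (ham_field p) (ii (ham_field p) om) = 0"
    by (rule ii_ii[OF fields_even[OF v] ii_hforms(2)[OF v fields_hforms[OF v]]])
  then have "- necklace p p = ii (ham_field p) (ii (ham_field p) om - dd p)" by (simp add: necklace_def ii_diff)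
  also have "\<dots> \<in> scom UNIV" by (rule scom_ii[OF ham_field(2)[OF p] fields_even[OF v]])
  finally show ?thesis using scom_minus by fastforce
qed

lemma necklace_anti:
  assumes "p \<in> F0" "q \<in> F0"
  shows "necklace p q + necklace q p \<in> scom UNIV"
proof -
  have "necklace (p + q) (p + q) - necklace p p - necklace q q \<in> scom UNIV"
    using assms by (intro scom_diff necklace_self hforms_add)
  then show ?thesis using assms by (simp add: necklace_add algebra_simps)
qed

text \<open>Modulo super-commutators \<open>L\<^sub>v \<omega> = d i\<^sub>v \<omega> = 0\<close> and \<open>i\<^bsub>[v,w]\<^esub> \<omega> = L\<^sub>v i\<^sub>w \<omega> - i\<^sub>w L\<^sub>v \<omega> = L\<^sub>v dq = d{p, q}\<close>. The
  second identity holds on the nose, before passing to cyclic words.\<close>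

lemma ham_field_necklace:
  assumes p: "p \<in> F0" and q: "q \<in> F0"
  shows "ham_field (necklace p q) = (\<lambda>i. ii (ham_field p) (dd (ham_field q i)) - ii (ham_field q) (dd (ham_field p i)))"
    "r \<in> F0 \<Longrightarrow> necklace (necklace p q) r = necklace p (necklace q r) - necklace q (necklace p r)"
proof -
  let ?v = "ham_field p" and ?w = "ham_field q"
  let ?u = "\<lambda>i. ii ?v (dd (?w i)) - ii ?w (dd (?v i))"
  note v = ham_field(1)[OF p] and w = ham_field(1)[OF q]
  have comm: "ll ?v (ii ?w t) - ii ?w (ll ?v t) = ii ?u t" for t
    by (rule ll_ii[OF fields_even[OF v] fields_even[OF w] ii_hforms(2)[OF v fields_hforms[OF w]] ii_hforms(2)[OF w fields_hforms[OF v]]])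
  have u: "?u \<in> fields"
    using v w ii_dd_F0[OF v fields_hforms[OF w]] ii_dd_F0[OF w fields_hforms[OF v]]
    by (auto simp: fields_def intro: hforms_diff)
  have "ll ?v (ii ?w om - dd q) \<in> scom UNIV" by (rule scom_ll[OF v ham_field(2)[OF q]])
  moreover have "ll ?v (dd q) = dd (necklace p q)" by (simp add: ll_def dd_dd necklace_def)
  ultimately have 1: "ll ?v (ii ?w om) - dd (necklace p q) \<in> scom UNIV"
    by (simp add: additive.diff[OF ll_additive])
  have "dd (ii ?v om - dd p) \<in> scom UNIV" by (rule scom_dd[OF ham_field(2)[OF p]])
  then have "ll ?v om \<in> scom UNIV" by (simp add: ll_def dd_omega0 dd_diff dd_dd)
  then have 2: "ii ?w (ll ?v om) \<in> scom UNIV" by (rule scom_ii[OF _ fields_even[OF w]])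
  have "ii ?u om - dd (necklace p q) \<in> scom UNIV"
    using scom_diff[OF 1 2] by (simp flip: comm add: algebra_simps)
  then show e: "ham_field (necklace p q) = ?u" by (rule ham_field_eqI[OF u])
  assume r: "r \<in> F0"
  have "ii ?v (ii ?w (dd r)) = 0" by (rule ii_hforms(2)[OF v ii_dd_F0[OF w r]])
  then show "necklace (necklace p q) r = necklace p (necklace q r) - necklace q (necklace p r)"
    unfolding necklace_def[of "necklace p q"] e comm[symmetric] by (simp add: ll_def necklace_def dd_dd)
qed

lemma necklace_jacobi:
  assumes "p \<in> F0" "q \<in> F0" "r \<in> F0"
  shows "necklace p (necklace q r) + necklace q (necklace r p) + necklace r (necklace p q) \<in> scom UNIV"
proof -
  have 1: "necklace q (necklace r p) + necklace q (necklace p r) \<in> scom UNIV"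
    using necklace_scom[OF assms(2) necklace_anti[OF assms(3,1)]] by (simp add: necklace_add)
  have 2: "necklace r (necklace p q) + necklace (necklace p q) r \<in> scom UNIV"
    using assms by (intro necklace_anti necklace_F0)
  have "(necklace q (necklace r p) + necklace q (necklace p r)) + (necklace r (necklace p q) + necklace (necklace p q) r) \<in> scom UNIV"
    by (rule scom_add[OF 2 1])
  also have "necklace (necklace p q) r = necklace p (necklace q r) - necklace q (necklace p r)" by (rule ham_field_necklace(2)[OF assms])
  finally show ?thesis by (simp add: algebra_simps)
qed

section \<open>The central extension\<close>

abbreviation "L \<equiv> cyc_lie A \<omega>"
abbreviation "H \<equiv> Der_omega A \<omega>"

lemma L_simps [simp]: "carrier L = cyc_of ` F0" "\<zero>\<^bsub>L\<^esub> = cyc_of 0"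
  "p \<in> F0 \<Longrightarrow> q \<in> F0 \<Longrightarrow> cyc_of p \<oplus>\<^bsub>L\<^esub> cyc_of q = cyc_of (p + q)"
  "p \<in> F0 \<Longrightarrow> c \<odot>\<^bsub>L\<^esub> cyc_of p = cyc_of (mon [] c * p)"
  "p \<in> F0 \<Longrightarrow> q \<in> F0 \<Longrightarrow> lie_bracket L (cyc_of p) (cyc_of q) = cyc_of (necklace p q)"
  by (simp_all add: cyc_lie_def cyc_space_cyc_of cyc_zero_cyc_of cyc_of_add cyc_of_smult cyc_bracket_cyc_of)

lemma lie_algebra_cyc: "lie_algebra L"
proof -
  have "abelian_group L"
  proof (rule abelian_groupI)
    fix x assume "x \<in> carrier L"
    then obtain p where p: "p \<in> F0" "x = cyc_of p" by auto
    then show "\<exists>y\<in>carrier L. y \<oplus>\<^bsub>L\<^esub> x = \<zero>\<^bsub>L\<^esub>"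
      by (intro bexI[of _ "cyc_of (- p)"]) (simp_all add: hforms_minus)
  qed (auto simp: hforms_add add_ac)
  then have "Module.module (ring_of_type_algebra :: 'k ring) L"
    by (intro moduleI cring_from_type_algebra)
       (auto simp: hforms_scale hforms_add single_add distrib_left distrib_right mon_mult simp flip: mult.assoc one_mon)
  moreover have "cyc_of (necklace p p) = cyc_of 0" if "p \<in> F0" for p
    using that necklace_self by (simp add: cyc_of_eq_iff necklace_F0)
  moreover have "cyc_of (necklace p (necklace q r) + necklace q (necklace r p) + necklace r (necklace p q)) = cyc_of 0" if "p \<in> F0" "q \<in> F0" "r \<in> F0" for p q r
    using that necklace_jacobi by (simp add: cyc_of_eq_iff necklace_F0 hforms_add)
  ultimately show ?thesis
    unfolding lie_algebra_def by (auto simp: necklace_F0 hforms_add hforms_scale necklace_add necklace_scale)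
qed

lemma ham_ext: "p \<in> F0 \<Longrightarrow> ham A \<omega> (cyc_of p) \<in> extensional (carrier A)"
  using DerD(4)[OF ham_cyc_of(1)] .

lemma Phi_ham: "p \<in> F0 \<Longrightarrow> a \<in> carrier A \<Longrightarrow> \<Phi> (ham A \<omega> (cyc_of p) a) = ii (ham_field p) (dd (\<Phi> a))"
  using Phi_Der[OF ham_cyc_of(1)] ham_cyc_of(2) by simp

lemma ham_closed: "p \<in> F0 \<Longrightarrow> a \<in> carrier A \<Longrightarrow> ham A \<omega> (cyc_of p) a \<in> carrier A"
  using Der_closed[OF ham_cyc_of(1)] by blast

lemma H_simps: "\<zero>\<^bsub>H\<^esub> = (\<lambda>a \<in> carrier A. \<zero>\<^bsub>A\<^esub>)"
  "\<theta> \<oplus>\<^bsub>H\<^esub> \<eta> = (\<lambda>a \<in> carrier A. \<theta> a \<oplus>\<^bsub>A\<^esub> \<eta> a)"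
  "c \<odot>\<^bsub>H\<^esub> \<theta> = (\<lambda>a \<in> carrier A. c \<odot>\<^bsub>A\<^esub> \<theta> a)"
  "lie_bracket H \<theta> \<eta> = (\<lambda>a \<in> carrier A. \<theta> (\<eta> a) \<ominus>\<^bsub>A\<^esub> \<eta> (\<theta> a))"
  by (simp_all add: Der_omega_def)

lemma ham_add:
  assumes p: "p \<in> F0" and q: "q \<in> F0"
  shows "ham A \<omega> (cyc_of (p + q)) = ham A \<omega> (cyc_of p) \<oplus>\<^bsub>H\<^esub> ham A \<omega> (cyc_of q)"
proof (rule extensionalityI[OF ham_ext])
  fix a assume "a \<in> carrier A"
  then show "ham A \<omega> (cyc_of (p + q)) a = (ham A \<omega> (cyc_of p) \<oplus>\<^bsub>H\<^esub> ham A \<omega> (cyc_of q)) a"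
    using p q hforms_add[OF p q]
    by (intro PA.h_inj) (simp_all add: H_simps ham_closed Phi_ham \<Phi>_hom ham_field_add ii_field_add)
qed (simp_all add: hforms_add p q H_simps)

lemma ham_scale:
  assumes p: "p \<in> F0"
  shows "ham A \<omega> (cyc_of (mon [] c * p)) = c \<odot>\<^bsub>H\<^esub> ham A \<omega> (cyc_of p)"
proof (rule extensionalityI[OF ham_ext])
  fix a assume "a \<in> carrier A"
  then show "ham A \<omega> (cyc_of (mon [] c * p)) a = (c \<odot>\<^bsub>H\<^esub> ham A \<omega> (cyc_of p)) a"
    using p hforms_scale[OF p, of c]
    by (intro PA.h_inj) (simp_all add: H_simps ham_closed Phi_ham \<Phi>_smult smult_closed ham_field_scale ii_field_scale)
qed (simp_all add: hforms_scale p H_simps)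

lemma ham_necklace:
  assumes p: "p \<in> F0" and q: "q \<in> F0"
  shows "ham A \<omega> (cyc_of (necklace p q)) = lie_bracket H (ham A \<omega> (cyc_of p)) (ham A \<omega> (cyc_of q))"
proof (rule extensionalityI[OF ham_ext])
  fix a assume a: "a \<in> carrier A"
  have "ii (ham_field (necklace p q)) (dd (\<Phi> a)) = ii (ham_field p) (dd (ii (ham_field q) (dd (\<Phi> a)))) - ii (ham_field q) (dd (ii (ham_field p) (dd (\<Phi> a))))"
    using ham_field_necklace(2)[OF p q \<Phi>_hforms[OF a]] by (simp only: necklace_def)
  then show "ham A \<omega> (cyc_of (necklace p q)) a = lie_bracket H (ham A \<omega> (cyc_of p)) (ham A \<omega> (cyc_of q)) a"
    using a p q necklace_F0[OF p q]
    by (intro PA.h_inj) (simp_all add: H_simps ham_closed Phi_ham \<Phi>_minus)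
qed (simp_all add: necklace_F0 p q H_simps)

text \<open>The Poincare lemma modulo super-commutators.\<close>

lemma dd_scom_exact:
  fixes p :: "('m \<times> bool, 'k) forms"
  assumes p: "p \<in> hforms (M \<times> UNIV) q" and d: "dd p \<in> scom UNIV"
  shows "p - mon [] (Poly_Mapping.lookup p []) - dd (unscale (ii euler p)) \<in> scom UNIV"
proof -
  have "unscale (ii euler (dd p)) \<in> scom UNIV"
    unfolding unscale_def by (intro scom_wscale scom_ii d even_euler)
  then show ?thesis unfolding poincare_homotopy by simp
qed

lemma euler_hforms: "p \<in> hforms (M \<times> UNIV) q \<Longrightarrow> ii euler p \<in> hforms (M \<times> UNIV) (q - 1)"
  "p \<in> hforms (M \<times> UNIV) 0 \<Longrightarrow> ii euler p = 0"
  for p :: "('m \<times> bool, 'k) forms"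
proof -
  have e: "euler i \<in> F0" if "i \<in> M \<times> UNIV" for i
    unfolding euler_def using that by (intro hforms_mon) auto
  show "p \<in> hforms (M \<times> UNIV) q \<Longrightarrow> ii euler p \<in> hforms (M \<times> UNIV) (q - 1)"
    by (rule hforms_ii(1)[OF e])
  show "p \<in> hforms (M \<times> UNIV) 0 \<Longrightarrow> ii euler p = 0"
    by (rule hforms_ii(2)[OF e _ refl])
qed

text \<open>Every symplectic derivation is Hamiltonian, because \<open>i\<^sub>\<theta> \<omega>\<close> is closed and hence exact.\<close>

lemma carrier_H: "carrier H = (\<lambda>p. ham A \<omega> (cyc_of p)) ` F0"
proof -
  have lie: "DR_Lie A \<theta> \<omega> = DR_zero A \<longleftrightarrow> dd (ii (der_field \<theta>) om) \<in> scom UNIV" if \<theta>: "\<theta> \<in> Der A" for \<theta>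
    using \<theta> dr_of_eq_iff[OF ll_FO[OF der_field_fields[OF \<theta>] om_FO] FO_0]
    by (simp add: \<omega>_def DR_Lie_dr_of om_FO DR_zero_dr_of) (simp add: ll_def dd_omega0)
  show ?thesis
  proof (intro subset_antisym subsetI)
    fix \<theta> assume "\<theta> \<in> carrier H"
    then have \<theta>: "\<theta> \<in> Der A" and d: "dd (ii (der_field \<theta>) om) \<in> scom UNIV" using lie by (auto simp: Der_omega_def)
    \<comment> \<open>The Hamiltonian is the one produced by the Euler homotopy.\<close>
    let ?a = "ii (der_field \<theta>) om" and ?p = "unscale (ii euler (ii (der_field \<theta>) om))"
    have a: "?a \<in> hforms (M \<times> UNIV) 1" by (rule ii_om_hforms[OF der_field_fields[OF \<theta>]])
    have p: "?p \<in> F0" unfolding unscale_def using hforms_wscale[OF euler_hforms(1)[OF a]] by simp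
    have "Poly_Mapping.lookup ?a [] = 0" using hforms_keys(2)[OF a, of "[]"] by (auto simp: in_keys_iff)
    then have "?a - dd ?p \<in> scom UNIV" using dd_scom_exact[OF a d] by simp
    then have "ham_field ?p = der_field \<theta>" by (rule ham_field_eqI[OF der_field_fields[OF \<theta>]])
    then have "\<theta> = ham A \<omega> (cyc_of ?p)" using der_field_inj[OF \<theta> ham_cyc_of(1)[OF p]] ham_cyc_of(2)[OF p] by simp
    then show "\<theta> \<in> (\<lambda>p. ham A \<omega> (cyc_of p)) ` F0" using p by blast
  next
    fix \<theta> assume "\<theta> \<in> (\<lambda>p. ham A \<omega> (cyc_of p)) ` F0"
    then obtain p where p: "p \<in> F0" "\<theta> = ham A \<omega> (cyc_of p)" by blast
    have "dd (ii (ham_field p) om - dd p) \<in> scom UNIV" by (rule scom_dd[OF ham_field(2)[OF p(1)]])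
    then have "dd (ii (der_field \<theta>) om) \<in> scom UNIV" using ham_cyc_of(2)[OF p(1)] p(2) by (simp add: dd_diff dd_dd)
    then show "\<theta> \<in> carrier H" using lie ham_cyc_of(1)[OF p(1)] p(2) by (simp add: Der_omega_def)
  qed
qed

lemma ham_field_0: "ham_field (mon [] c) = (\<lambda>_. 0)"
proof (rule ham_field_eqI)
  have "ii (\<lambda>_. 0) om = 0" using ii_field_scale[of 0 "\<lambda>_. 0" om] by simp
  then show "ii (\<lambda>_. 0) om - dd (mon [] c) \<in> scom UNIV" by (simp add: scom_0)
qed (simp add: fields_def)

lemma ii_zero_field: "ii (\<lambda>_. 0) p = 0" for p :: "('m \<times> bool, 'k) forms"
  using ii_field_scale[of 0 "\<lambda>_. 0" p] by simp

lemma ham_zero_iff: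
  assumes p: "p \<in> F0"
  shows "ham A \<omega> (cyc_of p) = \<zero>\<^bsub>H\<^esub> \<longleftrightarrow> ham_field p = (\<lambda>_. 0)"
proof
  assume "ham_field p = (\<lambda>_. 0)"
  then have "\<Phi> (ham A \<omega> (cyc_of p) a) = 0" if "a \<in> carrier A" for a
    using Phi_ham[OF p that] by (simp add: ii_zero_field)
  then show "ham A \<omega> (cyc_of p) = \<zero>\<^bsub>H\<^esub>" unfolding H_simps
    by (intro extensionalityI[OF ham_ext[OF p]] PA.h_inj) (simp_all add: ham_closed p \<Phi>_zero)
next
  assume "ham A \<omega> (cyc_of p) = \<zero>\<^bsub>H\<^esub>"
  then have "der_field (ham A \<omega> (cyc_of p)) = (\<lambda>_. 0)" by (auto simp: H_simps der_field_def z_dual \<Phi>_zero)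
  then show "ham_field p = (\<lambda>_. 0)" using ham_cyc_of(2)[OF p] by simp
qed

lemma const_F0: "mon [] c \<in> F0" by (rule hforms_mon) simp_all

lemma central_extension: "lie_central_extension ground_lie (const_class A) L (ham A \<omega>) H"
  unfolding lie_central_extension_def
proof (intro conjI)
  have "abelian_group (ground_lie :: ('k, 'k) lie_alg)"
  proof (rule abelian_groupI)
    fix x :: 'k
    show "\<exists>y\<in>carrier ground_lie. y \<oplus>\<^bsub>ground_lie\<^esub> x = \<zero>\<^bsub>ground_lie\<^esub>"
      by (rule bexI[of _ "- x"]) (simp_all add: ground_lie_def)
  qed (simp_all add: ground_lie_def algebra_simps)
  then have "Module.module (ring_of_type_algebra :: 'k ring) ground_lie"
    by (intro moduleI cring_from_type_algebra) (simp_all add: ground_lie_def ring_of_type_algebra_def algebra_simps)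
  then show "lie_algebra (ground_lie :: ('k, 'k) lie_alg)"
    unfolding lie_algebra_def by (simp add: ground_lie_def)
  show "lie_algebra L" by (rule lie_algebra_cyc)
  have image: "ham A \<omega> ` carrier L = carrier H" by (simp add: carrier_H image_image)
  then show "ham A \<omega> ` carrier L = carrier H" .
  have hom: "u \<in> carrier L \<Longrightarrow> v \<in> carrier L \<Longrightarrow> ham A \<omega> (u \<oplus>\<^bsub>L\<^esub> v) = ham A \<omega> u \<oplus>\<^bsub>H\<^esub> ham A \<omega> v"
    "u \<in> carrier L \<Longrightarrow> ham A \<omega> (c \<odot>\<^bsub>L\<^esub> u) = c \<odot>\<^bsub>H\<^esub> ham A \<omega> u"
    "u \<in> carrier L \<Longrightarrow> v \<in> carrier L \<Longrightarrow> ham A \<omega> (lie_bracket L u v) = lie_bracket H (ham A \<omega> u) (ham A \<omega> v)" for u v c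
    by (auto simp: ham_add ham_scale ham_necklace)
  have zero: "ham A \<omega> \<zero>\<^bsub>L\<^esub> = \<zero>\<^bsub>H\<^esub>" using ham_zero_iff[of 0] ham_field_0[of 0] by simp
  show "lie_algebra H" by (rule lie_algebra_image[OF lie_algebra_cyc image hom zero])
  show "ham A \<omega> \<in> lie_hom L H" unfolding lie_hom_def using image hom by blast
  show "const_class A \<in> lie_hom ground_lie L"
    unfolding lie_hom_def
    by (auto simp: ground_lie_def const_class_cyc_of const_F0 single_add mon_mult necklace_def simp del: L_simps(1))
       (auto simp: const_F0)
  show "inj_on (const_class A) (carrier ground_lie)"
  proof (rule inj_onI)
    fix c d assume "const_class A c = const_class A d"
    then have "(mon [] c - mon [] d :: ('m \<times> bool, 'k) forms) \<in> scom UNIV" by (simp add: const_class_cyc_of cyc_of_eq_iff const_F0)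
    from scom_lookup_Nil[OF this] show "c = d" by (simp add: lookup_minus)
  qed
  show "const_class A ` carrier ground_lie = {g \<in> carrier L. ham A \<omega> g = \<zero>\<^bsub>H\<^esub>}"
  proof (intro subset_antisym subsetI)
    fix g assume "g \<in> const_class A ` carrier ground_lie"
    then obtain c where "g = cyc_of (mon [] c)" by (auto simp: const_class_cyc_of)
    then show "g \<in> {g \<in> carrier L. ham A \<omega> g = \<zero>\<^bsub>H\<^esub>}" using ham_zero_iff[OF const_F0] by (simp add: const_F0 ham_field_0)
  next
    fix g assume "g \<in> {g \<in> carrier L. ham A \<omega> g = \<zero>\<^bsub>H\<^esub>}"
    then obtain p where p: "p \<in> F0" "g = cyc_of p" "ham_field p = (\<lambda>_. 0)" using ham_zero_iff by auto
    have "- dd p \<in> scom UNIV" using ham_field(2)[OF p(1)] p(3) by (simp add: ii_zero_field)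
    then have "dd p \<in> scom UNIV" using scom_minus by fastforce
    from dd_scom_exact[OF p(1) this] have "p - mon [] (Poly_Mapping.lookup p []) \<in> scom UNIV"
      using euler_hforms(2)[OF p(1)] by (simp add: unscale_def additive.zero[OF wscale_additive])
    then have "g = const_class A (Poly_Mapping.lookup p [])"
      using p by (simp add: const_class_cyc_of cyc_of_eq_iff const_F0)
    then show "g \<in> const_class A ` carrier ground_lie" by (simp add: ground_lie_def)
  qed
  show "\<forall>c\<in>carrier ground_lie. \<forall>g\<in>carrier L. lie_bracket L (const_class A c) g = \<zero>\<^bsub>L\<^esub>"
    by (auto simp: const_class_cyc_of const_F0 necklace_def ham_field_0 ii_zero_field)
qed

end

section \<open>The canonical form in given coordinates\<close>

text \<open>The two families of coordinates combine to one basis indexed by \<open>{1..n} \<times> bool\<close>.\<close>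

lemma symp_of_linear_coordinates:
  fixes s :: "'k::field_char_0 \<Rightarrow> 'e::ab_group_add \<Rightarrow> 'e"
  assumes vs: "vector_space s" and lc: "linear_coordinates s n x y"
  shows "symp s {1..n} (\<lambda>(m, b). if b then y m else x m)"
proof -
  let ?z = "\<lambda>(m, b). if b then y m else x m"
  have im: "?z ` ({1..n} \<times> UNIV) = x ` {1..n} \<union> y ` {1..n}"
  proof (intro subset_antisym subsetI)
    fix u assume "u \<in> x ` {1..n} \<union> y ` {1..n}"
    then obtain m where "m \<in> {1..n}" "u = x m \<or> u = y m" by blast
    then show "u \<in> ?z ` ({1..n} \<times> UNIV)"
      by (elim disjE) (auto intro: image_eqI[of _ _ "(m, False)"] image_eqI[of _ _ "(m, True)"])
  qed auto
  note d = lc[unfolded linear_coordinates_def Let_def]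
  have "inj_on ?z ({1..n} \<times> UNIV)"
  proof (rule inj_onI, clarify)
    fix m b m' b' assume m: "m \<in> {1..n}" "m' \<in> {1..n}" and e: "(if b then y m else x m) = (if b' then y m' else x m')"
    have "x m \<noteq> y m'" "y m \<noteq> x m'" using d m by blast+
    moreover have "x m = x m' \<Longrightarrow> m = m'" "y m = y m' \<Longrightarrow> m = m'" using d m by (auto dest: inj_onD)
    ultimately show "m = m' \<and> b = b'" using e by (cases b; cases b') auto
  qed
  then show ?thesis
    using vs d by (intro symp.intro coords.intro symp_axioms.intro) (simp_all only: im, simp_all)
qed

lemma canonical_form_eq:
  fixes z :: "nat \<times> bool \<Rightarrow> 'e::ab_group_add \<Rightarrow> 'k::field_char_0"
  assumes "symp s {1..n} z" "\<And>m. z (m, False) = x m" "\<And>m. z (m, True) = y m"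
  shows "canonical_form s n x y = symp.\<omega> s {1..n} z"
proof -
  interpret symp s "{1..n}" z by fact
  let ?M = "{1..n}"
  let ?f = "\<lambda>i. dform A (coord s (x i)) \<otimes>\<^bsub>\<Omega>\<^esub> dform A (coord s (y i))"
  have zd: "x i \<in> dual_space s" "y i \<in> dual_space s" if "i \<in> ?M" for i
    using z_dual[of "(i, False)"] z_dual[of "(i, True)"] that assms(2,3)[of i] by simp_all
  have f: "?f \<in> ?M \<rightarrow> carrier \<Omega>" by (auto simp: zd)
  have "\<Psi> (finsum \<Omega> ?f ?M) = (\<Sum>i\<in>?M. \<Psi> (?f i))" by (rule PO.h_finsum[OF finite_M f])
  also have "\<dots> = om"
    unfolding omega0_def
  proof (rule sum.cong[OF refl])
    fix i assume i: "i \<in> ?M"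
    have "\<Phi> (coord s (x i)) = mon [Inl (i, False)] 1" "\<Phi> (coord s (y i)) = mon [Inl (i, True)] 1"
      using \<Phi>_coord_z[of "(i, False)"] \<Phi>_coord_z[of "(i, True)"] i assms(2,3)[of i] by simp_all
    then show "\<Psi> (?f i) = mon [Inr (i, False), Inr (i, True)] 1"
      using zd[OF i] by (simp add: \<Psi>_hom \<Psi>_dform mon_mult del: One_nat_def)
  qed
  finally have "\<Psi> (finsum \<Omega> ?f ?M) = om" .
  moreover have "finsum \<Omega> ?f ?M \<in> carrier \<Omega>" using f by (rule Om0.finsum_closed)
  ultimately show ?thesis
    unfolding canonical_form_def Let_def \<omega>_def using DR_class_eq[of "finsum \<Omega> ?f ?M"] by simp
qed

theorem proposition14p2p2:
  fixes scaleE :: "'k :: {alg_closed_field, field_char_0} \<Rightarrow> 'e :: ab_group_add \<Rightarrow> 'e"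
    and n :: nat
    and x y :: "nat \<Rightarrow> 'e \<Rightarrow> 'k"
  assumes "\<exists>B. finite_dimensional_vector_space scaleE B"
    and "linear_coordinates scaleE n x y"
  defines "A \<equiv> tensor_algebra_dual scaleE"
    and "\<omega> \<equiv> canonical_form scaleE n x y"
  shows "nc_symplectic A \<omega> \<and>
    lie_central_extension ground_lie (const_class A) (cyc_lie A \<omega>) (ham A \<omega>) (Der_omega A \<omega>)"
proof -
  have "vector_space scaleE"
    using assms(1) finite_dimensional_vector_space.axioms(1) by blast
  then interpret S: symp scaleE "{1..n}" "\<lambda>(m, b). if b then y m else x m"
    using assms(2) by (rule symp_of_linear_coordinates)
  have "\<omega> = S.\<omega>" unfolding \<omega>_def by (rule canonical_form_eq[OF S.symp_axioms]) simp_all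
  then show ?thesis unfolding A_def using S.nc_symplectic S.central_extension by simp
qed

end
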